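(* Let $k$ be a field and let $A$ be a finite dimensional $k$-algebra with radical $r=r(A)$ satisfying $r^2=0$, and assume that $A$ is splitting over its radical $r$. Let $A/r=\bigoplus_{i=1}^{m}\overline{A}_i$ with $\overline{A}_i$ simple algebras, let $\mathcal{A}=\{\overline{A}_1,\dots,\overline{A}_m\}$, let $\Delta$ be the quiver of $A$, and let $\widetilde{\varphi}:k(\Delta,\mathcal{A})\to T(A/r,r)$ be the surjective algebra homomorphism described in the context. Then there is a set $\rho$ of relations on $k(\Delta,\mathcal{A})$ such that $$A\cong k(\Delta,\mathcal{A},\rho)\quad\text{as } k\text{-algebras, with}\quad \widetilde J^{2}\subset\langle\rho\rangle\subset \widetilde J^{2}+\widetilde J\cap \mathrm{Ker}\,\widetilde{\varphi}.$$
   Context: Algebras are associative with identity, modules are unital, $\subset$ denotes not necessarily strict inclusion. Splitting: $A$ is splitting over its radical $r$ if $A=B\oplus r$ as $k$-spaces for some subalgebra $B$ of $A$ isomorphic to $A/r$ (equivalently, there is an algebra morphism $\varepsilon:A/r\to A$ with $\eta\varepsilon=1$, $\eta:A\to A/r$ canonical). Rank: the rank of a finitely generated bimodule is the least cardinality of a generating set (zero bimodule: rank $0$). Quiver of $A$: since $r^2=0$, $r$ is an $A/r$-bimodule via $\bar x\cdot y=xy$, $y\cdot\bar x=yx$. Put ${}_iM_j=\overline{A}_i\cdot r\cdot\overline{A}_j$, so $r=\bigoplus_{i,j}{}_iM_j$. The quiver $\Delta$ has vertices $1,\dots,m$ and the number of arrows from $i$ to $j$ is the rank of ${}_iM_j$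 as an $\overline{A}_i$-$\overline{A}_j$-bimodule. Generalized path algebra: for a finite quiver $\Delta=(\Delta_0,\Delta_1)$ (an arrow $\beta$ goes from $s(\beta)$ to $e(\beta)$; paths $\beta_1\cdots\beta_n$ satisfy $e(\beta_i)=s(\beta_{i+1})$) and a family $\mathcal{A}=\{A_i:i\in\Delta_0\}$ of $k$-algebras with identities $e_i$, an $\mathcal{A}$-path of length $0$ is an element of $\bigcup_iA_i$ (elements of $A_i$ start and end at $i$), and an $\mathcal{A}$-path of length $n\ge1$ is $a_1\beta_1a_2\beta_2\cdots a_n\beta_na_{n+1}$ with $\beta_1\cdots\beta_n$ a path in $\Delta$, $a_i\in A_{s(\beta_i)}$ for $i\le n$, and $a_{n+1}\in A_{e(\beta_n)}$. $k(\Delta,\mathcal{A})$ is the $k$-space spanned by all $\mathcal{A}$-paths modulo $k$-multilinearity in the entries $a_i$, with product $(a_1\beta_1\cdots\beta_na_{n+1})(b_1\gamma_1\cdots\gamma_mb_{m+1})=a_1\beta_1\cdots\beta_n(a_{n+1}b_1)\gamma_1\cdots\gamma_mb_{m+1}$ if $a_{n+1},b_1$ lie in the same $A_i$, and $0$ otherwise. $\widetilde J$ is the ideal generated by all $\mathcal{A}$-paths of length $1$. A relation on $k(\Delta,\mathcal{A})$ is a $k$-linear combination of $\mathcal{A}$-paths with the same start vertex and the same end vertex; $\langle\rho\rangle$ is the ideal generated by $\rho$, and $k(\Delta,\mathcal{A},\rho)=k(\Delta,\mathcal{A})/\langle\rho\rangle$. Tensor algebra and $\widetilde\varphi$: $T(A/r,r)=A/r\oplus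 r\oplus (r\otimes_{A/r}r)\oplus\cdots$ is the tensor algebra of the $A/r$-bimodule $r$. For each $(i,j)$ fix a generating set of ${}_iM_j$ with cardinality equal to its rank, and a bijection between the arrows $i\to j$ and this set; $\widetilde{\varphi}:k(\Delta,\mathcal{A})\to T(A/r,r)$ is the $k$-algebra homomorphism that is the identity on $\bigoplus_i\overline{A}_i=A/r$ and sends each arrow (with identity entries) to the corresponding generator. *)

theory Defs
  imports
    "HOL-Algebra.Module"
    "HOL-Algebra.QuotRing"
    "HOL-Algebra.Subrings"
    "HOL-Algebra.Ideal_Product"
    "Graph_Theory.Arc_Walk"
begin

section \<open>Associative algebras over a commutative ring\<close>

text \<open>The locale \<open>algebra\<close> of HOL-Algebra is about commutative algebras; here the
  multiplication need not commute.\<close>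

locale assoc_algebra = module R M + M: ring M for R (structure) and M (structure) +
  assumes smult_mult_left:
      "\<lbrakk>c \<in> carrier R; x \<in> carrier M; y \<in> carrier M\<rbrakk> \<Longrightarrow>
        (c \<odot>\<^bsub>M\<^esub> x) \<otimes>\<^bsub>M\<^esub> y = c \<odot>\<^bsub>M\<^esub> (x \<otimes>\<^bsub>M\<^esub> y)"
    and smult_mult_right:
      "\<lbrakk>c \<in> carrier R; x \<in> carrier M; y \<in> carrier M\<rbrakk> \<Longrightarrow>
        x \<otimes>\<^bsub>M\<^esub> (c \<odot>\<^bsub>M\<^esub> y) = c \<odot>\<^bsub>M\<^esub> (x \<otimes>\<^bsub>M\<^esub> y)"

definition lin_span ::
  "('k, 'x) ring_scheme \<Rightarrow> ('k, 'a, 'y) module_scheme \<Rightarrow> 'a set \<Rightarrow> 'a set"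
  where "lin_span K V X = \<Inter>{N. submodule N K V \<and> X \<subseteq> N}"

definition fin_dim :: "('k, 'x) ring_scheme \<Rightarrow> ('k, 'a, 'y) module_scheme \<Rightarrow> bool"
  where "fin_dim K V \<longleftrightarrow> (\<exists>X. finite X \<and> X \<subseteq> carrier V \<and> lin_span K V X = carrier V)"

definition alg_hom ::
  "('k, 'x) ring_scheme \<Rightarrow> ('k, 'a, 'y) module_scheme \<Rightarrow> ('k, 'b, 'z) module_scheme \<Rightarrow> ('a \<Rightarrow> 'b) set"
  where "alg_hom K A B =
    {h \<in> ring_hom A B. \<forall>c \<in> carrier K. \<forall>x \<in> carrier A. h (c \<odot>\<^bsub>A\<^esub> x) = c \<odot>\<^bsub>B\<^esub> h x}"

definition alg_isomorphic ::
  "('k, 'x) ring_scheme \<Rightarrow> ('k, 'a, 'y) module_scheme \<Rightarrow> ('k, 'b, 'z) module_scheme \<Rightarrow> bool"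
  where "alg_isomorphic K A B \<longleftrightarrow> (\<exists>h \<in> alg_hom K A B. bij_betw h (carrier A) (carrier B))"

definition quotient_algebra ::
  "('k, 'a, 'y) module_scheme \<Rightarrow> 'a set \<Rightarrow> ('k, 'a set) module"
  where "quotient_algebra A I =
    ring.extend (A Quot I) (module.fields (\<lambda>c X. \<Union>x\<in>X. I +>\<^bsub>A\<^esub> (c \<odot>\<^bsub>A\<^esub> x)))"

definition simple_algebra :: "('k, 'x) ring_scheme \<Rightarrow> ('k, 'a, 'y) module_scheme \<Rightarrow> bool"
  where "simple_algebra K B \<longleftrightarrow> assoc_algebra K B \<and> carrier B \<noteq> {\<zero>\<^bsub>B\<^esub>} \<and>
    (\<forall>I. ideal I B \<longrightarrow> I = {\<zero>\<^bsub>B\<^esub>} \<or> I = carrier B)"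

text \<open>The family \<open>C 1, \<dots>, C m\<close> of two-sided ideals of \<open>S\<close>, with identities
  \<open>e 1, \<dots>, e m\<close>, decomposes \<open>S\<close> as a direct sum of simple algebras. The
  summands do not contain the identity of \<open>S\<close> in general, hence the change of \<open>one\<close>.\<close>

definition component_algebra ::
  "('k, 'a, 'y) module_scheme \<Rightarrow> (nat \<Rightarrow> 'a set) \<Rightarrow> (nat \<Rightarrow> 'a) \<Rightarrow> nat \<Rightarrow> ('k, 'a, 'y) module_scheme"
  where "component_algebra S C e i = S\<lparr>carrier := C i, one := e i\<rparr>"

definition simple_decomposition ::
  "('k, 'x) ring_scheme \<Rightarrow> ('k, 'a, 'y) module_scheme \<Rightarrow> nat \<Rightarrow> (nat \<Rightarrow> 'a set) \<Rightarrow> (nat \<Rightarrow> 'a) \<Rightarrow> bool"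
  where "simple_decomposition K S m C e \<longleftrightarrow>
    (\<forall>i \<in> {1..m}. ideal (C i) S \<and> simple_algebra K (component_algebra S C e i)) \<and>
    (\<forall>x \<in> carrier S. \<exists>!f. f \<in> (\<Pi>\<^sub>E i\<in>{1..m}. C i) \<and> x = (\<Oplus>\<^bsub>S\<^esub>i\<in>{1..m}. f i))"


section \<open>The radical\<close>

definition left_ideal :: "'a set \<Rightarrow> ('a, 'y) ring_scheme \<Rightarrow> bool"
  where "left_ideal L A \<longleftrightarrow> additive_subgroup L A \<and>
    (\<forall>a \<in> carrier A. \<forall>x \<in> L. a \<otimes>\<^bsub>A\<^esub> x \<in> L)"

definition maximal_left_ideal :: "'a set \<Rightarrow> ('a, 'y) ring_scheme \<Rightarrow> bool"
  where "maximal_left_ideal L A \<longleftrightarrow> left_ideal L A \<and> L \<noteq> carrier A \<and>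
    (\<forall>L'. left_ideal L' A \<and> L \<subseteq> L' \<longrightarrow> L' = L \<or> L' = carrier A)"

definition radical :: "('a, 'y) ring_scheme \<Rightarrow> 'a set"
  where "radical A = {x \<in> carrier A. \<forall>L. maximal_left_ideal L A \<longrightarrow> x \<in> L}"

definition splits_over_radical :: "('k, 'x) ring_scheme \<Rightarrow> ('k, 'a, 'y) module_scheme \<Rightarrow> bool"
  where "splits_over_radical K A \<longleftrightarrow>
    (\<exists>B. subring B A \<and> submodule B K A \<and>
      B <+>\<^bsub>A\<^esub> radical A = carrier A \<and> B \<inter> radical A = {\<zero>\<^bsub>A\<^esub>} \<and>
      alg_isomorphic K (A\<lparr>carrier := B\<rparr>) (quotient_algebra A (radical A)))"


section \<open>Bimodules and the quiver of an algebra with radical square zero\<close>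

text \<open>When the square of the radical vanishes, \<open>x \<otimes> y\<close> for \<open>y\<close> in the radical depends only
  on the coset \<open>X\<close> of \<open>x\<close>, so the sets below are singletons.\<close>

definition coset_lact :: "('a, 'y) ring_scheme \<Rightarrow> 'a set \<Rightarrow> 'a \<Rightarrow> 'a"
  where "coset_lact A X y = the_elem ((\<lambda>x. x \<otimes>\<^bsub>A\<^esub> y) ` X)"

definition coset_ract :: "('a, 'y) ring_scheme \<Rightarrow> 'a \<Rightarrow> 'a set \<Rightarrow> 'a"
  where "coset_ract A y X = the_elem ((\<lambda>x. y \<otimes>\<^bsub>A\<^esub> x) ` X)"

text \<open>\<open>P\<close> and \<open>Q\<close> are the carriers of the rings acting on \<open>M\<close> via \<open>l\<close> (left) and \<open>r\<close> (right).\<close>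

definition bimodule_span ::
  "('s \<Rightarrow> 'a \<Rightarrow> 'a) \<Rightarrow> ('a \<Rightarrow> 't \<Rightarrow> 'a) \<Rightarrow> 's set \<Rightarrow> 't set \<Rightarrow> ('a, 'y) ring_scheme \<Rightarrow> 'a set \<Rightarrow> 'a set"
  where "bimodule_span l r P Q M X =
    \<Inter>{N. additive_subgroup N M \<and> X \<subseteq> N \<and>
        (\<forall>p \<in> P. \<forall>y \<in> N. l p y \<in> N) \<and> (\<forall>q \<in> Q. \<forall>y \<in> N. r y q \<in> N)}"

definition bimodule_generators ::
  "('s \<Rightarrow> 'a \<Rightarrow> 'a) \<Rightarrow> ('a \<Rightarrow> 't \<Rightarrow> 'a) \<Rightarrow> 's set \<Rightarrow> 't set \<Rightarrow> ('a, 'y) ring_scheme \<Rightarrow> 'a set \<Rightarrow> bool"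
  where "bimodule_generators l r P Q M X \<longleftrightarrow>
    X \<subseteq> carrier M \<and> bimodule_span l r P Q M X = carrier M"

definition bimodule_rank ::
  "('s \<Rightarrow> 'a \<Rightarrow> 'a) \<Rightarrow> ('a \<Rightarrow> 't \<Rightarrow> 'a) \<Rightarrow> 's set \<Rightarrow> 't set \<Rightarrow> ('a, 'y) ring_scheme \<Rightarrow> nat"
  where "bimodule_rank l r P Q M =
    (LEAST n. \<exists>X. finite X \<and> card X = n \<and> bimodule_generators l r P Q M X)"

definition radical_bimodule :: "('k, 'a, 'y) module_scheme \<Rightarrow> ('k, 'a, 'y) module_scheme"
  where "radical_bimodule A = A\<lparr>carrier := radical A\<rparr>"

text \<open>The bimodule \<open>\<^sub>iM\<^sub>j\<close>; as usual, a product of subspaces is the span of the products.\<close>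

definition radical_part ::
  "('k, 'x) ring_scheme \<Rightarrow> ('k, 'a, 'y) module_scheme \<Rightarrow> (nat \<Rightarrow> 'a set set) \<Rightarrow> nat \<Rightarrow> nat \<Rightarrow>
    ('k, 'a, 'y) module_scheme"
  where "radical_part K A C i j = A\<lparr>carrier := lin_span K A
    {coset_ract A (coset_lact A X y) Y | X y Y. X \<in> C i \<and> y \<in> radical A \<and> Y \<in> C j}\<rparr>"

definition arcs_between :: "('v, 'e) pre_digraph \<Rightarrow> 'v \<Rightarrow> 'v \<Rightarrow> 'e set"
  where "arcs_between \<Delta> i j = {\<beta> \<in> arcs \<Delta>. tail \<Delta> \<beta> = i \<and> head \<Delta> \<beta> = j}"

text \<open>The quiver of \<open>A\<close> is determined up to renaming its arrows.\<close>

definition is_quiver_of ::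
  "('k, 'x) ring_scheme \<Rightarrow> ('k, 'a, 'y) module_scheme \<Rightarrow> nat \<Rightarrow> (nat \<Rightarrow> 'a set set) \<Rightarrow>
    (nat, 'e) pre_digraph \<Rightarrow> bool"
  where "is_quiver_of K A m C \<Delta> \<longleftrightarrow> fin_digraph \<Delta> \<and> verts \<Delta> = {1..m} \<and>
    (\<forall>i \<in> {1..m}. \<forall>j \<in> {1..m}. card (arcs_between \<Delta> i j) =
      bimodule_rank (coset_lact A) (coset_ract A) (C i) (C j) (radical_part K A C i j))"


section \<open>Algebras spanned by words\<close>

text \<open>The vector space with basis \<open>W\<close> (finitely supported functions), multiplied by bilinear
  extension of the partial multiplication \<open>mul\<close> of words, an undefined product being zero.
  The identity is the sum of the words in the finite set \<open>E\<close>.\<close>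

definition word_algebra ::
  "('k, 'x) ring_scheme \<Rightarrow> 'w set \<Rightarrow> ('w \<Rightarrow> 'w \<Rightarrow> 'w option) \<Rightarrow> 'w set \<Rightarrow> ('k, 'w \<Rightarrow> 'k) module"
  where "word_algebra K W mul E =
    \<lparr> carrier = {f. (\<forall>w. f w \<in> carrier K) \<and> (\<forall>w. w \<notin> W \<longrightarrow> f w = \<zero>\<^bsub>K\<^esub>) \<and> finite {w. f w \<noteq> \<zero>\<^bsub>K\<^esub>}},
      mult = (\<lambda>f g w. \<Oplus>\<^bsub>K\<^esub>p \<in> {(u, v). f u \<noteq> \<zero>\<^bsub>K\<^esub> \<and> g v \<noteq> \<zero>\<^bsub>K\<^esub> \<and> mul u v = Some w}.
        f (fst p) \<otimes>\<^bsub>K\<^esub> g (snd p)),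
      one = (\<lambda>w. if w \<in> E then \<one>\<^bsub>K\<^esub> else \<zero>\<^bsub>K\<^esub>),
      zero = (\<lambda>w. \<zero>\<^bsub>K\<^esub>),
      add = (\<lambda>f g w. f w \<oplus>\<^bsub>K\<^esub> g w),
      smult = (\<lambda>c f w. c \<otimes>\<^bsub>K\<^esub> f w) \<rparr>"

definition single_word :: "('k, 'x) ring_scheme \<Rightarrow> 'w \<Rightarrow> 'w \<Rightarrow> 'k"
  where "single_word K u = (\<lambda>w. if w = u then \<one>\<^bsub>K\<^esub> else \<zero>\<^bsub>K\<^esub>)"


section \<open>Generalized path algebras\<close>

text \<open>\<open>(i, a\<^sub>1, [(\<beta>\<^sub>1, a\<^sub>2), \<dots>, (\<beta>\<^sub>n, a\<^bsub>n+1\<^esub>)])\<close> represents the path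
  \<open>a\<^sub>1 \<beta>\<^sub>1 a\<^sub>2 \<dots> \<beta>\<^sub>n a\<^bsub>n+1\<^esub>\<close> starting at the vertex \<open>i\<close>. The entry following \<open>\<beta>\<close> lives at
  \<open>head \<beta>\<close>, which is the tail of the next arrow if there is one.\<close>

type_synonym ('v, 'a, 'e) gpath = "'v \<times> 'a \<times> ('e \<times> 'a) list"

definition gpaths_between ::
  "('v, 'e) pre_digraph \<Rightarrow> ('v \<Rightarrow> ('k, 'a, 'y) module_scheme) \<Rightarrow> 'v \<Rightarrow> 'v \<Rightarrow> ('v, 'a, 'e) gpath set"
  where "gpaths_between \<Delta> \<A> u v =
    {(u, a, ps) | a ps. pre_digraph.awalk \<Delta> u (map fst ps) v \<and> a \<in> carrier (\<A> u) \<and>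
      (\<forall>(\<beta>, b) \<in> set ps. b \<in> carrier (\<A> (head \<Delta> \<beta>)))}"

definition gpaths ::
  "('v, 'e) pre_digraph \<Rightarrow> ('v \<Rightarrow> ('k, 'a, 'y) module_scheme) \<Rightarrow> ('v, 'a, 'e) gpath set"
  where "gpaths \<Delta> \<A> = (\<Union>u \<in> verts \<Delta>. \<Union>v \<in> verts \<Delta>. gpaths_between \<Delta> \<A> u v)"

fun gpath_length :: "('v, 'a, 'e) gpath \<Rightarrow> nat"
  where "gpath_length (u, a, ps) = length ps"

fun gpath_mult ::
  "('v, 'e) pre_digraph \<Rightarrow> ('v \<Rightarrow> ('k, 'a, 'y) module_scheme) \<Rightarrow>
    ('v, 'a, 'e) gpath \<Rightarrow> ('v, 'a, 'e) gpath \<Rightarrow> ('v, 'a, 'e) gpath option"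
  where "gpath_mult \<Delta> \<A> (u, a, ps) (v, b, qs) =
    (if pre_digraph.awlast \<Delta> u (map fst ps) \<noteq> v then None
     else if ps = [] then Some (u, a \<otimes>\<^bsub>\<A> v\<^esub> b, qs)
     else Some (u, a, butlast ps @ (fst (last ps), snd (last ps) \<otimes>\<^bsub>\<A> v\<^esub> b) # qs))"

text \<open>The entries of a path of length \<open>n\<close> are numbered \<open>0, \<dots>, n\<close>.\<close>

fun entry_vertex :: "('v, 'e) pre_digraph \<Rightarrow> ('v, 'a, 'e) gpath \<Rightarrow> nat \<Rightarrow> 'v"
  where
    "entry_vertex \<Delta> (u, a, ps) 0 = u"
  | "entry_vertex \<Delta> (u, a, ps) (Suc t) = head \<Delta> (fst (ps ! t))"

fun set_entry :: "('v, 'a, 'e) gpath \<Rightarrow> nat \<Rightarrow> 'a \<Rightarrow> ('v, 'a, 'e) gpath"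
  where
    "set_entry (u, a, ps) 0 x = (u, x, ps)"
  | "set_entry (u, a, ps) (Suc t) x = (u, a, ps[t := (fst (ps ! t), x)])"

definition gpath_word_algebra ::
  "('k, 'x) ring_scheme \<Rightarrow> ('v, 'e) pre_digraph \<Rightarrow> ('v \<Rightarrow> ('k, 'a, 'y) module_scheme) \<Rightarrow>
    ('k, ('v, 'a, 'e) gpath \<Rightarrow> 'k) module"
  where "gpath_word_algebra K \<Delta> \<A> =
    word_algebra K (gpaths \<Delta> \<A>) (gpath_mult \<Delta> \<A>) {(i, \<one>\<^bsub>\<A> i\<^esub>, []) | i. i \<in> verts \<Delta>}"

definition gpath_multilinearity ::
  "('k, 'x) ring_scheme \<Rightarrow> ('v, 'e) pre_digraph \<Rightarrow> ('v \<Rightarrow> ('k, 'a, 'y) module_scheme) \<Rightarrow>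
    (('v, 'a, 'e) gpath \<Rightarrow> 'k) set"
  where "gpath_multilinearity K \<Delta> \<A> = (let F = gpath_word_algebra K \<Delta> \<A> in lin_span K F
    ({single_word K (set_entry p t (x \<oplus>\<^bsub>\<A> (entry_vertex \<Delta> p t)\<^esub> y)) \<ominus>\<^bsub>F\<^esub>
        (single_word K (set_entry p t x) \<oplus>\<^bsub>F\<^esub> single_word K (set_entry p t y)) | p t x y.
        p \<in> gpaths \<Delta> \<A> \<and> t \<le> gpath_length p \<and>
        x \<in> carrier (\<A> (entry_vertex \<Delta> p t)) \<and> y \<in> carrier (\<A> (entry_vertex \<Delta> p t))} \<union>
     {single_word K (set_entry p t (c \<odot>\<^bsub>\<A> (entry_vertex \<Delta> p t)\<^esub> x)) \<ominus>\<^bsub>F\<^esub>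
        c \<odot>\<^bsub>F\<^esub> single_word K (set_entry p t x) | p t c x.
        p \<in> gpaths \<Delta> \<A> \<and> t \<le> gpath_length p \<and>
        c \<in> carrier K \<and> x \<in> carrier (\<A> (entry_vertex \<Delta> p t))}))"

definition gpath_algebra ::
  "('k, 'x) ring_scheme \<Rightarrow> ('v, 'e) pre_digraph \<Rightarrow> ('v \<Rightarrow> ('k, 'a, 'y) module_scheme) \<Rightarrow>
    ('k, (('v, 'a, 'e) gpath \<Rightarrow> 'k) set) module"
  where "gpath_algebra K \<Delta> \<A> =
    quotient_algebra (gpath_word_algebra K \<Delta> \<A>) (gpath_multilinearity K \<Delta> \<A>)"

definition gpath_class ::
  "('k, 'x) ring_scheme \<Rightarrow> ('v, 'e) pre_digraph \<Rightarrow> ('v \<Rightarrow> ('k, 'a, 'y) module_scheme) \<Rightarrow>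
    ('v, 'a, 'e) gpath \<Rightarrow> (('v, 'a, 'e) gpath \<Rightarrow> 'k) set"
  where "gpath_class K \<Delta> \<A> p =
    gpath_multilinearity K \<Delta> \<A> +>\<^bsub>gpath_word_algebra K \<Delta> \<A>\<^esub> single_word K p"

definition gpath_arrow_ideal ::
  "('k, 'x) ring_scheme \<Rightarrow> ('v, 'e) pre_digraph \<Rightarrow> ('v \<Rightarrow> ('k, 'a, 'y) module_scheme) \<Rightarrow>
    (('v, 'a, 'e) gpath \<Rightarrow> 'k) set set"
  where "gpath_arrow_ideal K \<Delta> \<A> =
    Idl\<^bsub>gpath_algebra K \<Delta> \<A>\<^esub> (gpath_class K \<Delta> \<A> ` {p \<in> gpaths \<Delta> \<A>. gpath_length p = 1})"

definition gpath_relations ::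
  "('k, 'x) ring_scheme \<Rightarrow> ('v, 'e) pre_digraph \<Rightarrow> ('v \<Rightarrow> ('k, 'a, 'y) module_scheme) \<Rightarrow>
    (('v, 'a, 'e) gpath \<Rightarrow> 'k) set set"
  where "gpath_relations K \<Delta> \<A> = (\<Union>u \<in> verts \<Delta>. \<Union>v \<in> verts \<Delta>.
    lin_span K (gpath_algebra K \<Delta> \<A>) (gpath_class K \<Delta> \<A> ` gpaths_between \<Delta> \<A> u v))"


section \<open>Tensor algebras\<close>

text \<open>The tensor algebra of an \<open>S\<close>-bimodule \<open>M\<close> over a \<open>K\<close>-algebra \<open>S\<close>. The word
  \<open>Tensor [y\<^sub>1, \<dots>, y\<^sub>n]\<close> with \<open>n \<ge> 1\<close> stands for the pure tensor of degree \<open>n\<close>; the \<open>n\<close>-th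
  tensor power is spanned by these words modulo \<open>K\<close>-multilinearity and balancedness over \<open>S\<close>.\<close>

datatype ('s, 'a) tensor_word = Scalar 's | Tensor "'a list"

definition tensor_words ::
  "('s, 'z) ring_scheme \<Rightarrow> ('a, 'y) ring_scheme \<Rightarrow> ('s, 'a) tensor_word set"
  where "tensor_words S M =
    Scalar ` carrier S \<union> Tensor ` {ys. ys \<noteq> [] \<and> set ys \<subseteq> carrier M}"

fun tensor_word_mult ::
  "('s, 'z) ring_scheme \<Rightarrow> ('s \<Rightarrow> 'a \<Rightarrow> 'a) \<Rightarrow> ('a \<Rightarrow> 's \<Rightarrow> 'a) \<Rightarrow>
    ('s, 'a) tensor_word \<Rightarrow> ('s, 'a) tensor_word \<Rightarrow> ('s, 'a) tensor_word"
  where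
    "tensor_word_mult S l r (Scalar a) (Scalar b) = Scalar (a \<otimes>\<^bsub>S\<^esub> b)"
  | "tensor_word_mult S l r (Scalar a) (Tensor ys) = Tensor (l a (hd ys) # tl ys)"
  | "tensor_word_mult S l r (Tensor ys) (Scalar b) = Tensor (butlast ys @ [r (last ys) b])"
  | "tensor_word_mult S l r (Tensor ys) (Tensor zs) = Tensor (ys @ zs)"

definition tensor_word_algebra ::
  "('k, 'x) ring_scheme \<Rightarrow> ('k, 's, 'z) module_scheme \<Rightarrow> ('k, 'a, 'y) module_scheme \<Rightarrow>
    ('s \<Rightarrow> 'a \<Rightarrow> 'a) \<Rightarrow> ('a \<Rightarrow> 's \<Rightarrow> 'a) \<Rightarrow> ('k, ('s, 'a) tensor_word \<Rightarrow> 'k) module"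
  where "tensor_word_algebra K S M l r =
    word_algebra K (tensor_words S M) (\<lambda>u v. Some (tensor_word_mult S l r u v)) {Scalar \<one>\<^bsub>S\<^esub>}"

definition tensor_relators ::
  "('k, 'x) ring_scheme \<Rightarrow> ('k, 's, 'z) module_scheme \<Rightarrow> ('k, 'a, 'y) module_scheme \<Rightarrow>
    ('s \<Rightarrow> 'a \<Rightarrow> 'a) \<Rightarrow> ('a \<Rightarrow> 's \<Rightarrow> 'a) \<Rightarrow> (('s, 'a) tensor_word \<Rightarrow> 'k) set"
  where "tensor_relators K S M l r = (let F = tensor_word_algebra K S M l r in lin_span K F
    ({single_word K (Scalar (a \<oplus>\<^bsub>S\<^esub> b)) \<ominus>\<^bsub>F\<^esub>
        (single_word K (Scalar a) \<oplus>\<^bsub>F\<^esub> single_word K (Scalar b)) | a b.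
        a \<in> carrier S \<and> b \<in> carrier S} \<union>
     {single_word K (Scalar (c \<odot>\<^bsub>S\<^esub> a)) \<ominus>\<^bsub>F\<^esub> c \<odot>\<^bsub>F\<^esub> single_word K (Scalar a) | c a.
        c \<in> carrier K \<and> a \<in> carrier S} \<union>
     {single_word K (Tensor (ys[t := y \<oplus>\<^bsub>M\<^esub> z])) \<ominus>\<^bsub>F\<^esub>
        (single_word K (Tensor (ys[t := y])) \<oplus>\<^bsub>F\<^esub> single_word K (Tensor (ys[t := z]))) | ys t y z.
        set ys \<subseteq> carrier M \<and> t < length ys \<and> y \<in> carrier M \<and> z \<in> carrier M} \<union>
     {single_word K (Tensor (ys[t := c \<odot>\<^bsub>M\<^esub> y])) \<ominus>\<^bsub>F\<^esub>
        c \<odot>\<^bsub>F\<^esub> single_word K (Tensor (ys[t := y])) | ys t c y.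
        set ys \<subseteq> carrier M \<and> t < length ys \<and> c \<in> carrier K \<and> y \<in> carrier M} \<union>
     {single_word K (Tensor (ys[t := r (ys ! t) a])) \<ominus>\<^bsub>F\<^esub>
        single_word K (Tensor (ys[Suc t := l a (ys ! Suc t)])) | ys t a.
        set ys \<subseteq> carrier M \<and> Suc t < length ys \<and> a \<in> carrier S}))"

definition tensor_algebra ::
  "('k, 'x) ring_scheme \<Rightarrow> ('k, 's, 'z) module_scheme \<Rightarrow> ('k, 'a, 'y) module_scheme \<Rightarrow>
    ('s \<Rightarrow> 'a \<Rightarrow> 'a) \<Rightarrow> ('a \<Rightarrow> 's \<Rightarrow> 'a) \<Rightarrow> ('k, (('s, 'a) tensor_word \<Rightarrow> 'k) set) module"
  where "tensor_algebra K S M l r =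
    quotient_algebra (tensor_word_algebra K S M l r) (tensor_relators K S M l r)"

definition tensor_class ::
  "('k, 'x) ring_scheme \<Rightarrow> ('k, 's, 'z) module_scheme \<Rightarrow> ('k, 'a, 'y) module_scheme \<Rightarrow>
    ('s \<Rightarrow> 'a \<Rightarrow> 'a) \<Rightarrow> ('a \<Rightarrow> 's \<Rightarrow> 'a) \<Rightarrow> ('s, 'a) tensor_word \<Rightarrow> (('s, 'a) tensor_word \<Rightarrow> 'k) set"
  where "tensor_class K S M l r w =
    tensor_relators K S M l r +>\<^bsub>tensor_word_algebra K S M l r\<^esub> single_word K w"


section \<open>The homomorphism from the generalized path algebra to the tensor algebra\<close>

text \<open>The choice of generators of the bimodules \<open>\<^sub>iM\<^sub>j\<close>, indexed by the arrows.\<close>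

definition arrow_generators ::
  "('k, 'x) ring_scheme \<Rightarrow> ('k, 'a, 'y) module_scheme \<Rightarrow> nat \<Rightarrow> (nat \<Rightarrow> 'a set set) \<Rightarrow>
    (nat, 'e) pre_digraph \<Rightarrow> (nat \<Rightarrow> nat \<Rightarrow> 'a set) \<Rightarrow> ('e \<Rightarrow> 'a) \<Rightarrow> bool"
  where "arrow_generators K A m C \<Delta> X g \<longleftrightarrow> (\<forall>i \<in> {1..m}. \<forall>j \<in> {1..m}.
    bimodule_generators (coset_lact A) (coset_ract A) (C i) (C j) (radical_part K A C i j) (X i j) \<and>
    finite (X i j) \<and>
    card (X i j) = bimodule_rank (coset_lact A) (coset_ract A) (C i) (C j) (radical_part K A C i j) \<and>
    bij_betw g (arcs_between \<Delta> i j) (X i j))"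

definition radical_tensor_algebra ::
  "('k, 'x) ring_scheme \<Rightarrow> ('k, 'a, 'y) module_scheme \<Rightarrow>
    ('k, (('a set, 'a) tensor_word \<Rightarrow> 'k) set) module"
  where "radical_tensor_algebra K A = tensor_algebra K (quotient_algebra A (radical A))
    (radical_bimodule A) (coset_lact A) (coset_ract A)"

definition radical_tensor_class ::
  "('k, 'x) ring_scheme \<Rightarrow> ('k, 'a, 'y) module_scheme \<Rightarrow> ('a set, 'a) tensor_word \<Rightarrow>
    (('a set, 'a) tensor_word \<Rightarrow> 'k) set"
  where "radical_tensor_class K A = tensor_class K (quotient_algebra A (radical A))
    (radical_bimodule A) (coset_lact A) (coset_ract A)"

text \<open>These conditions determine \<open>\<phi>\<close> on the carrier, since the paths of length at most one
  occurring here generate the generalized path algebra.\<close>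

definition is_phi_tilde ::
  "('k, 'x) ring_scheme \<Rightarrow> ('k, 'a, 'y) module_scheme \<Rightarrow> (nat, 'e) pre_digraph \<Rightarrow>
    (nat \<Rightarrow> ('k, 'a set, 'z) module_scheme) \<Rightarrow> ('e \<Rightarrow> 'a) \<Rightarrow>
    (((nat, 'a set, 'e) gpath \<Rightarrow> 'k) set \<Rightarrow> (('a set, 'a) tensor_word \<Rightarrow> 'k) set) \<Rightarrow> bool"
  where "is_phi_tilde K A \<Delta> \<A> g \<phi> \<longleftrightarrow>
    \<phi> \<in> alg_hom K (gpath_algebra K \<Delta> \<A>) (radical_tensor_algebra K A) \<and>
    (\<forall>i \<in> verts \<Delta>. \<forall>a \<in> carrier (\<A> i).
      \<phi> (gpath_class K \<Delta> \<A> (i, a, [])) = radical_tensor_class K A (Scalar a)) \<and>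
    (\<forall>\<beta> \<in> arcs \<Delta>.
      \<phi> (gpath_class K \<Delta> \<A> (tail \<Delta> \<beta>, \<one>\<^bsub>\<A> (tail \<Delta> \<beta>)\<^esub>, [(\<beta>, \<one>\<^bsub>\<A> (head \<Delta> \<beta>)\<^esub>)])) =
        radical_tensor_class K A (Tensor [g \<beta>]))"

end

theory Submission
  imports Defs
begin

text \<open>A splitting \<open>\<epsilon>\<close> of \<open>A \<rightarrow> A/r\<close> together with the chosen generators of the bimodules \<open>\<^sub>iM\<^sub>j\<close>
  defines an algebra morphism \<open>\<psi>\<close> from the generalized path algebra to \<open>A\<close>, which is onto because
  \<open>r\<close> is the sum of the \<open>\<^sub>iM\<^sub>j\<close>. Multiplying by the vertex idempotents on both sides shows that
  every ideal of the generalized path algebra is generated by the relations that it contains, so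
  \<open>\<rho>\<close> can be taken to be the relations in the kernel of \<open>\<psi>\<close>. As \<open>r\<^sup>2 = 0\<close>, the kernel contains
  the square of the arrow ideal. Conversely, in degree one \<open>\<phi>\<close> and \<open>\<psi>\<close> both amount to evaluation
  in \<open>r\<close>, while in degree zero \<open>\<psi>\<close> is \<open>\<epsilon>\<close>, whose image meets \<open>r\<close> trivially: an element of the
  kernel of \<open>\<psi>\<close> therefore has no part of degree zero, and \<open>\<phi>\<close> kills its part of degree one.\<close>

section \<open>Spans and quotient algebras\<close>

text \<open>The obstacle is well-definedness. The path algebra and the tensor algebra are quotients
  of spaces of finitely supported functions on words, so the multilinearity relators must be shown
  to span an ideal, and every map out of the path algebra must kill them. Both tasks become
  manageable when a path with one free entry is treated as a function of that entry. No grading of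
  the path algebra is constructed. It is enough that each element is, in at least one way, a sum of
  the image of some \<open>s\<close> in \<open>A/r\<close>, some \<open>y\<close> in the arrow ideal
  for which \<open>\<phi> y\<close> is the class of the tensor \<open>\<psi> y\<close>, and some
  \<open>z\<close> in the square of the arrow ideal. The condition on \<open>y\<close> is an
  equation between linear maps, hence stable under sums and scalars, so it only has to be checked on
  paths of length one. The tensor algebra is handled as a vector space. Since \<open>\<phi>\<close>
  is a homomorphism into it, the few products that occur are known in advance to be cosets, and a
  coset is determined by any one of its elements.\<close>

lemma (in module) lin_span_submodule:
  assumes "X \<subseteq> carrier M"
  shows "submodule (lin_span R M X) R M"
proof (rule submoduleI)
  have c: "submodule (carrier M) R M" by (rule carrier_is_submodule)
  show "lin_span R M X \<subseteq> carrier M"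
    using c assms unfolding lin_span_def by blast
  have "submodule N R M \<Longrightarrow> \<zero>\<^bsub>M\<^esub> \<in> N" for N
    using subgroup.one_closed[of N "add_monoid M"] by (simp add: submodule_def)
  then show "\<zero>\<^bsub>M\<^esub> \<in> lin_span R M X"
    unfolding lin_span_def by blast
qed (auto simp: lin_span_def submoduleE)

lemma lin_span_incl: "X \<subseteq> lin_span K V X"
  unfolding lin_span_def by blast

lemma lin_span_minimal: "submodule N K V \<Longrightarrow> X \<subseteq> N \<Longrightarrow> lin_span K V X \<subseteq> N"
  unfolding lin_span_def by blast

lemma (in module) submodule_zero: "submodule N R M \<Longrightarrow> \<zero>\<^bsub>M\<^esub> \<in> N"
  using subgroup.one_closed[of N "add_monoid M"] by (simp add: submodule_def)

text \<open>The elements satisfying \<open>P\<close> form a submodule; negatives come from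
  \<open>smult\<close> with the scalar \<open>\<ominus> \<one>\<close>.\<close>

lemma (in module) lin_span_induct [consumes 2, case_names base zero add smult]:
  assumes x: "x \<in> lin_span R M X" and X: "X \<subseteq> carrier M"
    and base: "\<And>x. x \<in> X \<Longrightarrow> P x"
    and zero: "P \<zero>\<^bsub>M\<^esub>"
    and add: "\<And>x y. x \<in> carrier M \<Longrightarrow> y \<in> carrier M \<Longrightarrow> P x \<Longrightarrow> P y \<Longrightarrow> P (x \<oplus>\<^bsub>M\<^esub> y)"
    and smult: "\<And>c x. c \<in> carrier R \<Longrightarrow> x \<in> carrier M \<Longrightarrow> P x \<Longrightarrow> P (c \<odot>\<^bsub>M\<^esub> x)"
  shows "P x"
proof -
  have "submodule {x \<in> carrier M. P x} R M"
  proof (rule submoduleI)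
    fix a assume a: "a \<in> {x \<in> carrier M. P x}"
    then have "\<ominus>\<^bsub>M\<^esub> a = (\<ominus> \<one>) \<odot>\<^bsub>M\<^esub> a" by (simp add: smult_l_minus)
    with a show "\<ominus>\<^bsub>M\<^esub> a \<in> {x \<in> carrier M. P x}" by (simp add: smult)
  qed (auto intro: zero add smult)
  moreover have "X \<subseteq> {x \<in> carrier M. P x}" using X base by auto
  ultimately show ?thesis using lin_span_minimal x by blast
qed

lemma (in module) submodule_abelian_subgroup:
  assumes "submodule N R M"
  shows "abelian_subgroup N M"
  using assms submodule.axioms(1) additive_subgroupI abelian_subgroupI3 M.abelian_group_axioms
  by blast

section \<open>Cosets of submodules and ideals, quotient algebras, homomorphisms of algebras\<close>

lemma quotient_algebra_carrier:
  "carrier (quotient_algebra A I) = (+>\<^bsub>A\<^esub>) I ` carrier A"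
  by (auto simp: quotient_algebra_def ring.extend_def module.fields_def FactRing_simps)

lemma quotient_algebra_one: "\<one>\<^bsub>quotient_algebra A I\<^esub> = I +>\<^bsub>A\<^esub> \<one>\<^bsub>A\<^esub>"
  by (simp add: quotient_algebra_def ring.extend_def module.fields_def FactRing_def)

lemma quotient_algebra_zero: "\<zero>\<^bsub>quotient_algebra A I\<^esub> = I"
  by (simp add: quotient_algebra_def ring.extend_def module.fields_def FactRing_def)

lemma quotient_algebra_mult: "(\<otimes>\<^bsub>quotient_algebra A I\<^esub>) = rcoset_mult A I"
  by (simp add: quotient_algebra_def ring.extend_def module.fields_def FactRing_def)

context module
begin

lemma quotient_algebra_add:
  assumes "submodule N R M" "x \<in> carrier M" "y \<in> carrier M"
  shows "(N +>\<^bsub>M\<^esub> x) \<oplus>\<^bsub>quotient_algebra M N\<^esub> (N +>\<^bsub>M\<^esub> y) = N +>\<^bsub>M\<^esub> (x \<oplus>\<^bsub>M\<^esub> y)"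
  using abelian_subgroup.a_rcos_sum[OF submodule_abelian_subgroup] assms
  by (simp add: quotient_algebra_def ring.extend_def module.fields_def FactRing_def)

lemma coset_mem_iff:
  assumes "submodule N R M" "x \<in> carrier M"
  shows "y \<in> N +>\<^bsub>M\<^esub> x \<longleftrightarrow> y \<in> carrier M \<and> N +>\<^bsub>M\<^esub> y = N +>\<^bsub>M\<^esub> x"
proof -
  interpret N: abelian_subgroup N M by (rule submodule_abelian_subgroup) fact
  show ?thesis
    using M.a_repr_independence[OF _ assms(2) N.a_subgroup] N.a_rcos_self[of y]
      M.a_r_coset_subset_G[OF N.a_subset assms(2)] by auto
qed

lemma coset_eq_iff:
  assumes "submodule N R M" "x \<in> carrier M" "y \<in> carrier M"
  shows "N +>\<^bsub>M\<^esub> x = N +>\<^bsub>M\<^esub> y \<longleftrightarrow> x \<ominus>\<^bsub>M\<^esub> y \<in> N"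
proof -
  have "x \<in> N +>\<^bsub>M\<^esub> y \<longleftrightarrow> (\<exists>n\<in>N. x = n \<oplus>\<^bsub>M\<^esub> y)"
    by (auto simp: a_r_coset_def r_coset_def)
  also have "\<dots> \<longleftrightarrow> x \<ominus>\<^bsub>M\<^esub> y \<in> N"
  proof
    assume "\<exists>n\<in>N. x = n \<oplus>\<^bsub>M\<^esub> y"
    then obtain n where n: "n \<in> N" "x = n \<oplus>\<^bsub>M\<^esub> y" by blast
    then have "n \<in> carrier M" using submoduleE(1)[OF assms(1)] by blast
    then show "x \<ominus>\<^bsub>M\<^esub> y \<in> N" using n assms by (simp add: M.minus_eq M.a_assoc M.r_neg)
  next
    assume "x \<ominus>\<^bsub>M\<^esub> y \<in> N"
    then show "\<exists>n\<in>N. x = n \<oplus>\<^bsub>M\<^esub> y"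
      using assms by (intro bexI[of _ "x \<ominus>\<^bsub>M\<^esub> y"]) (auto simp: M.minus_eq M.a_assoc M.l_neg)
  qed
  finally show ?thesis using coset_mem_iff assms by blast
qed

text \<open>The scalar multiple of a coset is defined as a union over all representatives. As
  \<open>N\<close> is closed under scalars, all cosets in this union coincide.\<close>

lemma quotient_algebra_smult:
  assumes N: "submodule N R M" and c: "c \<in> carrier R" and x: "x \<in> carrier M"
  shows "c \<odot>\<^bsub>quotient_algebra M N\<^esub> (N +>\<^bsub>M\<^esub> x) = N +>\<^bsub>M\<^esub> (c \<odot>\<^bsub>M\<^esub> x)"
proof -
  have "N +>\<^bsub>M\<^esub> (c \<odot>\<^bsub>M\<^esub> y) = N +>\<^bsub>M\<^esub> (c \<odot>\<^bsub>M\<^esub> x)" if y: "y \<in> N +>\<^bsub>M\<^esub> x" for y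
  proof -
    have yc: "y \<in> carrier M" and "y \<ominus>\<^bsub>M\<^esub> x \<in> N"
      using y coset_mem_iff[OF N x] coset_eq_iff[OF N _ x] by auto
    then have "c \<odot>\<^bsub>M\<^esub> (y \<ominus>\<^bsub>M\<^esub> x) \<in> N" using submoduleE(4)[OF N] c by blast
    then have "c \<odot>\<^bsub>M\<^esub> y \<ominus>\<^bsub>M\<^esub> c \<odot>\<^bsub>M\<^esub> x \<in> N"
      using c x yc by (simp add: M.minus_eq smult_r_distr smult_r_minus)
    then show ?thesis using coset_eq_iff[OF N] c x yc by simp
  qed
  moreover have "x \<in> N +>\<^bsub>M\<^esub> x" using coset_mem_iff[OF N x] x by simp
  ultimately have "(\<Union>y\<in>N +>\<^bsub>M\<^esub> x. N +>\<^bsub>M\<^esub> (c \<odot>\<^bsub>M\<^esub> y)) = N +>\<^bsub>M\<^esub> (c \<odot>\<^bsub>M\<^esub> x)"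
    by blast
  then show ?thesis
    by (simp add: quotient_algebra_def ring.extend_def module.fields_def)
qed

text \<open>Stated for submodules, so that it also serves the tensor algebra, whose relators are
  only known to form a submodule.\<close>

lemma quotient_module:
  assumes N: "submodule N R M"
  shows "module R (quotient_algebra M N)"
proof -
  let ?Q = "quotient_algebra M N"
  have z: "\<zero>\<^bsub>?Q\<^esub> = N +>\<^bsub>M\<^esub> \<zero>\<^bsub>M\<^esub>"
    using submoduleE(1)[OF N]
    by (simp add: quotient_algebra_zero M.a_coset_add_zero)
  have add: "x \<in> carrier M \<Longrightarrow> y \<in> carrier M \<Longrightarrow>
    (N +>\<^bsub>M\<^esub> x) \<oplus>\<^bsub>?Q\<^esub> (N +>\<^bsub>M\<^esub> y) = N +>\<^bsub>M\<^esub> (x \<oplus>\<^bsub>M\<^esub> y)" for x y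
    by (rule quotient_algebra_add[OF N])
  note sm = quotient_algebra_smult[OF N]
  have "abelian_group ?Q"
  proof (rule abelian_groupI)
    fix x assume "x \<in> carrier ?Q"
    then obtain a where a: "a \<in> carrier M" "x = N +>\<^bsub>M\<^esub> a" by (auto simp: quotient_algebra_carrier)
    then have "(N +>\<^bsub>M\<^esub> (\<ominus>\<^bsub>M\<^esub> a)) \<oplus>\<^bsub>?Q\<^esub> x = \<zero>\<^bsub>?Q\<^esub>" by (simp add: add z M.l_neg)
    then show "\<exists>y\<in>carrier ?Q. y \<oplus>\<^bsub>?Q\<^esub> x = \<zero>\<^bsub>?Q\<^esub>" using a by (auto simp: quotient_algebra_carrier)
  qed (auto simp: quotient_algebra_carrier add z M.a_ac)
  then show ?thesis
    by (intro moduleI R.is_cring)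
      (auto simp: quotient_algebra_carrier add sm smult_l_distr smult_r_distr smult_assoc1)
qed

end

context assoc_algebra
begin

text \<open>A scalar \<open>c\<close> acts as multiplication by the element
  \<open>c \<odot> \<one>\<close> of the algebra, so an ideal of the underlying ring is
  automatically a subspace.\<close>

lemma ideal_submodule:
  assumes "ideal I M"
  shows "submodule I R M"
proof -
  interpret I: ideal I M by fact
  have "c \<odot>\<^bsub>M\<^esub> x \<in> I" if "c \<in> carrier R" "x \<in> I" for c x
  proof -
    have "(c \<odot>\<^bsub>M\<^esub> \<one>\<^bsub>M\<^esub>) \<otimes>\<^bsub>M\<^esub> x = c \<odot>\<^bsub>M\<^esub> x"
      using that by (simp add: smult_mult_left)
    then show ?thesis using I.I_l_closed[of x "c \<odot>\<^bsub>M\<^esub> \<one>\<^bsub>M\<^esub>"] that by simp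
  qed
  then show ?thesis by (intro submoduleI) auto
qed

lemma quotient_algebra_coset_mult:
  assumes "ideal I M" "x \<in> carrier M" "y \<in> carrier M"
  shows "(I +>\<^bsub>M\<^esub> x) \<otimes>\<^bsub>quotient_algebra M I\<^esub> (I +>\<^bsub>M\<^esub> y) = I +>\<^bsub>M\<^esub> (x \<otimes>\<^bsub>M\<^esub> y)"
  using ideal.rcoset_mult_add[OF assms] by (simp add: quotient_algebra_mult)

lemma quotient_assoc_algebra:
  assumes I: "ideal I M"
  shows "assoc_algebra R (quotient_algebra M I)"
proof -
  let ?Q = "quotient_algebra M I"
  note N = ideal_submodule[OF I]
  interpret Q: module R ?Q by (rule quotient_module[OF N])
  note simps = quotient_algebra_coset_mult[OF I] quotient_algebra_smult[OF N]
    quotient_algebra_add[OF N] quotient_algebra_one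
  have "ring ?Q"
    by (intro ringI Q.abelian_group_axioms monoidI)
      (auto simp: quotient_algebra_carrier simps M.m_assoc M.l_distr M.r_distr)
  then show ?thesis
    by (intro assoc_algebra.intro assoc_algebra_axioms.intro Q.module_axioms)
      (auto simp: quotient_algebra_carrier simps smult_mult_left smult_mult_right)
qed

lemma coset_alg_hom:
  assumes I: "ideal I M"
  shows "(+>\<^bsub>M\<^esub>) I \<in> alg_hom R M (quotient_algebra M I)"
  using quotient_algebra_coset_mult[OF I] quotient_algebra_smult[OF ideal_submodule[OF I]]
    quotient_algebra_add[OF ideal_submodule[OF I]]
  by (auto simp: alg_hom_def ring_hom_def quotient_algebra_one quotient_algebra_carrier)

end

lemma alg_homD:
  assumes "h \<in> alg_hom K A B"
  shows "x \<in> carrier A \<Longrightarrow> h x \<in> carrier B"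
    and "x \<in> carrier A \<Longrightarrow> y \<in> carrier A \<Longrightarrow> h (x \<otimes>\<^bsub>A\<^esub> y) = h x \<otimes>\<^bsub>B\<^esub> h y"
    and "x \<in> carrier A \<Longrightarrow> y \<in> carrier A \<Longrightarrow> h (x \<oplus>\<^bsub>A\<^esub> y) = h x \<oplus>\<^bsub>B\<^esub> h y"
    and "h \<one>\<^bsub>A\<^esub> = \<one>\<^bsub>B\<^esub>"
    and "c \<in> carrier K \<Longrightarrow> x \<in> carrier A \<Longrightarrow> h (c \<odot>\<^bsub>A\<^esub> x) = c \<odot>\<^bsub>B\<^esub> h x"
  using assms by (auto simp: alg_hom_def ring_hom_def)

lemma alg_hom_ring_hom_ring:
  assumes "h \<in> alg_hom K A B" "ring A" "ring B"
  shows "ring_hom_ring A B h"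
  using assms by (auto simp: alg_hom_def intro: ring_hom_ringI2)

text \<open>First isomorphism theorem, read from \<open>A\<close> to the quotient: the cosets of the
  kernel are the fibres of \<open>h\<close>, so sending \<open>a\<close> to its fibre
  \<open>k a\<close> involves no choice of representatives.\<close>

lemma alg_hom_surj_isomorphic:
  assumes A: "assoc_algebra K A" and B: "assoc_algebra K B"
    and h: "h \<in> alg_hom K B A" and surj: "h ` carrier B = carrier A"
  shows "alg_isomorphic K A (quotient_algebra B (a_kernel B A h))"
proof -
  interpret A: assoc_algebra K A by fact
  interpret B: assoc_algebra K B by fact
  interpret h: ring_hom_ring B A h
    by (rule alg_hom_ring_hom_ring[OF h B.M.ring_axioms A.M.ring_axioms])
  let ?I = "a_kernel B A h"
  let ?Q = "quotient_algebra B ?I"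
  have I: "ideal ?I B" by (rule h.kernel_is_ideal)
  note N = B.ideal_submodule[OF I]
  define k where "k a = {b \<in> carrier B. h b = a}" for a
  have eq: "h x = h y \<longleftrightarrow> ?I +>\<^bsub>B\<^esub> x = ?I +>\<^bsub>B\<^esub> y" if "x \<in> carrier B" "y \<in> carrier B" for x y
  proof -
    have "?I +>\<^bsub>B\<^esub> x = ?I +>\<^bsub>B\<^esub> y \<longleftrightarrow> x \<ominus>\<^bsub>B\<^esub> y \<in> ?I"
      by (rule B.coset_eq_iff[OF N that])
    also have "\<dots> \<longleftrightarrow> h (x \<ominus>\<^bsub>B\<^esub> y) = \<zero>\<^bsub>A\<^esub>"
      using that unfolding a_kernel_def' by simp
    also have "h (x \<ominus>\<^bsub>B\<^esub> y) = h x \<ominus>\<^bsub>A\<^esub> h y"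
      using that by (simp add: B.M.minus_eq A.M.minus_eq)
    also have "\<dots> = \<zero>\<^bsub>A\<^esub> \<longleftrightarrow> h x = h y"
      using that by simp
    finally show ?thesis by simp
  qed
  have k: "k (h b) = ?I +>\<^bsub>B\<^esub> b" if "b \<in> carrier B" for b
    using B.coset_mem_iff[OF N that] that eq by (auto simp: k_def)
  note simps = B.quotient_algebra_coset_mult[OF I] B.quotient_algebra_smult[OF N]
    B.quotient_algebra_add[OF N] quotient_algebra_one
  have lift: "\<exists>b\<in>carrier B. a = h b" if "a \<in> carrier A" for a
    using that surj by blast
  note hD = alg_homD[OF h]
  have "k \<in> alg_hom K A ?Q"
    unfolding alg_hom_def
  proof (intro CollectI conjI ballI ring_hom_memI)
    fix x assume "x \<in> carrier A"
    then obtain b where "b \<in> carrier B" "x = h b" using lift by blast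
    then show "k x \<in> carrier ?Q" by (simp add: k quotient_algebra_carrier)
    fix y assume "y \<in> carrier A"
    then obtain b' where "b' \<in> carrier B" "y = h b'" using lift by blast
    then show "k (x \<otimes>\<^bsub>A\<^esub> y) = k x \<otimes>\<^bsub>?Q\<^esub> k y" "k (x \<oplus>\<^bsub>A\<^esub> y) = k x \<oplus>\<^bsub>?Q\<^esub> k y"
      using \<open>b \<in> carrier B\<close> \<open>x = h b\<close>
      by (simp_all add: hD(2,3)[symmetric] k simps del: h.hom_mult h.hom_add)
  next
    fix c x assume c: "c \<in> carrier K" and "x \<in> carrier A"
    then obtain b where "b \<in> carrier B" "x = h b" using lift by blast
    with c show "k (c \<odot>\<^bsub>A\<^esub> x) = c \<odot>\<^bsub>?Q\<^esub> k x"
      by (simp add: hD(5)[symmetric] k simps)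
  next
    have "k (h \<one>\<^bsub>B\<^esub>) = \<one>\<^bsub>?Q\<^esub>" using k by (simp add: simps del: h.hom_one)
    then show "k \<one>\<^bsub>A\<^esub> = \<one>\<^bsub>?Q\<^esub>" by simp
  qed
  moreover have "inj_on k (carrier A)"
    unfolding surj[symmetric] by (auto intro!: inj_onI simp: k eq)
  moreover have "k ` carrier A = carrier ?Q"
    unfolding surj[symmetric] by (auto simp: quotient_algebra_carrier k image_image)
  ultimately show ?thesis unfolding alg_isomorphic_def bij_betw_def by blast
qed

section \<open>Word algebras\<close>

definition lin_ext ::
  "('k, 'x) ring_scheme \<Rightarrow> ('k, 'a, 'y) module_scheme \<Rightarrow> ('w \<Rightarrow> 'a) \<Rightarrow> ('w \<Rightarrow> 'k) \<Rightarrow> 'a"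
  where "lin_ext K V h f = (\<Oplus>\<^bsub>V\<^esub>w\<in>{w. f w \<noteq> \<zero>\<^bsub>K\<^esub>}. f w \<odot>\<^bsub>V\<^esub> h w)"

text \<open>No law is imposed on \<open>mul\<close> here. This level provides the module structure,
  bilinearity and the product of two single words, and it is the level at which tensor words are
  used; associativity and units enter with \<open>monoid_words\<close>.\<close>

locale words = K: cring K for K :: "('k, 'x) ring_scheme" (structure) +
  fixes W :: "'w set" and mul :: "'w \<Rightarrow> 'w \<Rightarrow> 'w option" and E :: "'w set"
    and F :: "('k, 'w \<Rightarrow> 'k) module"
  defines "F \<equiv> word_algebra K W mul E"
begin

lemma word_carrier:
  "f \<in> carrier F \<longleftrightarrow>
    (\<forall>w. f w \<in> carrier K) \<and> (\<forall>w. w \<notin> W \<longrightarrow> f w = \<zero>) \<and> finite {w. f w \<noteq> \<zero>}"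
  by (simp add: F_def word_algebra_def)

lemma word_add: "(f \<oplus>\<^bsub>F\<^esub> g) w = f w \<oplus> g w"
  and word_smult: "(c \<odot>\<^bsub>F\<^esub> f) w = c \<otimes> f w"
  and word_zero: "\<zero>\<^bsub>F\<^esub> w = \<zero>"
  by (simp_all add: F_def word_algebra_def)

lemma word_val_closed: "f \<in> carrier F \<Longrightarrow> f w \<in> carrier K"
  by (simp add: word_carrier)

lemma word_finite_supp: "f \<in> carrier F \<Longrightarrow> finite {w. f w \<noteq> \<zero>}"
  by (simp add: word_carrier)

lemma supp_subset: "f \<in> carrier F \<Longrightarrow> {w. f w \<noteq> \<zero>} \<subseteq> W"
  by (auto simp: word_carrier)

lemma word_module: "module K F"
proof (rule moduleI)
  have add_closed: "f \<oplus>\<^bsub>F\<^esub> g \<in> carrier F" if "f \<in> carrier F" "g \<in> carrier F" for f g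
  proof -
    have "{w. f w \<oplus> g w \<noteq> \<zero>} \<subseteq> {w. f w \<noteq> \<zero>} \<union> {w. g w \<noteq> \<zero>}" by auto
    then have "finite {w. f w \<oplus> g w \<noteq> \<zero>}"
      by (rule finite_subset) (use that in \<open>simp add: word_carrier\<close>)
    then show ?thesis using that by (simp add: word_carrier word_add)
  qed
  show "abelian_group F"
  proof (rule abelian_groupI)
    fix f assume f: "f \<in> carrier F"
    have "{w. \<ominus> f w \<noteq> \<zero>} \<subseteq> {w. f w \<noteq> \<zero>}" by auto
    then have "finite {w. \<ominus> f w \<noteq> \<zero>}"
      by (rule finite_subset) (use f in \<open>simp add: word_carrier\<close>)
    then have "(\<lambda>w. \<ominus> f w) \<in> carrier F" using f by (simp add: word_carrier)
    moreover have "(\<lambda>w. \<ominus> f w) \<oplus>\<^bsub>F\<^esub> f = \<zero>\<^bsub>F\<^esub>"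
      using f by (simp add: fun_eq_iff word_add word_zero word_carrier K.l_neg)
    ultimately show "\<exists>g\<in>carrier F. g \<oplus>\<^bsub>F\<^esub> f = \<zero>\<^bsub>F\<^esub>" by blast
  qed (auto simp: add_closed fun_eq_iff word_add word_zero word_val_closed K.a_ac, simp add: word_carrier word_zero)
  fix c f assume c: "c \<in> carrier K" and f: "f \<in> carrier F"
  have "{w. c \<otimes> f w \<noteq> \<zero>} \<subseteq> {w. f w \<noteq> \<zero>}" using c by auto
  then have "finite {w. c \<otimes> f w \<noteq> \<zero>}"
    by (rule finite_subset) (use f in \<open>simp add: word_carrier\<close>)
  then show "c \<odot>\<^bsub>F\<^esub> f \<in> carrier F" using c f by (simp add: word_carrier word_smult)
qed (auto simp: fun_eq_iff word_smult word_add word_val_closed K.l_distr K.r_distr K.m_assoc K.is_cring)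

interpretation F: module K F by (rule word_module)

declare word_val_closed [simp] word_finite_supp [simp]

lemma single_word_closed [simp]: "w \<in> W \<Longrightarrow> single_word K w \<in> carrier F"
proof -
  assume w: "w \<in> W"
  have "finite {v. single_word K w v \<noteq> \<zero>}"
    by (rule finite_subset[of _ "{w}"]) (auto simp: single_word_def)
  then show ?thesis using w unfolding word_carrier by (auto simp: single_word_def)
qed

text \<open>Induction on a finite set containing the support: a word is split off by resetting its
  coefficient to zero.\<close>

lemma word_induct [consumes 1, case_names zero add]:
  assumes f: "f \<in> carrier F" and zero: "P \<zero>\<^bsub>F\<^esub>"
    and add: "\<And>c w f. c \<in> carrier K \<Longrightarrow> w \<in> W \<Longrightarrow> f \<in> carrier F \<Longrightarrow> P f \<Longrightarrow>
      P (c \<odot>\<^bsub>F\<^esub> single_word K w \<oplus>\<^bsub>F\<^esub> f)"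
  shows "P f"
proof -
  have "finite U \<Longrightarrow> f \<in> carrier F \<Longrightarrow> {w. f w \<noteq> \<zero>} \<subseteq> U \<Longrightarrow> P f" for U f
  proof (induction U arbitrary: f rule: finite_induct)
    case empty
    then have "f = \<zero>\<^bsub>F\<^esub>" by (auto simp: fun_eq_iff word_zero)
    then show ?case using zero by simp
  next
    case (insert u U)
    show ?case
    proof (cases "f u = \<zero>")
      case True
      then show ?thesis using insert by blast
    next
      case False
      then have u: "u \<in> W" using insert.prems supp_subset by blast
      let ?f = "f(u := \<zero>)"
      have "finite {w. ?f w \<noteq> \<zero>}"
        by (rule finite_subset[OF _ word_finite_supp[OF insert.prems(1)]]) auto
      then have f': "?f \<in> carrier F" using insert.prems(1)
        unfolding word_carrier by auto
      then have "P ?f" by (rule insert.IH) (use insert.prems in auto)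
      then have "P (f u \<odot>\<^bsub>F\<^esub> single_word K u \<oplus>\<^bsub>F\<^esub> ?f)"
        using f' u insert.prems by (intro add) auto
      moreover have "f u \<odot>\<^bsub>F\<^esub> single_word K u \<oplus>\<^bsub>F\<^esub> ?f = f"
        using insert.prems by (auto simp: fun_eq_iff word_smult word_add single_word_def)
      ultimately show ?thesis by simp
    qed
  qed
  from this[OF word_finite_supp[OF f] f] show ?thesis by simp
qed

text \<open>The supports of \<open>f\<close>, \<open>g\<close> and their sum differ. Extending the
  range of summation to a common finite set adds only zero terms and makes the sums
  comparable.\<close>

lemma lin_ext_superset:
  assumes "module K V" "finite U" "f \<in> carrier F" "{w. f w \<noteq> \<zero>} \<subseteq> U" "U \<subseteq> W"
    "\<And>w. w \<in> W \<Longrightarrow> h w \<in> carrier V"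
  shows "lin_ext K V h f = (\<Oplus>\<^bsub>V\<^esub>w\<in>U. f w \<odot>\<^bsub>V\<^esub> h w)"
proof -
  interpret V: module K V by fact
  show ?thesis unfolding lin_ext_def
    using assms by (intro V.add.finprod_mono_neutral_cong_left) auto
qed

lemma lin_ext_closed:
  assumes "module K V" "f \<in> carrier F" "\<And>w. w \<in> W \<Longrightarrow> h w \<in> carrier V"
  shows "lin_ext K V h f \<in> carrier V"
proof -
  interpret V: module K V by fact
  show ?thesis unfolding lin_ext_def
    using assms supp_subset[OF assms(2)] by (intro V.M.finsum_closed) auto
qed

lemma lin_ext_add:
  assumes V: "module K V" and f: "f \<in> carrier F" "g \<in> carrier F"
    and h: "\<And>w. w \<in> W \<Longrightarrow> h w \<in> carrier V"
  shows "lin_ext K V h (f \<oplus>\<^bsub>F\<^esub> g) = lin_ext K V h f \<oplus>\<^bsub>V\<^esub> lin_ext K V h g"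
proof -
  interpret V: module K V by fact
  let ?U = "{w. f w \<noteq> \<zero>} \<union> {w. g w \<noteq> \<zero>}"
  have U: "finite ?U" "?U \<subseteq> W" using f supp_subset by auto
  have "lin_ext K V h (f \<oplus>\<^bsub>F\<^esub> g) = (\<Oplus>\<^bsub>V\<^esub>w\<in>?U. (f \<oplus>\<^bsub>F\<^esub> g) w \<odot>\<^bsub>V\<^esub> h w)"
    using U f h by (intro lin_ext_superset[OF V]) (auto simp: word_add)
  also have "\<dots> = (\<Oplus>\<^bsub>V\<^esub>w\<in>?U. f w \<odot>\<^bsub>V\<^esub> h w \<oplus>\<^bsub>V\<^esub> g w \<odot>\<^bsub>V\<^esub> h w)"
    using U f h by (intro V.M.finsum_cong') (auto simp: word_add V.smult_l_distr)
  also have "\<dots> = (\<Oplus>\<^bsub>V\<^esub>w\<in>?U. f w \<odot>\<^bsub>V\<^esub> h w) \<oplus>\<^bsub>V\<^esub> (\<Oplus>\<^bsub>V\<^esub>w\<in>?U. g w \<odot>\<^bsub>V\<^esub> h w)"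
    using U f h by (intro V.M.finsum_addf) auto
  also have "(\<Oplus>\<^bsub>V\<^esub>w\<in>?U. f w \<odot>\<^bsub>V\<^esub> h w) = lin_ext K V h f"
    using U f h by (intro lin_ext_superset[OF V, symmetric]) auto
  also have "(\<Oplus>\<^bsub>V\<^esub>w\<in>?U. g w \<odot>\<^bsub>V\<^esub> h w) = lin_ext K V h g"
    using U f h by (intro lin_ext_superset[OF V, symmetric]) auto
  finally show ?thesis .
qed

lemma lin_ext_zero: "lin_ext K V h \<zero>\<^bsub>F\<^esub> = \<zero>\<^bsub>V\<^esub>" if "module K V"
proof -
  interpret V: module K V by fact
  show ?thesis by (simp add: lin_ext_def word_zero)
qed

lemma lin_ext_smult_single:
  assumes V: "module K V" and c: "c \<in> carrier K" and w: "w \<in> W"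
    and h: "\<And>w. w \<in> W \<Longrightarrow> h w \<in> carrier V"
  shows "lin_ext K V h (c \<odot>\<^bsub>F\<^esub> single_word K w) = c \<odot>\<^bsub>V\<^esub> h w"
proof -
  interpret V: module K V by fact
  have "lin_ext K V h (c \<odot>\<^bsub>F\<^esub> single_word K w) =
      (\<Oplus>\<^bsub>V\<^esub>v\<in>{w}. (c \<odot>\<^bsub>F\<^esub> single_word K w) v \<odot>\<^bsub>V\<^esub> h v)"
    using F.smult_closed[OF c single_word_closed[OF w]] c w h
    by (intro lin_ext_superset[OF V]) (auto simp: word_smult single_word_def)
  then show ?thesis using c w h by (simp add: word_smult single_word_def)
qed

lemma lin_ext_single:
  assumes V: "module K V" and w: "w \<in> W" and h: "\<And>w. w \<in> W \<Longrightarrow> h w \<in> carrier V"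
  shows "lin_ext K V h (single_word K w) = h w"
proof -
  interpret V: module K V by fact
  show ?thesis using lin_ext_smult_single[OF V K.one_closed w h] w h by simp
qed

lemma lin_ext_smult:
  assumes V: "module K V" and c: "c \<in> carrier K" and f: "f \<in> carrier F"
    and h: "\<And>w. w \<in> W \<Longrightarrow> h w \<in> carrier V"
  shows "lin_ext K V h (c \<odot>\<^bsub>F\<^esub> f) = c \<odot>\<^bsub>V\<^esub> lin_ext K V h f"
proof -
  interpret V: module K V by fact
  note [simp] = lin_ext_add[OF V _ _ h] lin_ext_smult_single[OF V _ _ h] lin_ext_closed[OF V _ h]
  show ?thesis using f
  proof (induction f rule: word_induct)
    case zero
    then show ?case using c by (simp add: lin_ext_zero[OF V])
  next
    case (add d w f)
    have "lin_ext K V h (c \<odot>\<^bsub>F\<^esub> (d \<odot>\<^bsub>F\<^esub> single_word K w \<oplus>\<^bsub>F\<^esub> f)) =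
      lin_ext K V h ((c \<otimes> d) \<odot>\<^bsub>F\<^esub> single_word K w \<oplus>\<^bsub>F\<^esub> c \<odot>\<^bsub>F\<^esub> f)"
      using c add by (simp add: F.smult_r_distr F.smult_assoc1)
    also have "\<dots> = c \<odot>\<^bsub>V\<^esub> lin_ext K V h (d \<odot>\<^bsub>F\<^esub> single_word K w \<oplus>\<^bsub>F\<^esub> f)"
      using c add h by (simp add: V.smult_r_distr V.smult_assoc1)
    finally show ?case .
  qed
qed

section \<open>The bilinear product of finitely supported functions\<close>

lemma word_mult_val:
  "(f \<otimes>\<^bsub>F\<^esub> g) w =
    (\<Oplus>p\<in>{(u, v). f u \<noteq> \<zero> \<and> g v \<noteq> \<zero> \<and> mul u v = Some w}. f (fst p) \<otimes> g (snd p))"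
  by (simp only: F_def word_algebra_def monoid.select_convs)

lemma word_mult_superset:
  assumes f: "f \<in> carrier F" "g \<in> carrier F" and U: "finite U" "finite V"
    and sup: "{w. f w \<noteq> \<zero>} \<subseteq> U" "{w. g w \<noteq> \<zero>} \<subseteq> V"
  shows "(f \<otimes>\<^bsub>F\<^esub> g) w =
    (\<Oplus>p\<in>{(u, v). u \<in> U \<and> v \<in> V \<and> mul u v = Some w}. f (fst p) \<otimes> g (snd p))"
proof -
  have "finite {(u, v). u \<in> U \<and> v \<in> V \<and> mul u v = Some w}"
    by (rule finite_subset[of _ "U \<times> V"]) (use U in auto)
  then have "(\<Oplus>p\<in>{(u, v). f u \<noteq> \<zero> \<and> g v \<noteq> \<zero> \<and> mul u v = Some w}. f (fst p) \<otimes> g (snd p)) =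
    (\<Oplus>p\<in>{(u, v). u \<in> U \<and> v \<in> V \<and> mul u v = Some w}. f (fst p) \<otimes> g (snd p))"
    using f sup by (intro K.add.finprod_mono_neutral_cong_left) auto
  then show ?thesis by (simp only: word_mult_val)
qed

lemma word_mult_l_distr:
  assumes f: "f \<in> carrier F" "f' \<in> carrier F" "g \<in> carrier F"
  shows "(f \<oplus>\<^bsub>F\<^esub> f') \<otimes>\<^bsub>F\<^esub> g = f \<otimes>\<^bsub>F\<^esub> g \<oplus>\<^bsub>F\<^esub> f' \<otimes>\<^bsub>F\<^esub> g"
proof
  fix w
  let ?U = "{w. f w \<noteq> \<zero>} \<union> {w. f' w \<noteq> \<zero>}" and ?V = "{w. g w \<noteq> \<zero>}"
  let ?S = "{(u, v). u \<in> ?U \<and> v \<in> ?V \<and> mul u v = Some w}"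
  have fin: "finite ?U" "finite ?V" using f by auto
  have "((f \<oplus>\<^bsub>F\<^esub> f') \<otimes>\<^bsub>F\<^esub> g) w = (\<Oplus>p\<in>?S. (f \<oplus>\<^bsub>F\<^esub> f') (fst p) \<otimes> g (snd p))"
    using f fin by (intro word_mult_superset) (auto simp: word_add)
  also have "\<dots> = (\<Oplus>p\<in>?S. f (fst p) \<otimes> g (snd p) \<oplus> f' (fst p) \<otimes> g (snd p))"
    using f by (intro K.finsum_cong') (auto simp: word_add K.l_distr)
  also have "\<dots> = (\<Oplus>p\<in>?S. f (fst p) \<otimes> g (snd p)) \<oplus> (\<Oplus>p\<in>?S. f' (fst p) \<otimes> g (snd p))"
    using f by (intro K.finsum_addf) auto
  also have "(\<Oplus>p\<in>?S. f (fst p) \<otimes> g (snd p)) = (f \<otimes>\<^bsub>F\<^esub> g) w"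
    using f fin by (intro word_mult_superset[symmetric]) auto
  also have "(\<Oplus>p\<in>?S. f' (fst p) \<otimes> g (snd p)) = (f' \<otimes>\<^bsub>F\<^esub> g) w"
    using f fin by (intro word_mult_superset[symmetric]) auto
  finally show "((f \<oplus>\<^bsub>F\<^esub> f') \<otimes>\<^bsub>F\<^esub> g) w = (f \<otimes>\<^bsub>F\<^esub> g \<oplus>\<^bsub>F\<^esub> f' \<otimes>\<^bsub>F\<^esub> g) w"
    by (simp add: word_add[of _ _ w])
qed

lemma word_mult_r_distr:
  assumes f: "f \<in> carrier F" "f' \<in> carrier F" "g \<in> carrier F"
  shows "g \<otimes>\<^bsub>F\<^esub> (f \<oplus>\<^bsub>F\<^esub> f') = g \<otimes>\<^bsub>F\<^esub> f \<oplus>\<^bsub>F\<^esub> g \<otimes>\<^bsub>F\<^esub> f'"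
proof
  fix w
  let ?V = "{w. f w \<noteq> \<zero>} \<union> {w. f' w \<noteq> \<zero>}" and ?U = "{w. g w \<noteq> \<zero>}"
  let ?S = "{(u, v). u \<in> ?U \<and> v \<in> ?V \<and> mul u v = Some w}"
  have fin: "finite ?U" "finite ?V" using f by auto
  have "(g \<otimes>\<^bsub>F\<^esub> (f \<oplus>\<^bsub>F\<^esub> f')) w = (\<Oplus>p\<in>?S. g (fst p) \<otimes> (f \<oplus>\<^bsub>F\<^esub> f') (snd p))"
    using f fin by (intro word_mult_superset) (auto simp: word_add)
  also have "\<dots> = (\<Oplus>p\<in>?S. g (fst p) \<otimes> f (snd p) \<oplus> g (fst p) \<otimes> f' (snd p))"
    using f by (intro K.finsum_cong') (auto simp: word_add K.r_distr)
  also have "\<dots> = (\<Oplus>p\<in>?S. g (fst p) \<otimes> f (snd p)) \<oplus> (\<Oplus>p\<in>?S. g (fst p) \<otimes> f' (snd p))"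
    using f by (intro K.finsum_addf) auto
  also have "(\<Oplus>p\<in>?S. g (fst p) \<otimes> f (snd p)) = (g \<otimes>\<^bsub>F\<^esub> f) w"
    using f fin by (intro word_mult_superset[symmetric]) auto
  also have "(\<Oplus>p\<in>?S. g (fst p) \<otimes> f' (snd p)) = (g \<otimes>\<^bsub>F\<^esub> f') w"
    using f fin by (intro word_mult_superset[symmetric]) auto
  finally show "(g \<otimes>\<^bsub>F\<^esub> (f \<oplus>\<^bsub>F\<^esub> f')) w = (g \<otimes>\<^bsub>F\<^esub> f \<oplus>\<^bsub>F\<^esub> g \<otimes>\<^bsub>F\<^esub> f') w"
    by (simp add: word_add[of _ _ w])
qed

lemma word_mult_smult_left:
  assumes c: "c \<in> carrier K" and f: "f \<in> carrier F" "g \<in> carrier F"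
  shows "(c \<odot>\<^bsub>F\<^esub> f) \<otimes>\<^bsub>F\<^esub> g = c \<odot>\<^bsub>F\<^esub> (f \<otimes>\<^bsub>F\<^esub> g)"
proof
  fix w
  let ?U = "{w. f w \<noteq> \<zero>}" and ?V = "{w. g w \<noteq> \<zero>}"
  let ?S = "{(u, v). u \<in> ?U \<and> v \<in> ?V \<and> mul u v = Some w}"
  have fin: "finite ?U" "finite ?V" using f by auto
  have S: "finite ?S" by (rule finite_subset[of _ "?U \<times> ?V"]) (use fin in auto)
  have "((c \<odot>\<^bsub>F\<^esub> f) \<otimes>\<^bsub>F\<^esub> g) w = (\<Oplus>p\<in>?S. (c \<odot>\<^bsub>F\<^esub> f) (fst p) \<otimes> g (snd p))"
    using c f fin by (intro word_mult_superset) (auto simp: word_smult)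
  also have "\<dots> = (\<Oplus>p\<in>?S. c \<otimes> (f (fst p) \<otimes> g (snd p)))"
    using c f by (intro K.finsum_cong') (auto simp: word_smult K.m_assoc)
  also have "\<dots> = c \<otimes> (\<Oplus>p\<in>?S. f (fst p) \<otimes> g (snd p))"
    using c f S by (intro K.finsum_rdistr[symmetric]) auto
  also have "(\<Oplus>p\<in>?S. f (fst p) \<otimes> g (snd p)) = (f \<otimes>\<^bsub>F\<^esub> g) w"
    using f fin by (intro word_mult_superset[symmetric]) auto
  finally show "((c \<odot>\<^bsub>F\<^esub> f) \<otimes>\<^bsub>F\<^esub> g) w = (c \<odot>\<^bsub>F\<^esub> (f \<otimes>\<^bsub>F\<^esub> g)) w"
    by (simp add: word_smult[of _ _ w])
qed

lemma word_mult_smult_right: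
  assumes c: "c \<in> carrier K" and f: "f \<in> carrier F" "g \<in> carrier F"
  shows "f \<otimes>\<^bsub>F\<^esub> (c \<odot>\<^bsub>F\<^esub> g) = c \<odot>\<^bsub>F\<^esub> (f \<otimes>\<^bsub>F\<^esub> g)"
proof
  fix w
  let ?U = "{w. f w \<noteq> \<zero>}" and ?V = "{w. g w \<noteq> \<zero>}"
  let ?S = "{(u, v). u \<in> ?U \<and> v \<in> ?V \<and> mul u v = Some w}"
  have fin: "finite ?U" "finite ?V" using f by auto
  have S: "finite ?S" by (rule finite_subset[of _ "?U \<times> ?V"]) (use fin in auto)
  have "(f \<otimes>\<^bsub>F\<^esub> (c \<odot>\<^bsub>F\<^esub> g)) w = (\<Oplus>p\<in>?S. f (fst p) \<otimes> (c \<odot>\<^bsub>F\<^esub> g) (snd p))"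
    using c f fin by (intro word_mult_superset) (auto simp: word_smult)
  also have "\<dots> = (\<Oplus>p\<in>?S. c \<otimes> (f (fst p) \<otimes> g (snd p)))"
    using c f by (intro K.finsum_cong') (auto simp: word_smult K.m_lcomm)
  also have "\<dots> = c \<otimes> (\<Oplus>p\<in>?S. f (fst p) \<otimes> g (snd p))"
    using c f S by (intro K.finsum_rdistr[symmetric]) auto
  also have "(\<Oplus>p\<in>?S. f (fst p) \<otimes> g (snd p)) = (f \<otimes>\<^bsub>F\<^esub> g) w"
    using f fin by (intro word_mult_superset[symmetric]) auto
  finally show "(f \<otimes>\<^bsub>F\<^esub> (c \<odot>\<^bsub>F\<^esub> g)) w = (c \<odot>\<^bsub>F\<^esub> (f \<otimes>\<^bsub>F\<^esub> g)) w"
    by (simp add: word_smult[of _ _ w])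
qed

definition option_word :: "'w option \<Rightarrow> 'w \<Rightarrow> 'k"
  where "option_word r = (case r of None \<Rightarrow> \<zero>\<^bsub>F\<^esub> | Some w \<Rightarrow> single_word K w)"

lemma option_word_simps [simp]:
  "option_word None = \<zero>\<^bsub>F\<^esub>" "option_word (Some w) = single_word K w"
  by (simp_all add: option_word_def)

lemma single_word_mult:
  assumes "u \<in> W" "v \<in> W"
  shows "single_word K u \<otimes>\<^bsub>F\<^esub> single_word K v = option_word (mul u v)"
proof
  fix w
  have S: "{(u', v'). u' \<in> {u} \<and> v' \<in> {v} \<and> mul u' v' = Some w} =
      (if mul u v = Some w then {(u, v)} else {})" by auto
  have "(single_word K u \<otimes>\<^bsub>F\<^esub> single_word K v) w =
     (\<Oplus>p\<in>{(u', v'). u' \<in> {u} \<and> v' \<in> {v} \<and> mul u' v' = Some w}.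
        single_word K u (fst p) \<otimes> single_word K v (snd p))"
    using assms[THEN single_word_closed] assms
    by (intro word_mult_superset) (auto simp: single_word_def)
  then show "(single_word K u \<otimes>\<^bsub>F\<^esub> single_word K v) w = option_word (mul u v) w"
    unfolding S by (cases "mul u v") (auto simp: single_word_def word_zero)
qed

end

text \<open>Close to the axioms of a category with finitely many objects, phrased without objects:
  \<open>E\<close> plays the role of the identities, and each word has exactly one composable
  identity on either side. With \<open>Option.bind\<close>, associativity also says that both
  bracketings are undefined together.\<close>

locale monoid_words = words +
  assumes mul_closed: "u \<in> W \<Longrightarrow> v \<in> W \<Longrightarrow> mul u v = Some w \<Longrightarrow> w \<in> W"
    and mul_assoc: "u \<in> W \<Longrightarrow> v \<in> W \<Longrightarrow> w \<in> W \<Longrightarrow>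
      Option.bind (mul u v) (\<lambda>x. mul x w) = Option.bind (mul v w) (mul u)"
    and E: "finite E" "E \<subseteq> W"
    and l_unit: "w \<in> W \<Longrightarrow> \<exists>e\<in>E. mul e w = Some w \<and> (\<forall>e'\<in>E - {e}. mul e' w = None)"
    and r_unit: "w \<in> W \<Longrightarrow> \<exists>e\<in>E. mul w e = Some w \<and> (\<forall>e'\<in>E - {e}. mul w e' = None)"
begin

interpretation F: module K F by (rule word_module)

lemma option_word_closed [simp]: "u \<in> W \<Longrightarrow> v \<in> W \<Longrightarrow> option_word (mul u v) \<in> carrier F"
  by (cases "mul u v") (simp_all add: mul_closed[of u v])

lemma word_mult_zero:
  assumes "f \<in> carrier F"
  shows "\<zero>\<^bsub>F\<^esub> \<otimes>\<^bsub>F\<^esub> f = \<zero>\<^bsub>F\<^esub>" "f \<otimes>\<^bsub>F\<^esub> \<zero>\<^bsub>F\<^esub> = \<zero>\<^bsub>F\<^esub>"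
  by (simp_all add: fun_eq_iff word_mult_val word_zero)

lemma word_mult_closed [simp]:
  assumes "f \<in> carrier F" "g \<in> carrier F"
  shows "f \<otimes>\<^bsub>F\<^esub> g \<in> carrier F"
proof -
  have *: "single_word K u \<otimes>\<^bsub>F\<^esub> g \<in> carrier F" if "u \<in> W" for u
    using assms(2)
    by (induction g rule: word_induct)
      (simp_all add: that word_mult_zero word_mult_r_distr word_mult_smult_right single_word_mult)
  show ?thesis using assms(1)
    by (induction f rule: word_induct)
      (simp_all add: assms * word_mult_zero word_mult_l_distr word_mult_smult_left)
qed

lemma word_one_val: "\<one>\<^bsub>F\<^esub> x = (if x \<in> E then \<one> else \<zero>)"
  by (simp only: F_def word_algebra_def monoid.select_convs)

lemma word_one_closed [simp]: "\<one>\<^bsub>F\<^esub> \<in> carrier F"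
proof -
  have "finite {w. \<one>\<^bsub>F\<^esub> w \<noteq> \<zero>}"
    by (rule finite_subset[OF _ E(1)]) (auto simp: word_one_val)
  then show ?thesis using E(2) unfolding word_carrier by (auto simp: word_one_val)
qed

text \<open>Of the words in \<open>E\<close> only one composes with \<open>w\<close>, so the sum
  that defines the product has a single term, at \<open>w\<close> itself.\<close>

lemma word_one_mult:
  assumes w: "w \<in> W"
  shows "\<one>\<^bsub>F\<^esub> \<otimes>\<^bsub>F\<^esub> single_word K w = single_word K w"
    "single_word K w \<otimes>\<^bsub>F\<^esub> \<one>\<^bsub>F\<^esub> = single_word K w"
proof -
  note one = word_one_closed and val = word_one_val
  obtain e where e: "e \<in> E" "mul e w = Some w" "\<forall>e'\<in>E - {e}. mul e' w = None"
    using l_unit[OF w] by blast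
  obtain e2 where e2: "e2 \<in> E" "mul w e2 = Some w" "\<forall>e'\<in>E - {e2}. mul w e' = None"
    using r_unit[OF w] by blast
  show "\<one>\<^bsub>F\<^esub> \<otimes>\<^bsub>F\<^esub> single_word K w = single_word K w"
  proof
    fix x
    have S: "{(u, v). u \<in> E \<and> v \<in> {w} \<and> mul u v = Some x} = (if x = w then {(e, w)} else {})"
      using e by (auto, metis Diff_iff option.distinct(1) option.inject singletonD)+
    have "(\<one>\<^bsub>F\<^esub> \<otimes>\<^bsub>F\<^esub> single_word K w) x =
       (\<Oplus>p\<in>{(u, v). u \<in> E \<and> v \<in> {w} \<and> mul u v = Some x}. \<one>\<^bsub>F\<^esub> (fst p) \<otimes> single_word K w (snd p))"
      using single_word_closed[OF w] w one E by (intro word_mult_superset) (auto simp: single_word_def val)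
    then show "(\<one>\<^bsub>F\<^esub> \<otimes>\<^bsub>F\<^esub> single_word K w) x = single_word K w x"
      unfolding S using e by (simp add: val single_word_def)
  qed
  show "single_word K w \<otimes>\<^bsub>F\<^esub> \<one>\<^bsub>F\<^esub> = single_word K w"
  proof
    fix x
    have S: "{(u, v). u \<in> {w} \<and> v \<in> E \<and> mul u v = Some x} = (if x = w then {(w, e2)} else {})"
      using e2 by (auto, metis Diff_iff option.distinct(1) option.inject singletonD)+
    have "(single_word K w \<otimes>\<^bsub>F\<^esub> \<one>\<^bsub>F\<^esub>) x =
       (\<Oplus>p\<in>{(u, v). u \<in> {w} \<and> v \<in> E \<and> mul u v = Some x}. single_word K w (fst p) \<otimes> \<one>\<^bsub>F\<^esub> (snd p))"
      using single_word_closed[OF w] w one E by (intro word_mult_superset) (auto simp: single_word_def val)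
    then show "(single_word K w \<otimes>\<^bsub>F\<^esub> \<one>\<^bsub>F\<^esub>) x = single_word K w x"
      unfolding S using e2 by (simp add: val single_word_def)
  qed
qed

lemma single_word_mult_assoc:
  assumes "u \<in> W" "v \<in> W" "w \<in> W"
  shows "single_word K u \<otimes>\<^bsub>F\<^esub> single_word K v \<otimes>\<^bsub>F\<^esub> single_word K w =
    single_word K u \<otimes>\<^bsub>F\<^esub> (single_word K v \<otimes>\<^bsub>F\<^esub> single_word K w)"
proof -
  have "single_word K u \<otimes>\<^bsub>F\<^esub> single_word K v \<otimes>\<^bsub>F\<^esub> single_word K w =
      option_word (Option.bind (mul u v) (\<lambda>x. mul x w))"
  proof (cases "mul u v")
    case (Some x)
    then show ?thesis
      using assms mul_closed[OF assms(1,2) Some] by (simp add: single_word_mult)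
  qed (use assms in \<open>simp add: single_word_mult word_mult_zero\<close>)
  moreover have "single_word K u \<otimes>\<^bsub>F\<^esub> (single_word K v \<otimes>\<^bsub>F\<^esub> single_word K w) =
      option_word (Option.bind (mul v w) (mul u))"
  proof (cases "mul v w")
    case (Some x)
    then show ?thesis
      using assms mul_closed[OF assms(2,3) Some] by (simp add: single_word_mult)
  qed (use assms in \<open>simp add: single_word_mult word_mult_zero\<close>)
  ultimately show ?thesis by (simp add: mul_assoc[OF assms])
qed

text \<open>Associativity is trilinear: three nested inductions, one for each argument, reduce it to
  single words, where it is the law for \<open>mul\<close>.\<close>

lemma word_assoc_algebra: "assoc_algebra K F"
proof -
  note bilin = word_mult_l_distr word_mult_r_distr word_mult_smult_left word_mult_smult_right
    word_mult_zero
  have assoc: "f \<otimes>\<^bsub>F\<^esub> g \<otimes>\<^bsub>F\<^esub> h = f \<otimes>\<^bsub>F\<^esub> (g \<otimes>\<^bsub>F\<^esub> h)"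
    if fgh: "f \<in> carrier F" "g \<in> carrier F" "h \<in> carrier F" for f g h
  proof -
    have 1: "single_word K u \<otimes>\<^bsub>F\<^esub> single_word K v \<otimes>\<^bsub>F\<^esub> h =
        single_word K u \<otimes>\<^bsub>F\<^esub> (single_word K v \<otimes>\<^bsub>F\<^esub> h)" if "u \<in> W" "v \<in> W" for u v
      using fgh(3) by (induction h rule: word_induct) (simp_all add: that bilin single_word_mult_assoc)
    have 2: "single_word K u \<otimes>\<^bsub>F\<^esub> g \<otimes>\<^bsub>F\<^esub> h = single_word K u \<otimes>\<^bsub>F\<^esub> (g \<otimes>\<^bsub>F\<^esub> h)"
      if "u \<in> W" for u
      using fgh(2) by (induction g rule: word_induct) (simp_all add: that fgh(3) bilin 1)
    show ?thesis
      using fgh(1) by (induction f rule: word_induct) (simp_all add: fgh bilin 2)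
  qed
  have l_one: "\<one>\<^bsub>F\<^esub> \<otimes>\<^bsub>F\<^esub> f = f" if "f \<in> carrier F" for f
    using that by (induction f rule: word_induct) (simp_all add: bilin word_one_mult)
  have r_one: "f \<otimes>\<^bsub>F\<^esub> \<one>\<^bsub>F\<^esub> = f" if "f \<in> carrier F" for f
    using that by (induction f rule: word_induct) (simp_all add: bilin word_one_mult)
  have "ring F"
    by (intro ringI F.M.abelian_group_axioms monoidI) (simp_all add: assoc l_one r_one bilin)
  then show ?thesis
    by (intro assoc_algebra.intro assoc_algebra_axioms.intro F.module_axioms) (simp_all add: bilin)
qed

lemma word_one_sum: "\<one>\<^bsub>F\<^esub> = (\<Oplus>\<^bsub>F\<^esub>e\<in>E. single_word K e)"
proof -
  have "(\<Oplus>\<^bsub>F\<^esub>e\<in>U. single_word K e) = (\<lambda>w. if w \<in> U then \<one> else \<zero>)"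
    if "finite U" "U \<subseteq> E" for U
    using that
  proof (induction U rule: finite_induct)
    case empty
    then show ?case by (simp add: fun_eq_iff word_zero)
  next
    case (insert u U)
    then have "(\<Oplus>\<^bsub>F\<^esub>e\<in>insert u U. single_word K e) =
        single_word K u \<oplus>\<^bsub>F\<^esub> (\<Oplus>\<^bsub>F\<^esub>e\<in>U. single_word K e)"
      using E by (intro F.M.finsum_insert) auto
    with insert show ?case by (auto simp: fun_eq_iff word_add single_word_def)
  qed
  from this[of E] show ?thesis using E by (simp add: fun_eq_iff word_one_val)
qed

lemma lin_ext_alg_hom:
  assumes A: "assoc_algebra K A" and h: "\<And>w. w \<in> W \<Longrightarrow> h w \<in> carrier A"
    and mult: "\<And>u v. u \<in> W \<Longrightarrow> v \<in> W \<Longrightarrow>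
      h u \<otimes>\<^bsub>A\<^esub> h v = (case mul u v of None \<Rightarrow> \<zero>\<^bsub>A\<^esub> | Some w \<Rightarrow> h w)"
    and one: "(\<Oplus>\<^bsub>A\<^esub>e\<in>E. h e) = \<one>\<^bsub>A\<^esub>"
  shows "lin_ext K A h \<in> alg_hom K F A"
proof -
  interpret A: assoc_algebra K A by fact
  have V: "module K A" by unfold_locales
  note [simp] = lin_ext_closed[OF V _ h] lin_ext_add[OF V _ _ h] lin_ext_smult[OF V _ _ h]
    lin_ext_zero[OF V] lin_ext_single[OF V _ h]
  note bilin = word_mult_l_distr word_mult_r_distr word_mult_smult_left word_mult_smult_right
    word_mult_zero A.M.l_distr A.M.r_distr A.smult_mult_left A.smult_mult_right
  have mult': "lin_ext K A h (f \<otimes>\<^bsub>F\<^esub> g) = lin_ext K A h f \<otimes>\<^bsub>A\<^esub> lin_ext K A h g"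
    if fg: "f \<in> carrier F" "g \<in> carrier F" for f g
  proof -
    have s: "lin_ext K A h (single_word K u \<otimes>\<^bsub>F\<^esub> single_word K v) = h u \<otimes>\<^bsub>A\<^esub> h v"
      if "u \<in> W" "v \<in> W" for u v
      using that mult[OF that] mul_closed[OF that]
      by (cases "mul u v") (simp_all add: single_word_mult)
    have l: "lin_ext K A h (single_word K u \<otimes>\<^bsub>F\<^esub> g) = h u \<otimes>\<^bsub>A\<^esub> lin_ext K A h g"
      if "u \<in> W" for u
      using fg(2) by (induction g rule: word_induct) (simp_all add: that bilin s h)
    show ?thesis
      using fg(1) by (induction f rule: word_induct) (simp_all add: fg bilin h l)
  qed
  have "lin_ext K A h (\<Oplus>\<^bsub>F\<^esub>e\<in>U. single_word K e) = (\<Oplus>\<^bsub>A\<^esub>e\<in>U. h e)"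
    if "finite U" "U \<subseteq> E" for U
    using that
  proof (induction U rule: finite_induct)
    case (insert u U)
    have "single_word K \<in> U \<rightarrow> carrier F" "h \<in> U \<rightarrow> carrier A" "u \<in> W"
      using insert.prems E h by auto
    then show ?case using insert h E by (simp add: subset_iff)
  qed simp
  from this[of E] have "lin_ext K A h \<one>\<^bsub>F\<^esub> = \<one>\<^bsub>A\<^esub>"
    using E one by (simp add: word_one_sum)
  then show ?thesis
    unfolding alg_hom_def by (auto intro!: ring_hom_memI simp: mult')
qed

end

section \<open>Generalized paths\<close>

context wf_digraph
begin

text \<open>A recursive form of membership in \<open>gpaths\<close>. Removing the first entry and
  the first arrow leaves a path that starts at the head of this arrow; nearly all inductions on
  paths follow this scheme.\<close>

fun gpath_valid :: "('a \<Rightarrow> ('k, 'c, 'y) module_scheme) \<Rightarrow> ('a, 'c, 'b) gpath \<Rightarrow> bool"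
  where
    "gpath_valid \<A> (u, a, []) \<longleftrightarrow> u \<in> verts G \<and> a \<in> carrier (\<A> u)"
  | "gpath_valid \<A> (u, a, (\<beta>, b) # ps) \<longleftrightarrow>
      \<beta> \<in> arcs G \<and> tail G \<beta> = u \<and> a \<in> carrier (\<A> u) \<and> gpath_valid \<A> (head G \<beta>, b, ps)"

fun gpath_end :: "('a, 'c, 'b) gpath \<Rightarrow> 'a"
  where
    "gpath_end (u, a, []) = u"
  | "gpath_end (u, a, (\<beta>, b) # ps) = gpath_end (head G \<beta>, b, ps)"

lemma awlast_eq_gpath_end: "awlast u (map fst ps) = gpath_end (u, a, ps)"
  by (induction "(u, a, ps)" arbitrary: u a ps rule: gpath_end.induct) auto

lemma gpath_valid_start:
  "gpath_valid \<A> (u, a, ps) \<Longrightarrow> u \<in> verts G \<and> a \<in> carrier (\<A> u)"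
  by (cases "(u, a, ps)" rule: gpath_end.cases) auto

lemma gpath_valid_end: "gpath_valid \<A> p \<Longrightarrow> gpath_end p \<in> verts G"
  by (induction p rule: gpath_end.induct) auto

lemma gpaths_between_iff:
  "(u, a, ps) \<in> gpaths_between G \<A> u' v \<longleftrightarrow>
    u = u' \<and> gpath_valid \<A> (u, a, ps) \<and> gpath_end (u, a, ps) = v"
proof -
  have "awalk u (map fst ps) v \<and> a \<in> carrier (\<A> u) \<and>
      (\<forall>(\<beta>, b) \<in> set ps. b \<in> carrier (\<A> (head G \<beta>))) \<longleftrightarrow>
    gpath_valid \<A> (u, a, ps) \<and> gpath_end (u, a, ps) = v"
  proof (induction "(u, a, ps)" arbitrary: u a ps rule: gpath_end.induct)
    case (1 u a)
    then show ?case by (auto simp: awalk_Nil_iff)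
  next
    case (2 u a \<beta> b ps)
    then show ?case by (auto simp: awalk_Cons_iff gpath_valid_start)
  qed
  then show ?thesis by (auto simp: gpaths_between_def)
qed

lemma gpaths_iff: "p \<in> gpaths G \<A> \<longleftrightarrow> gpath_valid \<A> p"
proof (cases p)
  case (fields u a ps)
  show ?thesis
    unfolding gpaths_def fields
    by (auto simp: gpaths_between_iff gpath_valid_end dest: gpath_valid_start)
qed

text \<open>The start vertex of the extended path is forgotten, because it is recovered as the head
  of \<open>\<beta>\<close>. This is why the facts about \<open>gpath_cons\<close> assume
  \<open>fst p = head G \<beta>\<close>.\<close>

fun gpath_cons :: "'a \<Rightarrow> 'c \<Rightarrow> 'b \<Rightarrow> ('a, 'c, 'b) gpath \<Rightarrow> ('a, 'c, 'b) gpath"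
  where "gpath_cons u a \<beta> (v, b, ps) = (u, a, (\<beta>, b) # ps)"

lemma gpath_mult_Nil:
  "gpath_mult G \<A> (u, a, []) (v, b, qs) = (if u = v then Some (u, a \<otimes>\<^bsub>\<A> v\<^esub> b, qs) else None)"
  by simp

text \<open>The defining equation of \<open>gpath_mult\<close> works at the last arrow of the left
  factor. This one recurses from its first arrow and replaces the original for
  simplification.\<close>

lemma gpath_mult_Cons:
  "gpath_mult G \<A> (u, a, (\<beta>, c) # ps) q =
    map_option (gpath_cons u a \<beta>) (gpath_mult G \<A> (head G \<beta>, c, ps) q)"
  by (cases q) auto

declare gpath_mult.simps [simp del]

lemmas gpath_mult_simps [simp] = gpath_mult_Nil gpath_mult_Cons

lemma gpath_mult_fst: "gpath_mult G \<A> p q = Some r \<Longrightarrow> fst r = fst p"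
  by (induction p arbitrary: r rule: gpath_end.induct; cases q) (auto split: if_splits)

lemma gpath_mult_None: "gpath_mult G \<A> p q = None \<longleftrightarrow> gpath_end p \<noteq> fst q"
  by (induction p rule: gpath_end.induct; cases q) auto

lemma set_entry_cons:
  "fst p = head G \<beta> \<Longrightarrow>
    set_entry (gpath_cons u a \<beta> p) (Suc t) x = gpath_cons u a \<beta> (set_entry p t x)"
  by (cases p; cases t) auto

lemma set_entry_fst [simp]: "fst (set_entry p t x) = fst p"
  by (cases "(p, t, x)" rule: set_entry.cases) auto

lemma set_entry_Cons:
  "set_entry (u, a, (\<beta>, b) # ps) (Suc t) x = gpath_cons u a \<beta> (set_entry (head G \<beta>, b, ps) t x)"
  using set_entry_cons[of "(head G \<beta>, b, ps)"] by simp

lemma entry_vertex_Cons: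
  "entry_vertex G (u, a, (\<beta>, b) # ps) (Suc t) = entry_vertex G (head G \<beta>, b, ps) t"
  by (cases t) auto

lemma entry_vertex_cons:
  "fst p = head G \<beta> \<Longrightarrow> entry_vertex G (gpath_cons u a \<beta> p) (Suc t) = entry_vertex G p t"
  by (cases p; cases t) auto

lemma gpath_cons_length [simp]: "gpath_length (gpath_cons u a \<beta> p) = Suc (gpath_length p)"
  by (cases p) auto

lemma gpath_cons_valid:
  "fst p = head G \<beta> \<Longrightarrow> gpath_valid \<A> (gpath_cons u a \<beta> p) \<longleftrightarrow>
    \<beta> \<in> arcs G \<and> tail G \<beta> = u \<and> a \<in> carrier (\<A> u) \<and> gpath_valid \<A> p"
  by (cases p) auto

lemma entry_vertex_in_verts:
  "gpath_valid \<A> p \<Longrightarrow> t \<le> gpath_length p \<Longrightarrow> entry_vertex G p t \<in> verts G"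
proof (induction p arbitrary: t rule: gpath_end.induct)
  case (2 u a \<beta> b ps)
  then show ?case by (cases t) (auto simp: entry_vertex_Cons simp del: entry_vertex.simps(2))
qed simp

lemma set_entry_valid:
  "gpath_valid \<A> p \<Longrightarrow> t \<le> gpath_length p \<Longrightarrow> x \<in> carrier (\<A> (entry_vertex G p t)) \<Longrightarrow>
    gpath_valid \<A> (set_entry p t x)"
proof (induction p arbitrary: t rule: gpath_end.induct)
  case (2 u a \<beta> b ps)
  then show ?case
    by (cases t) (auto simp: entry_vertex_Cons set_entry_Cons gpath_cons_valid
        simp del: entry_vertex.simps(2) set_entry.simps(2))
qed simp

end

locale gpath_family = K: cring K + D: fin_digraph \<Delta>
  for K :: "('k, 'x) ring_scheme" (structure) and \<Delta> :: "('v, 'e) pre_digraph" +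
  fixes \<A> :: "'v \<Rightarrow> ('k, 'a, 'y) module_scheme"
  assumes component_algebra: "v \<in> verts \<Delta> \<Longrightarrow> assoc_algebra K (\<A> v)"
begin

abbreviation "W \<equiv> gpaths \<Delta> \<A>"
abbreviation "mul \<equiv> gpath_mult \<Delta> \<A>"
abbreviation "F \<equiv> gpath_word_algebra K \<Delta> \<A>"
abbreviation "E \<equiv> {(i, \<one>\<^bsub>\<A> i\<^esub>, []) | i. i \<in> verts \<Delta>} :: ('v, 'a, 'e) gpath set"
abbreviation "valid \<equiv> D.gpath_valid \<A>"

lemma component_monoid: "v \<in> verts \<Delta> \<Longrightarrow> monoid (\<A> v)"
  using component_algebra by (meson assoc_algebra.axioms(2) ring_def)

lemma component_mult_closed:
    "v \<in> verts \<Delta> \<Longrightarrow> a \<in> carrier (\<A> v) \<Longrightarrow> b \<in> carrier (\<A> v) \<Longrightarrow> a \<otimes>\<^bsub>\<A> v\<^esub> b \<in> carrier (\<A> v)"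
  and component_one_closed: "v \<in> verts \<Delta> \<Longrightarrow> \<one>\<^bsub>\<A> v\<^esub> \<in> carrier (\<A> v)"
  using component_monoid monoid.m_closed monoid.one_closed by metis+

lemma gpath_mult_valid:
  "valid p \<Longrightarrow> valid q \<Longrightarrow> mul p q = Some r \<Longrightarrow> valid r"
proof (induction p arbitrary: r rule: D.gpath_end.induct)
  case (1 u a)
  obtain v b qs where q: "q = (v, b, qs)" by (cases q)
  show ?case using 1 unfolding q
    by (cases qs) (auto split: if_splits intro: component_mult_closed D.tail_in_verts)
next
  case (2 u a \<beta> b ps)
  then obtain x where x: "mul (head \<Delta> \<beta>, b, ps) q = Some x" "r = D.gpath_cons u a \<beta> x"
    by auto
  then show ?case using 2(1)[OF _ 2(3) x(1)] 2(2) D.gpath_mult_fst[OF x(1)]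
    by (simp add: D.gpath_cons_valid)
qed

text \<open>Prefixing an arrow commutes with multiplication on the right, so everything reduces to a
  first factor of length zero. It only alters the first entry of \<open>q\<close>, and associativity
  in \<open>\<A> u\<close> is called for only when \<open>q\<close> has length zero too.\<close>

lemma gpath_mult_assoc:
  assumes "valid p" "valid q" "valid r"
  shows "Option.bind (mul p q) (\<lambda>x. mul x r) = Option.bind (mul q r) (mul p)"
  using assms(1)
proof (induction p rule: D.gpath_end.induct)
  case (1 u a)
  interpret monoid "\<A> u" using 1(1) component_monoid by simp
  obtain v b qs where q: "q = (v, b, qs)" by (cases q)
  obtain w c rs where r: "r = (w, c, rs)" by (cases r)
  show ?case
  proof (cases "u = v")
    case False
    \<comment> \<open>A product with left factor \<open>q\<close> starts where \<open>q\<close>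
      starts, so it fails to compose with a path ending at \<open>u\<close> just as \<open>q\<close>
      does.\<close>
    have "mul (u, a, []) x = None" if "mul q r = Some x" for x
      using D.gpath_mult_fst[OF that] False by (cases x) (simp add: q)
    then have "Option.bind (mul q r) (mul (u, a, [])) = None"
      by (cases "mul q r") auto
    then show ?thesis using False by (simp add: q)
  next
    case True
    show ?thesis
    proof (cases qs)
      case Nil
      then show ?thesis using True 1 assms(2,3) D.gpath_valid_start[of \<A> w c rs]
        by (auto simp: q r monoid.m_assoc[OF component_monoid])
    next
      case (Cons y ys)
      obtain \<beta> d where y: "y = (\<beta>, d)" by (cases y)
      have "mul (u, a, []) (D.gpath_cons u b \<beta> x) = Some (D.gpath_cons u (a \<otimes>\<^bsub>\<A> u\<^esub> b) \<beta> x)" for x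
        by (cases x) simp
      then show ?thesis using True Cons
        by (cases "mul (head \<Delta> \<beta>, d, ys) r") (simp_all add: q y)
    qed
  qed
next
  case (2 u a \<beta> b ps)
  let ?p = "(head \<Delta> \<beta>, b, ps)"
  have cons: "mul (D.gpath_cons u a \<beta> x) r = map_option (D.gpath_cons u a \<beta>) (mul x r)"
    if "mul ?p q = Some x" for x
    using D.gpath_mult_fst[OF that] by (cases x) simp
  have "Option.bind (mul (u, a, (\<beta>, b) # ps) q) (\<lambda>x. mul x r) =
      map_option (D.gpath_cons u a \<beta>) (Option.bind (mul ?p q) (\<lambda>x. mul x r))"
    using cons by (cases "mul ?p q") auto
  also have "\<dots> = map_option (D.gpath_cons u a \<beta>) (Option.bind (mul q r) (mul ?p))"
    using 2 by simp
  also have "\<dots> = Option.bind (mul q r) (mul (u, a, (\<beta>, b) # ps))"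
    by (cases "mul q r") auto
  finally show ?case .
qed

lemma gpath_mult_unit_right:
  "valid p \<Longrightarrow> mul p (D.gpath_end p, \<one>\<^bsub>\<A> (D.gpath_end p)\<^esub>, []) = Some p"
proof (induction p rule: D.gpath_end.induct)
  case (1 u a)
  interpret monoid "\<A> u" using 1(1) component_monoid by simp
  show ?case using 1 by simp
qed simp

sublocale word: monoid_words K W mul E F
proof unfold_locales
  show "F \<equiv> word_algebra K W mul E" by (simp add: gpath_word_algebra_def)
  show "w \<in> W" if "u \<in> W" "v \<in> W" "mul u v = Some w" for u v w
    using that gpath_mult_valid[of u v w] by (simp add: D.gpaths_iff)
  show "Option.bind (mul u v) (\<lambda>x. mul x w) = Option.bind (mul v w) (mul u)"
    if "u \<in> W" "v \<in> W" "w \<in> W" for u v w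
    using that gpath_mult_assoc by (simp add: D.gpaths_iff)
  show "finite E" by simp
  show "E \<subseteq> W" by (auto simp: D.gpaths_iff component_one_closed)
  fix w assume "w \<in> W"
  then have w: "valid w" by (simp add: D.gpaths_iff)
  obtain u a ps where uap: "w = (u, a, ps)" by (cases w)
  then have u: "u \<in> verts \<Delta>" "a \<in> carrier (\<A> u)" using D.gpath_valid_start[of \<A> u a ps] w by auto
  interpret monoid "\<A> u" using u component_monoid by simp
  show "\<exists>e\<in>E. mul e w = Some w \<and> (\<forall>e'\<in>E - {e}. mul e' w = None)"
    using u by (intro bexI[of _ "(u, \<one>\<^bsub>\<A> u\<^esub>, [])"]) (auto simp: uap split: if_splits)
  show "\<exists>e\<in>E. mul w e = Some w \<and> (\<forall>e'\<in>E - {e}. mul w e' = None)"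
    using gpath_mult_unit_right[OF w] D.gpath_valid_end[OF w]
    by (intro bexI[of _ "(D.gpath_end w, \<one>\<^bsub>\<A> (D.gpath_end w)\<^esub>, [])"])
      (auto simp: D.gpath_mult_None)
qed

end

section \<open>The multilinearity ideal\<close>

context gpath_family
begin

text \<open>A path with one entry left free, as a function of this entry; \<open>v\<close> is the
  vertex whose algebra the entry ranges over. Multilinearity is linearity in every slot, and slots
  can be prefixed and multiplied without keeping track of the position \<open>t\<close>.\<close>

definition slot :: "('a \<Rightarrow> ('v, 'a, 'e) gpath) \<Rightarrow> 'v \<Rightarrow> bool"
  where "slot s v \<longleftrightarrow> (\<exists>p t. valid p \<and> t \<le> gpath_length p \<and>
    v = entry_vertex \<Delta> p t \<and> s = set_entry p t)"

lemma slotI: "valid p \<Longrightarrow> t \<le> gpath_length p \<Longrightarrow> slot (set_entry p t) (entry_vertex \<Delta> p t)"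
  unfolding slot_def by blast

lemma slot_in_verts: "slot s v \<Longrightarrow> v \<in> verts \<Delta>"
  by (auto simp: slot_def D.entry_vertex_in_verts)

lemma slot_valid: "slot s v \<Longrightarrow> x \<in> carrier (\<A> v) \<Longrightarrow> valid (s x)"
  by (auto simp: slot_def D.set_entry_valid)

lemma slot_head: "u \<in> verts \<Delta> \<Longrightarrow> valid (u, a, ps) \<Longrightarrow> slot (\<lambda>x. (u, x, ps)) u"
proof -
  have "set_entry (u, a, ps) 0 = (\<lambda>x. (u, x, ps))" by auto
  then show "valid (u, a, ps) \<Longrightarrow> ?thesis" using slotI[of "(u, a, ps)" 0] by simp
qed

text \<open>The start vertex of a slot does not depend on the entry that is filled in, so it may be
  tested at any single value \<open>x0\<close>.\<close>

lemma slot_cons: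
  assumes s: "slot s v" and \<beta>: "\<beta> \<in> arcs \<Delta>" and a: "a \<in> carrier (\<A> (tail \<Delta> \<beta>))"
    and start: "x0 \<in> carrier (\<A> v)" "fst (s x0) = head \<Delta> \<beta>"
  shows "slot (\<lambda>x. D.gpath_cons (tail \<Delta> \<beta>) a \<beta> (s x)) v"
proof -
  obtain p t where p: "valid p" "t \<le> gpath_length p" "v = entry_vertex \<Delta> p t" "s = set_entry p t"
    using s by (auto simp: slot_def)
  then have fst: "fst p = head \<Delta> \<beta>" using start by simp
  then have "set_entry (D.gpath_cons (tail \<Delta> \<beta>) a \<beta> p) (Suc t) =
      (\<lambda>x. D.gpath_cons (tail \<Delta> \<beta>) a \<beta> (set_entry p t x))"
    by (auto simp: D.set_entry_cons)
  then show ?thesis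
    using slotI[of "D.gpath_cons (tail \<Delta> \<beta>) a \<beta> p" "Suc t"] p \<beta> a fst
    by (simp add: D.gpath_cons_valid D.entry_vertex_cons)
qed

text \<open>The free entry is either the first one or lies behind the first arrow. This stands in
  for a simultaneous induction on path and position.\<close>

lemma slot_induct [consumes 1, case_names head cons]:
  assumes "slot s v"
    and head: "\<And>u a ps. valid (u, a, ps) \<Longrightarrow> u \<in> verts \<Delta> \<Longrightarrow> P (\<lambda>x. (u, x, ps)) u"
    and cons: "\<And>a \<beta> s v. \<beta> \<in> arcs \<Delta> \<Longrightarrow> a \<in> carrier (\<A> (tail \<Delta> \<beta>)) \<Longrightarrow> slot s v \<Longrightarrow>
      (\<And>x. fst (s x) = head \<Delta> \<beta>) \<Longrightarrow> P s v \<Longrightarrow>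
      P (\<lambda>x. D.gpath_cons (tail \<Delta> \<beta>) a \<beta> (s x)) v"
  shows "P s v"
proof -
  have "valid p \<Longrightarrow> t \<le> gpath_length p \<Longrightarrow> P (set_entry p t) (entry_vertex \<Delta> p t)" for p t
  proof (induction p arbitrary: t rule: D.gpath_end.induct)
    case (1 u a)
    then show ?case using head[of u a "[]"] by simp
  next
    case (2 u a \<beta> b ps)
    show ?case
    proof (cases t)
      case 0
      then show ?thesis using head[of u a "(\<beta>, b) # ps"] 2(2) D.gpath_valid_start[OF 2(2)] by simp
    next
      case (Suc t')
      let ?p = "(head \<Delta> \<beta>, b, ps)"
      have p: "valid ?p" "t' \<le> gpath_length ?p" using 2 Suc by auto
      have "set_entry (u, a, (\<beta>, b) # ps) (Suc t') = (\<lambda>x. D.gpath_cons (tail \<Delta> \<beta>) a \<beta> (set_entry ?p t' x))"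
        using 2(2) D.set_entry_Cons[of u a \<beta> b ps t'] by auto
      moreover have "P (\<lambda>x. D.gpath_cons (tail \<Delta> \<beta>) a \<beta> (set_entry ?p t' x)) (entry_vertex \<Delta> ?p t')"
        using 2 p by (intro cons slotI) auto
      ultimately show ?thesis using Suc D.entry_vertex_Cons[of u a \<beta> b ps t'] by simp
    qed
  qed
  then show ?thesis using assms(1) by (auto simp: slot_def)
qed

lemma component_units:
  "v \<in> verts \<Delta> \<Longrightarrow> a \<in> carrier (\<A> v) \<Longrightarrow> \<one>\<^bsub>\<A> v\<^esub> \<otimes>\<^bsub>\<A> v\<^esub> a = a"
  "v \<in> verts \<Delta> \<Longrightarrow> a \<in> carrier (\<A> v) \<Longrightarrow> a \<otimes>\<^bsub>\<A> v\<^esub> \<one>\<^bsub>\<A> v\<^esub> = a"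
  using monoid.l_one[OF component_monoid] monoid.r_one[OF component_monoid] by auto

lemma component_inhabited: "v \<in> verts \<Delta> \<Longrightarrow> \<exists>x. x \<in> carrier (\<A> v)"
  using component_one_closed by blast

text \<open>A path multiplied onto a slot either fails to compose or gives a slot again, with the
  free entry multiplied by a constant. The constant comes from the adjacent entry of
  \<open>p\<close> if the free entry is the first one, and is the identity otherwise. This is what
  makes multiplication by paths carry relators to relators.\<close>

lemma slot_mult_left:
  assumes "valid p" "slot s v"
  shows "(\<forall>x\<in>carrier (\<A> v). mul p (s x) = None) \<or>
    (\<exists>s' c. slot s' v \<and> c \<in> carrier (\<A> v) \<and>
      (\<forall>x\<in>carrier (\<A> v). mul p (s x) = Some (s' (c \<otimes>\<^bsub>\<A> v\<^esub> x))))"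
  using assms(1)
proof (induction p rule: D.gpath_end.induct)
  case (1 u a)
  show ?case using assms(2)
  proof (induction rule: slot_induct[case_names h c])
    case (h w b ps)
    show ?case
    proof (cases "u = w")
      case True
      then show ?thesis using 1 slot_head[OF h(2,1)]
        by (intro disjI2 exI[of _ "\<lambda>x. (w, x, ps)"] exI[of _ a]) auto
    qed simp
  next
    case (c b \<beta> s v)
    show ?case
    proof (cases "u = tail \<Delta> \<beta>")
      case True
      have "slot (\<lambda>x. D.gpath_cons u (a \<otimes>\<^bsub>\<A> u\<^esub> b) \<beta> (s x)) v"
        using 1 c component_inhabited[OF slot_in_verts[OF c(3)]] True
        by (auto intro!: slot_cons component_mult_closed)
      moreover have "mul (u, a, []) (D.gpath_cons (tail \<Delta> \<beta>) b \<beta> q) =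
          Some (D.gpath_cons u (a \<otimes>\<^bsub>\<A> u\<^esub> b) \<beta> q)" for q
        using True by (cases q) simp
      ultimately show ?thesis using slot_in_verts[OF c(3)]
        by (intro disjI2 exI[of _ "\<lambda>x. D.gpath_cons u (a \<otimes>\<^bsub>\<A> u\<^esub> b) \<beta> (s x)"] exI[of _ "\<one>\<^bsub>\<A> v\<^esub>"])
          (simp add: component_units component_one_closed)
    next
      case False
      have "mul (u, a, []) (D.gpath_cons (tail \<Delta> \<beta>) b \<beta> q) = None" for q
        using False by (cases q) simp
      then show ?thesis by simp
    qed
  qed
next
  case (2 u a \<beta> b ps)
  let ?p = "(head \<Delta> \<beta>, b, ps)"
  have u: "u = tail \<Delta> \<beta>" "\<beta> \<in> arcs \<Delta>" "a \<in> carrier (\<A> (tail \<Delta> \<beta>))" "valid ?p" using 2(2) by auto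
  consider "\<forall>x\<in>carrier (\<A> v). mul ?p (s x) = None"
    | s' c where "slot s' v" "c \<in> carrier (\<A> v)"
      "\<And>x. x \<in> carrier (\<A> v) \<Longrightarrow> mul ?p (s x) = Some (s' (c \<otimes>\<^bsub>\<A> v\<^esub> x))"
    using 2(1)[OF u(4)] by blast
  then show ?case
  proof cases
    case 1
    then show ?thesis by simp
  next
    case (2 s' c)
    have v: "v \<in> verts \<Delta>" by (rule slot_in_verts[OF 2(1)])
    \<comment> \<open>The slot \<open>s'\<close> is known only at the values
      \<open>c \<otimes> x\<close>, where it is a product of paths; its start vertex is therefore
      read off at \<open>x = \<one>\<close>.\<close>
    have "fst (s' (c \<otimes>\<^bsub>\<A> v\<^esub> \<one>\<^bsub>\<A> v\<^esub>)) = head \<Delta> \<beta>"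
      using D.gpath_mult_fst[OF 2(3)[OF component_one_closed[OF v]]] by simp
    then have "slot (\<lambda>x. D.gpath_cons u a \<beta> (s' x)) v"
      unfolding u(1) using u 2 v
      by (intro slot_cons[where ?x0.0 = "c \<otimes>\<^bsub>\<A> v\<^esub> \<one>\<^bsub>\<A> v\<^esub>"] component_mult_closed component_one_closed) auto
    then show ?thesis using 2
      by (intro disjI2 exI[of _ "\<lambda>x. D.gpath_cons u a \<beta> (s' x)"] exI[of _ c]) auto
  qed
qed

text \<open>Multiplication recurses on the left factor, which here is the slot itself, so the
  induction is on the slot. The free entry is affected only when it is the last entry of its
  path.\<close>

lemma slot_mult_right:
  assumes "valid q" "slot s v"
  shows "(\<forall>x\<in>carrier (\<A> v). mul (s x) q = None) \<or>
    (\<exists>s' c. slot s' v \<and> c \<in> carrier (\<A> v) \<and>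
      (\<forall>x\<in>carrier (\<A> v). mul (s x) q = Some (s' (x \<otimes>\<^bsub>\<A> v\<^esub> c))))"
  using assms(2)
proof (induction rule: slot_induct[case_names h c])
  case (h u a ps)
  obtain w b qs where q: "q = (w, b, qs)" by (cases q)
  have w: "b \<in> carrier (\<A> w)" "w \<in> verts \<Delta>" using assms(1) D.gpath_valid_start[of \<A> w b qs] q by auto
  show ?case
  proof (cases "D.gpath_end (u, a, ps) = w")
    case False
    have "mul (u, x, ps) q = None" for x
      using False D.gpath_mult_None[of \<A> "(u, x, ps)" q]
      by (simp add: q flip: D.awlast_eq_gpath_end)
    then show ?thesis by simp
  next
    case True
    show ?thesis
    proof (cases ps)
      case Nil
      then show ?thesis using True w assms(1) slot_head[of u b qs]
        by (intro disjI2 exI[of _ "\<lambda>x. (u, x, qs)"] exI[of _ b]) (auto simp: q)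
    next
      case (Cons y ps')
      obtain \<beta> d where y: "y = (\<beta>, d)" by (cases y)
      have \<beta>: "\<beta> \<in> arcs \<Delta>" "tail \<Delta> \<beta> = u" "valid (head \<Delta> \<beta>, d, ps')" using h(1) Cons y by auto
      \<comment> \<open>The rest of the path absorbs \<open>q\<close> and becomes the fixed rest of
        the new slot. The free first entry stays untouched, hence the constant is the identity of
        \<open>\<A> u\<close>.\<close>
      obtain r where r: "mul (head \<Delta> \<beta>, d, ps') q = Some r"
        using True Cons y D.gpath_mult_None[of \<A> "(head \<Delta> \<beta>, d, ps')" q]
        by (auto simp: q simp del: D.gpath_mult_simps)
      obtain e rs where re: "r = (head \<Delta> \<beta>, e, rs)"
        using D.gpath_mult_fst[OF r] by (cases r) auto
      have "valid r" using gpath_mult_valid[OF \<beta>(3) assms(1) r] .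
      then have "slot (\<lambda>x. (u, x, (\<beta>, e) # rs)) u"
        using \<beta> h re slot_head[of u a "(\<beta>, e) # rs"] D.gpath_valid_start[OF h(1)] by auto
      then show ?thesis using h(2) r
        by (intro disjI2 exI[of _ "\<lambda>x. (u, x, (\<beta>, e) # rs)"] exI[of _ "\<one>\<^bsub>\<A> u\<^esub>"])
          (auto simp: Cons y re component_units component_one_closed)
    qed
  qed
next
  case (c a \<beta> s v)
  have cons: "mul (D.gpath_cons (tail \<Delta> \<beta>) a \<beta> (s x)) q =
      map_option (D.gpath_cons (tail \<Delta> \<beta>) a \<beta>) (mul (s x) q)" for x
    using c(4)[of x] by (cases "s x") simp
  from c(5) show ?case
  proof
    assume "\<exists>s' d. slot s' v \<and> d \<in> carrier (\<A> v) \<and>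
      (\<forall>x\<in>carrier (\<A> v). mul (s x) q = Some (s' (x \<otimes>\<^bsub>\<A> v\<^esub> d)))"
    then obtain s' d where s': "slot s' v" "d \<in> carrier (\<A> v)"
      "\<And>x. x \<in> carrier (\<A> v) \<Longrightarrow> mul (s x) q = Some (s' (x \<otimes>\<^bsub>\<A> v\<^esub> d))" by blast
    have v: "v \<in> verts \<Delta>" by (rule slot_in_verts[OF c(3)])
    have "fst (s' (\<one>\<^bsub>\<A> v\<^esub> \<otimes>\<^bsub>\<A> v\<^esub> d)) = head \<Delta> \<beta>"
      using D.gpath_mult_fst[OF s'(3)[OF component_one_closed[OF v]]] c(4) by simp
    then have "slot (\<lambda>x. D.gpath_cons (tail \<Delta> \<beta>) a \<beta> (s' x)) v"
      using c s' v
      by (intro slot_cons[where ?x0.0 = "\<one>\<^bsub>\<A> v\<^esub> \<otimes>\<^bsub>\<A> v\<^esub> d"] component_mult_closed component_one_closed) auto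
    then show ?thesis using s'
      by (intro disjI2 exI[of _ "\<lambda>x. D.gpath_cons (tail \<Delta> \<beta>) a \<beta> (s' x)"] exI[of _ d]) (auto simp: cons)
  qed (simp add: cons)
qed

abbreviation "N \<equiv> gpath_multilinearity K \<Delta> \<A>"

abbreviation "sw \<equiv> single_word K :: ('v, 'a, 'e) gpath \<Rightarrow> _"

text \<open>The generators of \<open>gpath_multilinearity\<close>, with path and position replaced
  by a slot.\<close>

definition "relators =
  {sw (s (x \<oplus>\<^bsub>\<A> v\<^esub> y)) \<ominus>\<^bsub>F\<^esub> (sw (s x) \<oplus>\<^bsub>F\<^esub> sw (s y)) | s v x y.
    slot s v \<and> x \<in> carrier (\<A> v) \<and> y \<in> carrier (\<A> v)} \<union>
  {sw (s (c \<odot>\<^bsub>\<A> v\<^esub> x)) \<ominus>\<^bsub>F\<^esub> c \<odot>\<^bsub>F\<^esub> sw (s x) | s v c x.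
    slot s v \<and> c \<in> carrier K \<and> x \<in> carrier (\<A> v)}"

lemma relator_addI: "slot s v \<Longrightarrow> x \<in> carrier (\<A> v) \<Longrightarrow> y \<in> carrier (\<A> v) \<Longrightarrow>
    sw (s (x \<oplus>\<^bsub>\<A> v\<^esub> y)) \<ominus>\<^bsub>F\<^esub> (sw (s x) \<oplus>\<^bsub>F\<^esub> sw (s y)) \<in> relators"
  unfolding relators_def by blast

lemma relator_smultI: "slot s v \<Longrightarrow> c \<in> carrier K \<Longrightarrow> x \<in> carrier (\<A> v) \<Longrightarrow>
    sw (s (c \<odot>\<^bsub>\<A> v\<^esub> x)) \<ominus>\<^bsub>F\<^esub> c \<odot>\<^bsub>F\<^esub> sw (s x) \<in> relators"
  unfolding relators_def by blast

lemma N_eq: "N = lin_span K F relators"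
proof -
  have "{sw (set_entry p t (x \<oplus>\<^bsub>\<A> (entry_vertex \<Delta> p t)\<^esub> y)) \<ominus>\<^bsub>F\<^esub>
        (sw (set_entry p t x) \<oplus>\<^bsub>F\<^esub> sw (set_entry p t y)) | p t x y.
        p \<in> gpaths \<Delta> \<A> \<and> t \<le> gpath_length p \<and>
        x \<in> carrier (\<A> (entry_vertex \<Delta> p t)) \<and> y \<in> carrier (\<A> (entry_vertex \<Delta> p t))} =
    {sw (s (x \<oplus>\<^bsub>\<A> v\<^esub> y)) \<ominus>\<^bsub>F\<^esub> (sw (s x) \<oplus>\<^bsub>F\<^esub> sw (s y)) | s v x y.
      slot s v \<and> x \<in> carrier (\<A> v) \<and> y \<in> carrier (\<A> v)}"
    unfolding slot_def D.gpaths_iff by blast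
  moreover have "{sw (set_entry p t (c \<odot>\<^bsub>\<A> (entry_vertex \<Delta> p t)\<^esub> x)) \<ominus>\<^bsub>F\<^esub>
        c \<odot>\<^bsub>F\<^esub> sw (set_entry p t x) | p t c x.
        p \<in> gpaths \<Delta> \<A> \<and> t \<le> gpath_length p \<and>
        c \<in> carrier K \<and> x \<in> carrier (\<A> (entry_vertex \<Delta> p t))} =
    {sw (s (c \<odot>\<^bsub>\<A> v\<^esub> x)) \<ominus>\<^bsub>F\<^esub> c \<odot>\<^bsub>F\<^esub> sw (s x) | s v c x.
      slot s v \<and> c \<in> carrier K \<and> x \<in> carrier (\<A> v)}"
    unfolding slot_def D.gpaths_iff by blast
  ultimately show ?thesis
    unfolding gpath_multilinearity_def relators_def Let_def by simp
qed

sublocale F: assoc_algebra K F by (rule word.word_assoc_algebra)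

lemma sw_closed [simp]: "valid p \<Longrightarrow> sw p \<in> carrier F"
  by (simp add: D.gpaths_iff)

lemma component_add_closed:
    "v \<in> verts \<Delta> \<Longrightarrow> x \<in> carrier (\<A> v) \<Longrightarrow> y \<in> carrier (\<A> v) \<Longrightarrow> x \<oplus>\<^bsub>\<A> v\<^esub> y \<in> carrier (\<A> v)"
  and component_smult_closed:
    "v \<in> verts \<Delta> \<Longrightarrow> c \<in> carrier K \<Longrightarrow> x \<in> carrier (\<A> v) \<Longrightarrow> c \<odot>\<^bsub>\<A> v\<^esub> x \<in> carrier (\<A> v)"
proof -
  assume v: "v \<in> verts \<Delta>"
  interpret assoc_algebra K "\<A> v" by (rule component_algebra[OF v])
  show "x \<in> carrier (\<A> v) \<Longrightarrow> y \<in> carrier (\<A> v) \<Longrightarrow> x \<oplus>\<^bsub>\<A> v\<^esub> y \<in> carrier (\<A> v)"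
    "c \<in> carrier K \<Longrightarrow> x \<in> carrier (\<A> v) \<Longrightarrow> c \<odot>\<^bsub>\<A> v\<^esub> x \<in> carrier (\<A> v)" by simp_all
qed

lemma relators_closed: "relators \<subseteq> carrier F"
  unfolding relators_def
  by (auto simp: slot_valid slot_in_verts component_add_closed component_smult_closed)

lemma N_submodule: "submodule N K F"
  unfolding N_eq by (rule F.lin_span_submodule[OF relators_closed])

lemma relators_N: "relators \<subseteq> N"
  unfolding N_eq by (rule lin_span_incl)

text \<open>Below, \<open>T\<close> is left or right multiplication by a path, so that \<open>h\<close> is multiplication by the
  adjacent entry of that path.\<close>

lemma relator_image_mem:
  assumes T: "\<And>f g. f \<in> carrier F \<Longrightarrow> g \<in> carrier F \<Longrightarrow> T (f \<oplus>\<^bsub>F\<^esub> g) = T f \<oplus>\<^bsub>F\<^esub> T g"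
    "\<And>c f. c \<in> carrier K \<Longrightarrow> f \<in> carrier F \<Longrightarrow> T (c \<odot>\<^bsub>F\<^esub> f) = c \<odot>\<^bsub>F\<^esub> T f"
    "\<And>f. f \<in> carrier F \<Longrightarrow> T f \<in> carrier F"
    and slot: "\<And>s v. slot s v \<Longrightarrow> (\<forall>x\<in>carrier (\<A> v). T (sw (s x)) = \<zero>\<^bsub>F\<^esub>) \<or>
      (\<exists>s' h. slot s' v \<and> (\<forall>x\<in>carrier (\<A> v). h x \<in> carrier (\<A> v) \<and> T (sw (s x)) = sw (s' (h x))) \<and>
        (\<forall>x\<in>carrier (\<A> v). \<forall>y\<in>carrier (\<A> v). h (x \<oplus>\<^bsub>\<A> v\<^esub> y) = h x \<oplus>\<^bsub>\<A> v\<^esub> h y) \<and>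
        (\<forall>c\<in>carrier K. \<forall>x\<in>carrier (\<A> v). h (c \<odot>\<^bsub>\<A> v\<^esub> x) = c \<odot>\<^bsub>\<A> v\<^esub> h x))"
    and f: "f \<in> N"
  shows "T f \<in> N"
proof -
  \<comment> \<open>The relators are differences, whereas \<open>T\<close> is assumed to respect
    sums and scalars; the difference is rewritten with the scalar
    \<open>\<ominus> \<one>\<close>.\<close>
  have minus: "T (f \<ominus>\<^bsub>F\<^esub> g) = T f \<ominus>\<^bsub>F\<^esub> T g" if "f \<in> carrier F" "g \<in> carrier F" for f g
  proof -
    have "f \<ominus>\<^bsub>F\<^esub> g = f \<oplus>\<^bsub>F\<^esub> (\<ominus> \<one>) \<odot>\<^bsub>F\<^esub> g" using that by (simp add: F.M.minus_eq F.smult_l_minus)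
    then have "T (f \<ominus>\<^bsub>F\<^esub> g) = T f \<oplus>\<^bsub>F\<^esub> (\<ominus> \<one>) \<odot>\<^bsub>F\<^esub> T g" using that by (simp add: T)
    then show ?thesis using that by (simp add: F.M.minus_eq F.smult_l_minus T(3))
  qed
  have zero: "T \<zero>\<^bsub>F\<^esub> = \<zero>\<^bsub>F\<^esub>"
    using T(2)[of \<zero> "\<zero>\<^bsub>F\<^esub>"] T(3)[of "\<zero>\<^bsub>F\<^esub>"] by simp
  have base: "T f \<in> N" if "f \<in> relators" for f
    using that unfolding relators_def
  proof (elim UnE CollectE exE conjE)
    fix s v x y
    assume f: "f = sw (s (x \<oplus>\<^bsub>\<A> v\<^esub> y)) \<ominus>\<^bsub>F\<^esub> (sw (s x) \<oplus>\<^bsub>F\<^esub> sw (s y))"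
      and s: "slot s v" and xy: "x \<in> carrier (\<A> v)" "y \<in> carrier (\<A> v)"
    note cl = component_add_closed[OF slot_in_verts[OF s]]
    have Tf: "T f = T (sw (s (x \<oplus>\<^bsub>\<A> v\<^esub> y))) \<ominus>\<^bsub>F\<^esub> (T (sw (s x)) \<oplus>\<^bsub>F\<^esub> T (sw (s y)))"
      unfolding f using xy s slot_valid[OF s] by (simp add: minus cl T(1))
    from slot[OF s] show "T f \<in> N"
    proof (elim disjE exE conjE)
      assume "\<forall>x\<in>carrier (\<A> v). T (sw (s x)) = \<zero>\<^bsub>F\<^esub>"
      then have "T f = \<zero>\<^bsub>F\<^esub>" unfolding Tf using xy cl by (simp add: F.M.minus_eq)
      then show ?thesis using F.submodule_zero[OF N_submodule] by simp
    next
      fix s' h assume s': "slot s' v"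
        and "\<forall>x\<in>carrier (\<A> v). h x \<in> carrier (\<A> v) \<and> T (sw (s x)) = sw (s' (h x))"
        and "\<forall>x\<in>carrier (\<A> v). \<forall>y\<in>carrier (\<A> v). h (x \<oplus>\<^bsub>\<A> v\<^esub> y) = h x \<oplus>\<^bsub>\<A> v\<^esub> h y"
      then have "T f \<in> relators"
        unfolding Tf using xy cl relator_addI[OF s', of "h x" "h y"] by simp
      then show ?thesis using relators_N by (rule rev_subsetD)
    qed
  next
    fix s v c x
    assume f: "f = sw (s (c \<odot>\<^bsub>\<A> v\<^esub> x)) \<ominus>\<^bsub>F\<^esub> c \<odot>\<^bsub>F\<^esub> sw (s x)"
      and s: "slot s v" and cx: "c \<in> carrier K" "x \<in> carrier (\<A> v)"
    note cl = component_smult_closed[OF slot_in_verts[OF s]]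
    have Tf: "T f = T (sw (s (c \<odot>\<^bsub>\<A> v\<^esub> x))) \<ominus>\<^bsub>F\<^esub> c \<odot>\<^bsub>F\<^esub> T (sw (s x))"
      unfolding f using cx s slot_valid[OF s] by (simp add: minus cl T(2))
    from slot[OF s] show "T f \<in> N"
    proof (elim disjE exE conjE)
      assume "\<forall>x\<in>carrier (\<A> v). T (sw (s x)) = \<zero>\<^bsub>F\<^esub>"
      then have "T f = \<zero>\<^bsub>F\<^esub>" unfolding Tf using cx cl by (simp add: F.M.minus_eq)
      then show ?thesis using F.submodule_zero[OF N_submodule] by simp
    next
      fix s' h assume s': "slot s' v"
        and "\<forall>x\<in>carrier (\<A> v). h x \<in> carrier (\<A> v) \<and> T (sw (s x)) = sw (s' (h x))"
        and "\<forall>c\<in>carrier K. \<forall>x\<in>carrier (\<A> v). h (c \<odot>\<^bsub>\<A> v\<^esub> x) = c \<odot>\<^bsub>\<A> v\<^esub> h x"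
      then have "T f \<in> relators"
        unfolding Tf using cx cl relator_smultI[OF s', of c "h x"] by simp
      then show ?thesis using relators_N by (rule rev_subsetD)
    qed
  qed
  show ?thesis using f[unfolded N_eq] relators_closed
  proof (induction rule: F.lin_span_induct)
    case (add x y)
    then show ?case using F.submoduleE(5)[OF N_submodule] by (simp add: T)
  next
    case (smult c x)
    then show ?case using F.submoduleE(4)[OF N_submodule] by (simp add: T)
  qed (use base zero F.submodule_zero[OF N_submodule] in auto)
qed

text \<open>By bilinearity it suffices to multiply by single paths. These carry a relator to zero or
  to another relator, since they act on a slot by multiplying its free entry by a constant, which is
  a linear operation.\<close>

lemma N_ideal: "ideal N F"
proof (rule idealI)
  show "ring F" by (rule F.M.ring_axioms)
  show "subgroup N (add_monoid F)" using N_submodule submodule.axioms(1) by blast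
  fix n f assume n: "n \<in> N" and f: "f \<in> carrier F"
  have nc: "n \<in> carrier F" using n F.submoduleE(1)[OF N_submodule] by blast
  have l: "sw p \<otimes>\<^bsub>F\<^esub> n \<in> N" if p: "valid p" for p
  proof (rule relator_image_mem[OF _ _ _ _ n])
    fix s v assume s: "slot s v"
    have v: "v \<in> verts \<Delta>" by (rule slot_in_verts[OF s])
    interpret Av: assoc_algebra K "\<A> v" by (rule component_algebra[OF v])
    have m: "sw p \<otimes>\<^bsub>F\<^esub> sw (s x) = word.option_word (mul p (s x))" if "x \<in> carrier (\<A> v)" for x
      using p slot_valid[OF s that] by (simp add: word.single_word_mult D.gpaths_iff)
    from slot_mult_left[OF p s]
    show "(\<forall>x\<in>carrier (\<A> v). sw p \<otimes>\<^bsub>F\<^esub> sw (s x) = \<zero>\<^bsub>F\<^esub>) \<or>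
      (\<exists>s' h. slot s' v \<and>
        (\<forall>x\<in>carrier (\<A> v). h x \<in> carrier (\<A> v) \<and> sw p \<otimes>\<^bsub>F\<^esub> sw (s x) = sw (s' (h x))) \<and>
        (\<forall>x\<in>carrier (\<A> v). \<forall>y\<in>carrier (\<A> v). h (x \<oplus>\<^bsub>\<A> v\<^esub> y) = h x \<oplus>\<^bsub>\<A> v\<^esub> h y) \<and>
        (\<forall>c\<in>carrier K. \<forall>x\<in>carrier (\<A> v). h (c \<odot>\<^bsub>\<A> v\<^esub> x) = c \<odot>\<^bsub>\<A> v\<^esub> h x))"
    proof (elim disjE exE conjE)
      fix s' d assume "slot s' v" "d \<in> carrier (\<A> v)"
        "\<forall>x\<in>carrier (\<A> v). mul p (s x) = Some (s' (d \<otimes>\<^bsub>\<A> v\<^esub> x))"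
      then show ?thesis
        by (intro disjI2 exI[of _ s'] exI[of _ "\<lambda>x. d \<otimes>\<^bsub>\<A> v\<^esub> x"])
          (simp add: m Av.M.r_distr Av.smult_mult_right)
    qed (simp add: m)
  qed (use p in \<open>simp_all add: F.M.r_distr F.smult_mult_right\<close>)
  have r: "n \<otimes>\<^bsub>F\<^esub> sw p \<in> N" if p: "valid p" for p
  proof (rule relator_image_mem[where T = "\<lambda>n. n \<otimes>\<^bsub>F\<^esub> sw p", OF _ _ _ _ n])
    fix s v assume s: "slot s v"
    have v: "v \<in> verts \<Delta>" by (rule slot_in_verts[OF s])
    interpret Av: assoc_algebra K "\<A> v" by (rule component_algebra[OF v])
    have m: "sw (s x) \<otimes>\<^bsub>F\<^esub> sw p = word.option_word (mul (s x) p)" if "x \<in> carrier (\<A> v)" for x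
      using p slot_valid[OF s that] by (simp add: word.single_word_mult D.gpaths_iff)
    from slot_mult_right[OF p s]
    show "(\<forall>x\<in>carrier (\<A> v). sw (s x) \<otimes>\<^bsub>F\<^esub> sw p = \<zero>\<^bsub>F\<^esub>) \<or>
      (\<exists>s' h. slot s' v \<and>
        (\<forall>x\<in>carrier (\<A> v). h x \<in> carrier (\<A> v) \<and> sw (s x) \<otimes>\<^bsub>F\<^esub> sw p = sw (s' (h x))) \<and>
        (\<forall>x\<in>carrier (\<A> v). \<forall>y\<in>carrier (\<A> v). h (x \<oplus>\<^bsub>\<A> v\<^esub> y) = h x \<oplus>\<^bsub>\<A> v\<^esub> h y) \<and>
        (\<forall>c\<in>carrier K. \<forall>x\<in>carrier (\<A> v). h (c \<odot>\<^bsub>\<A> v\<^esub> x) = c \<odot>\<^bsub>\<A> v\<^esub> h x))"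
    proof (elim disjE exE conjE)
      fix s' d assume "slot s' v" "d \<in> carrier (\<A> v)"
        "\<forall>x\<in>carrier (\<A> v). mul (s x) p = Some (s' (x \<otimes>\<^bsub>\<A> v\<^esub> d))"
      then show ?thesis
        by (intro disjI2 exI[of _ s'] exI[of _ "\<lambda>x. x \<otimes>\<^bsub>\<A> v\<^esub> d"])
          (simp add: m Av.M.l_distr Av.smult_mult_left)
    qed (simp add: m)
  qed (use p in \<open>simp_all add: F.M.l_distr F.smult_mult_left\<close>)
  note N = F.submoduleE(4,5)[OF N_submodule] F.submodule_zero[OF N_submodule]
  show "f \<otimes>\<^bsub>F\<^esub> n \<in> N" using f
    by (induction f rule: word.word_induct)
      (simp_all add: nc F.M.l_distr F.smult_mult_left N l D.gpaths_iff)
  show "n \<otimes>\<^bsub>F\<^esub> f \<in> N" using f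
    by (induction f rule: word.word_induct)
      (simp_all add: nc F.M.r_distr F.smult_mult_right N r D.gpaths_iff)
qed

end

section \<open>The generalized path algebra\<close>

text \<open>A homomorphism that kills \<open>I\<close> is constant on cosets, so its value at an
  arbitrarily chosen representative depends on the coset alone.\<close>

lemma (in assoc_algebra) quotient_lift:
  assumes I: "ideal I M" and L: "L \<in> alg_hom R M B" and B: "assoc_algebra R B"
    and ker: "\<And>x. x \<in> I \<Longrightarrow> L x = \<zero>\<^bsub>B\<^esub>"
  shows "\<exists>\<psi> \<in> alg_hom R (quotient_algebra M I) B. \<forall>x\<in>carrier M. \<psi> (I +>\<^bsub>M\<^esub> x) = L x"
proof -
  interpret B: assoc_algebra R B by fact
  interpret L: ring_hom_ring M B L
    by (rule alg_hom_ring_hom_ring[OF L M.ring_axioms B.M.ring_axioms])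
  note N = ideal_submodule[OF I]
  have L_eq: "L y = L x" if "x \<in> carrier M" "y \<in> I +>\<^bsub>M\<^esub> x" for x y
  proof -
    have y: "y \<in> carrier M" "y \<ominus>\<^bsub>M\<^esub> x \<in> I"
      using coset_mem_iff[OF N that(1)] coset_eq_iff[OF N _ that(1)] that(2) by auto
    then have "L y \<ominus>\<^bsub>B\<^esub> L x = \<zero>\<^bsub>B\<^esub>"
      using ker[OF y(2)] that(1) by (simp add: M.minus_eq B.M.minus_eq)
    then show ?thesis using y that by simp
  qed
  define \<psi> where "\<psi> X = L (SOME x. x \<in> X)" for X
  have \<psi>: "\<psi> (I +>\<^bsub>M\<^esub> x) = L x" if "x \<in> carrier M" for x
  proof -
    have "x \<in> I +>\<^bsub>M\<^esub> x" using coset_mem_iff[OF N that] that by simp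
    then have "(SOME y. y \<in> I +>\<^bsub>M\<^esub> x) \<in> I +>\<^bsub>M\<^esub> x" by (rule someI)
    then show ?thesis unfolding \<psi>_def by (rule L_eq[OF that])
  qed
  note simps = quotient_algebra_coset_mult[OF I] quotient_algebra_smult[OF N]
    quotient_algebra_add[OF N] quotient_algebra_one
  have "\<psi> \<in> alg_hom R (quotient_algebra M I) B"
    unfolding alg_hom_def
    by (auto intro!: ring_hom_memI simp: quotient_algebra_carrier simps \<psi> alg_homD(5)[OF L])
  then show ?thesis using \<psi> by blast
qed

lemma (in ring) ideal_finsum_closed:
  assumes "ideal I R" "finite U" "\<And>i. i \<in> U \<Longrightarrow> f i \<in> I"
  shows "(\<Oplus>i\<in>U. f i) \<in> I"
  using assms(2,3)
proof (induction U rule: finite_induct)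
  interpret I: ideal I R by fact
  case empty
  then show ?case by simp
next
  interpret I: ideal I R by fact
  case (insert u U)
  then have "f \<in> U \<rightarrow> carrier R" "f u \<in> carrier R" using I.a_subset by auto
  with insert show ?case by simp
qed

context gpath_family
begin

abbreviation "G \<equiv> gpath_algebra K \<Delta> \<A>"
abbreviation "cls \<equiv> gpath_class K \<Delta> \<A>"
abbreviation "vertex_unit i \<equiv> cls (i, \<one>\<^bsub>\<A> i\<^esub>, [])"
abbreviation "J \<equiv> gpath_arrow_ideal K \<Delta> \<A>"

lemma gpath_assoc_algebra: "assoc_algebra K G"
  unfolding gpath_algebra_def by (rule F.quotient_assoc_algebra[OF N_ideal])

sublocale G: assoc_algebra K G by (rule gpath_assoc_algebra)

lemma proj_alg_hom: "(+>\<^bsub>F\<^esub>) N \<in> alg_hom K F G"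
  unfolding gpath_algebra_def by (rule F.coset_alg_hom[OF N_ideal])

lemmas proj = alg_homD[OF proj_alg_hom]

lemma G_zero: "N +>\<^bsub>F\<^esub> \<zero>\<^bsub>F\<^esub> = \<zero>\<^bsub>G\<^esub>"
  using ring_hom_zero[of "(+>\<^bsub>F\<^esub>) N" F G] proj_alg_hom F.M.ring_axioms G.M.ring_axioms
  by (auto simp: alg_hom_def)

lemma cls_closed [simp]: "valid p \<Longrightarrow> cls p \<in> carrier G"
  by (simp add: gpath_class_def proj(1))

lemma cls_mult:
  assumes "valid p" "valid q"
  shows "cls p \<otimes>\<^bsub>G\<^esub> cls q = (case mul p q of None \<Rightarrow> \<zero>\<^bsub>G\<^esub> | Some r \<Rightarrow> cls r)"
proof -
  have "cls p \<otimes>\<^bsub>G\<^esub> cls q = N +>\<^bsub>F\<^esub> (sw p \<otimes>\<^bsub>F\<^esub> sw q)"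
    using assms by (simp add: gpath_class_def proj(2))
  also have "sw p \<otimes>\<^bsub>F\<^esub> sw q = word.option_word (mul p q)"
    using assms by (simp add: word.single_word_mult D.gpaths_iff)
  finally show ?thesis
    by (cases "mul p q") (simp_all add: G_zero gpath_class_def)
qed

lemma cls_add:
  assumes s: "slot s v" and xy: "x \<in> carrier (\<A> v)" "y \<in> carrier (\<A> v)"
  shows "cls (s (x \<oplus>\<^bsub>\<A> v\<^esub> y)) = cls (s x) \<oplus>\<^bsub>G\<^esub> cls (s y)"
proof -
  note v = slot_valid[OF s] component_add_closed[OF slot_in_verts[OF s]]
  have "sw (s (x \<oplus>\<^bsub>\<A> v\<^esub> y)) \<ominus>\<^bsub>F\<^esub> (sw (s x) \<oplus>\<^bsub>F\<^esub> sw (s y)) \<in> N"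
    using relator_addI[OF s xy] relators_N by blast
  then have "cls (s (x \<oplus>\<^bsub>\<A> v\<^esub> y)) = N +>\<^bsub>F\<^esub> (sw (s x) \<oplus>\<^bsub>F\<^esub> sw (s y))"
    unfolding gpath_class_def using F.coset_eq_iff[OF N_submodule] xy v by simp
  then show ?thesis using xy v by (simp add: proj(3) gpath_class_def)
qed

lemma cls_smult:
  assumes s: "slot s v" and cx: "c \<in> carrier K" "x \<in> carrier (\<A> v)"
  shows "cls (s (c \<odot>\<^bsub>\<A> v\<^esub> x)) = c \<odot>\<^bsub>G\<^esub> cls (s x)"
proof -
  note v = slot_valid[OF s] component_smult_closed[OF slot_in_verts[OF s]]
  have "sw (s (c \<odot>\<^bsub>\<A> v\<^esub> x)) \<ominus>\<^bsub>F\<^esub> c \<odot>\<^bsub>F\<^esub> sw (s x) \<in> N"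
    using relator_smultI[OF s cx] relators_N by blast
  then have "cls (s (c \<odot>\<^bsub>\<A> v\<^esub> x)) = N +>\<^bsub>F\<^esub> (c \<odot>\<^bsub>F\<^esub> sw (s x))"
    unfolding gpath_class_def using F.coset_eq_iff[OF N_submodule] cx v by simp
  then show ?thesis using cx v by (simp add: proj(5) gpath_class_def)
qed

lemma gpath_algebra_induct [consumes 1, case_names zero add]:
  assumes x: "x \<in> carrier G" and zero: "P \<zero>\<^bsub>G\<^esub>"
    and add: "\<And>c p x. c \<in> carrier K \<Longrightarrow> valid p \<Longrightarrow> x \<in> carrier G \<Longrightarrow> P x \<Longrightarrow>
      P (c \<odot>\<^bsub>G\<^esub> cls p \<oplus>\<^bsub>G\<^esub> x)"
  shows "P x"
proof -
  have "P (N +>\<^bsub>F\<^esub> f)" if "f \<in> carrier F" for f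
    using that
  proof (induction f rule: word.word_induct)
    case zero
    then show ?case using assms(2) by (simp add: G_zero)
  next
    case (add c w f)
    then have w: "valid w" by (simp add: D.gpaths_iff)
    have "P (c \<odot>\<^bsub>G\<^esub> cls w \<oplus>\<^bsub>G\<^esub> (N +>\<^bsub>F\<^esub> f))"
      using add w by (intro assms(3)) (auto simp: proj(1))
    then show ?case using add w by (simp add: proj(3,5) gpath_class_def)
  qed
  moreover obtain f where "f \<in> carrier F" "x = N +>\<^bsub>F\<^esub> f"
    using x unfolding gpath_algebra_def quotient_algebra_carrier by blast
  ultimately show ?thesis by simp
qed

lemma E_sum:
  assumes "abelian_monoid V" "\<And>i. i \<in> verts \<Delta> \<Longrightarrow> h (i, \<one>\<^bsub>\<A> i\<^esub>, []) \<in> carrier V"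
  shows "(\<Oplus>\<^bsub>V\<^esub>p\<in>E. h p) = (\<Oplus>\<^bsub>V\<^esub>i\<in>verts \<Delta>. h (i, \<one>\<^bsub>\<A> i\<^esub>, []))"
proof -
  interpret V: abelian_monoid V by fact
  have E: "E = (\<lambda>i. (i, \<one>\<^bsub>\<A> i\<^esub>, [])) ` verts \<Delta>" by auto
  show ?thesis unfolding E
    by (rule V.add.finprod_reindex) (auto simp: inj_on_def assms(2))
qed

lemma vertex_unit_valid: "i \<in> verts \<Delta> \<Longrightarrow> valid (i, \<one>\<^bsub>\<A> i\<^esub>, [])"
  by (simp add: component_one_closed)

lemma G_one: "\<one>\<^bsub>G\<^esub> = (\<Oplus>\<^bsub>G\<^esub>i\<in>verts \<Delta>. vertex_unit i)"
proof -
  interpret p: ring_hom_ring F G "(+>\<^bsub>F\<^esub>) N"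
    by (rule alg_hom_ring_hom_ring[OF proj_alg_hom F.M.ring_axioms G.M.ring_axioms])
  have "\<one>\<^bsub>F\<^esub> = (\<Oplus>\<^bsub>F\<^esub>i\<in>verts \<Delta>. sw (i, \<one>\<^bsub>\<A> i\<^esub>, []))"
    unfolding word.word_one_sum
    by (rule E_sum) (auto simp: component_one_closed F.M.abelian_monoid_axioms)
  moreover have "N +>\<^bsub>F\<^esub> (\<Oplus>\<^bsub>F\<^esub>i\<in>verts \<Delta>. sw (i, \<one>\<^bsub>\<A> i\<^esub>, [])) =
      (\<Oplus>\<^bsub>G\<^esub>i\<in>verts \<Delta>. vertex_unit i)"
    using p.hom_finsum[of "\<lambda>i. sw (i, \<one>\<^bsub>\<A> i\<^esub>, [])" "verts \<Delta>"] vertex_unit_valid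
    by (simp add: gpath_class_def o_def)
  ultimately show ?thesis using proj(4) by simp
qed

text \<open>Universal property of the generalized path algebra. The map is extended linearly from
  words and then passed to the quotient; linearity in each slot says exactly that the relators are
  sent to zero.\<close>

lemma lift_alg_hom:
  assumes B: "assoc_algebra K B" and h: "\<And>p. valid p \<Longrightarrow> h p \<in> carrier B"
    and mult: "\<And>p q. valid p \<Longrightarrow> valid q \<Longrightarrow>
      h p \<otimes>\<^bsub>B\<^esub> h q = (case mul p q of None \<Rightarrow> \<zero>\<^bsub>B\<^esub> | Some r \<Rightarrow> h r)"
    and one: "(\<Oplus>\<^bsub>B\<^esub>i\<in>verts \<Delta>. h (i, \<one>\<^bsub>\<A> i\<^esub>, [])) = \<one>\<^bsub>B\<^esub>"
    and add: "\<And>s v x y. slot s v \<Longrightarrow> x \<in> carrier (\<A> v) \<Longrightarrow> y \<in> carrier (\<A> v) \<Longrightarrow>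
      h (s (x \<oplus>\<^bsub>\<A> v\<^esub> y)) = h (s x) \<oplus>\<^bsub>B\<^esub> h (s y)"
    and smult: "\<And>s v c x. slot s v \<Longrightarrow> c \<in> carrier K \<Longrightarrow> x \<in> carrier (\<A> v) \<Longrightarrow>
      h (s (c \<odot>\<^bsub>\<A> v\<^esub> x)) = c \<odot>\<^bsub>B\<^esub> h (s x)"
  shows "\<exists>\<psi> \<in> alg_hom K G B. \<forall>p. valid p \<longrightarrow> \<psi> (cls p) = h p"
proof -
  interpret B: assoc_algebra K B by fact
  let ?L = "lin_ext K B h"
  have V: "module K B" by unfold_locales
  have hW: "h p \<in> carrier B" if "p \<in> W" for p using h that by (simp add: D.gpaths_iff)
  have L: "?L \<in> alg_hom K F B"
  proof (rule word.lin_ext_alg_hom[OF B hW])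
    have "(\<Oplus>\<^bsub>B\<^esub>p\<in>E. h p) = (\<Oplus>\<^bsub>B\<^esub>i\<in>verts \<Delta>. h (i, \<one>\<^bsub>\<A> i\<^esub>, []))"
      by (rule E_sum) (auto simp: h component_one_closed B.M.abelian_monoid_axioms)
    then show "(\<Oplus>\<^bsub>B\<^esub>p\<in>E. h p) = \<one>\<^bsub>B\<^esub>" using one by simp
  qed (simp_all add: mult D.gpaths_iff)
  interpret L: ring_hom_ring F B ?L
    by (rule alg_hom_ring_hom_ring[OF L F.M.ring_axioms B.M.ring_axioms])
  have Lsw: "?L (sw p) = h p" if "valid p" for p
    using word.lin_ext_single[OF V _ hW] that by (simp add: D.gpaths_iff)
  have rel: "?L f = \<zero>\<^bsub>B\<^esub>" if "f \<in> relators" for f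
    using that unfolding relators_def
  proof (elim UnE CollectE exE conjE)
    fix s v x y
    assume f: "f = sw (s (x \<oplus>\<^bsub>\<A> v\<^esub> y)) \<ominus>\<^bsub>F\<^esub> (sw (s x) \<oplus>\<^bsub>F\<^esub> sw (s y))"
      and s: "slot s v" and xy: "x \<in> carrier (\<A> v)" "y \<in> carrier (\<A> v)"
    note v = slot_valid[OF s] component_add_closed[OF slot_in_verts[OF s]]
    show "?L f = \<zero>\<^bsub>B\<^esub>"
      unfolding f using xy v add[OF s xy]
      by (simp add: F.M.minus_eq Lsw h B.M.r_neg)
  next
    fix s v c x
    assume f: "f = sw (s (c \<odot>\<^bsub>\<A> v\<^esub> x)) \<ominus>\<^bsub>F\<^esub> c \<odot>\<^bsub>F\<^esub> sw (s x)"
      and s: "slot s v" and cx: "c \<in> carrier K" "x \<in> carrier (\<A> v)"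
    note v = slot_valid[OF s] component_smult_closed[OF slot_in_verts[OF s]]
    show "?L f = \<zero>\<^bsub>B\<^esub>"
      unfolding f using cx v smult[OF s cx]
      by (simp add: F.M.minus_eq Lsw h B.M.r_neg alg_homD(5)[OF L])
  qed
  have "?L f = \<zero>\<^bsub>B\<^esub>" if "f \<in> N" for f
    using that[unfolded N_eq] relators_closed
    by (induction rule: F.lin_span_induct) (simp_all add: rel alg_homD(5)[OF L])
  from F.quotient_lift[OF N_ideal L B this]
  obtain \<psi> where \<psi>: "\<psi> \<in> alg_hom K G B" "\<And>f. f \<in> carrier F \<Longrightarrow> \<psi> (N +>\<^bsub>F\<^esub> f) = ?L f"
    unfolding gpath_algebra_def by blast
  have "\<psi> (cls p) = h p" if "valid p" for p
    using \<psi>(2)[of "sw p"] that Lsw by (simp add: gpath_class_def)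
  with \<psi>(1) show ?thesis by blast
qed

section \<open>Vertex idempotents and the relations contained in an ideal\<close>

lemma vertex_unit_mult_left:
  assumes "i \<in> verts \<Delta>" "valid p"
  shows "vertex_unit i \<otimes>\<^bsub>G\<^esub> cls p = (if fst p = i then cls p else \<zero>\<^bsub>G\<^esub>)"
proof -
  obtain u a ps where p: "p = (u, a, ps)" by (cases p)
  have "a \<in> carrier (\<A> u)" "u \<in> verts \<Delta>" using D.gpath_valid_start[of \<A> u a ps] assms p by auto
  then show ?thesis using assms cls_mult[OF vertex_unit_valid assms(2), of i]
    by (auto simp: p component_units)
qed

lemma vertex_unit_mult_right:
  assumes "j \<in> verts \<Delta>" "valid p"
  shows "cls p \<otimes>\<^bsub>G\<^esub> vertex_unit j = (if D.gpath_end p = j then cls p else \<zero>\<^bsub>G\<^esub>)"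
proof (cases "D.gpath_end p = j")
  case True
  then show ?thesis
    using assms cls_mult[OF assms(2) vertex_unit_valid, of j] gpath_mult_unit_right[OF assms(2)]
    by auto
next
  case False
  then have "mul p (j, \<one>\<^bsub>\<A> j\<^esub>, []) = None" by (simp add: D.gpath_mult_None)
  then show ?thesis using False assms cls_mult[OF assms(2) vertex_unit_valid, of j] by simp
qed

text \<open>Among all paths, only those from \<open>i\<close> to \<open>j\<close> survive between
  the two idempotents, so this product projects onto the span that defines relations from
  \<open>i\<close> to \<open>j\<close>.\<close>

lemma sandwich_in_span:
  assumes x: "x \<in> carrier G" and ij: "i \<in> verts \<Delta>" "j \<in> verts \<Delta>"
  shows "vertex_unit i \<otimes>\<^bsub>G\<^esub> x \<otimes>\<^bsub>G\<^esub> vertex_unit j \<in> lin_span K G (cls ` gpaths_between \<Delta> \<A> i j)"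
proof -
  let ?S = "lin_span K G (cls ` gpaths_between \<Delta> \<A> i j)"
  have between: "p \<in> gpaths_between \<Delta> \<A> i j \<longleftrightarrow> fst p = i \<and> valid p \<and> D.gpath_end p = j" for p
    by (cases p) (simp add: D.gpaths_between_iff)
  have "cls ` gpaths_between \<Delta> \<A> i j \<subseteq> carrier G" by (auto simp: between)
  then have S: "submodule ?S K G" by (rule G.lin_span_submodule)
  note S' = G.submoduleE(4,5)[OF S] G.submodule_zero[OF S]
  note [simp] = component_one_closed
  show ?thesis using x
  proof (induction x rule: gpath_algebra_induct)
    case zero
    then show ?case using ij S' by simp
  next
    case (add c p x)
    have "vertex_unit i \<otimes>\<^bsub>G\<^esub> (c \<odot>\<^bsub>G\<^esub> cls p \<oplus>\<^bsub>G\<^esub> x) \<otimes>\<^bsub>G\<^esub> vertex_unit j =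
        c \<odot>\<^bsub>G\<^esub> (vertex_unit i \<otimes>\<^bsub>G\<^esub> cls p \<otimes>\<^bsub>G\<^esub> vertex_unit j) \<oplus>\<^bsub>G\<^esub>
          vertex_unit i \<otimes>\<^bsub>G\<^esub> x \<otimes>\<^bsub>G\<^esub> vertex_unit j"
      using add ij by (simp add: G.M.l_distr G.M.r_distr G.smult_mult_left G.smult_mult_right)
    moreover have "vertex_unit i \<otimes>\<^bsub>G\<^esub> cls p \<otimes>\<^bsub>G\<^esub> vertex_unit j \<in> ?S"
    proof (cases "p \<in> gpaths_between \<Delta> \<A> i j")
      case True
      then have "cls p \<in> ?S" by (intro subsetD[OF lin_span_incl] imageI)
      then show ?thesis using True ij add
        by (simp add: between vertex_unit_mult_left vertex_unit_mult_right)
    next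
      case False
      then show ?thesis using ij add S'
        by (auto simp: between vertex_unit_mult_left vertex_unit_mult_right)
    qed
    ultimately show ?case using add S' by simp
  qed
qed

lemma ideal_generated_by_relations:
  assumes H: "ideal H G"
  shows "Idl\<^bsub>G\<^esub> (H \<inter> gpath_relations K \<Delta> \<A>) = H"
proof
  interpret H: ideal H G by fact
  let ?I = "Idl\<^bsub>G\<^esub> (H \<inter> gpath_relations K \<Delta> \<A>)"
  show "?I \<subseteq> H" by (rule G.M.genideal_minimal[OF H]) blast
  have I: "ideal ?I G" using H.a_subset by (intro G.M.genideal_ideal) blast
  show "H \<subseteq> ?I"
  proof
    fix x assume x: "x \<in> H"
    then have xc: "x \<in> carrier G" using H.a_subset by blast
    note [simp] = component_one_closed
    have 1: "vertex_unit i \<otimes>\<^bsub>G\<^esub> x \<otimes>\<^bsub>G\<^esub> vertex_unit j \<in> ?I" if "i \<in> verts \<Delta>" "j \<in> verts \<Delta>" for i j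
    proof -
      have "vertex_unit i \<otimes>\<^bsub>G\<^esub> x \<otimes>\<^bsub>G\<^esub> vertex_unit j \<in> gpath_relations K \<Delta> \<A>"
        unfolding gpath_relations_def using sandwich_in_span[OF xc that] that by blast
      moreover have "vertex_unit i \<otimes>\<^bsub>G\<^esub> x \<otimes>\<^bsub>G\<^esub> vertex_unit j \<in> H"
        using x that by (simp add: H.I_l_closed H.I_r_closed)
      ultimately show ?thesis
        using G.M.genideal_self[of "H \<inter> gpath_relations K \<Delta> \<A>"] H.a_subset by blast
    qed
    \<comment> \<open>Summing over the start vertices removes the left idempotent, because the
      idempotents add up to the identity. The sum over the end vertices then returns
      \<open>x\<close>.\<close>
    have 2: "x \<otimes>\<^bsub>G\<^esub> vertex_unit j \<in> ?I" if j: "j \<in> verts \<Delta>" for j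
    proof -
      have "(\<Oplus>\<^bsub>G\<^esub>i\<in>verts \<Delta>. vertex_unit i \<otimes>\<^bsub>G\<^esub> (x \<otimes>\<^bsub>G\<^esub> vertex_unit j)) \<in> ?I"
        using 1[OF _ j] xc j by (intro G.M.ideal_finsum_closed[OF I]) (simp_all add: G.M.m_assoc)
      also have "(\<Oplus>\<^bsub>G\<^esub>i\<in>verts \<Delta>. vertex_unit i \<otimes>\<^bsub>G\<^esub> (x \<otimes>\<^bsub>G\<^esub> vertex_unit j)) =
          \<one>\<^bsub>G\<^esub> \<otimes>\<^bsub>G\<^esub> (x \<otimes>\<^bsub>G\<^esub> vertex_unit j)"
        unfolding G_one using xc j by (intro G.M.finsum_ldistr[symmetric]) auto
      finally show ?thesis using xc j by simp
    qed
    have "(\<Oplus>\<^bsub>G\<^esub>j\<in>verts \<Delta>. x \<otimes>\<^bsub>G\<^esub> vertex_unit j) \<in> ?I"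
      using 2 by (intro G.M.ideal_finsum_closed[OF I]) simp_all
    also have "(\<Oplus>\<^bsub>G\<^esub>j\<in>verts \<Delta>. x \<otimes>\<^bsub>G\<^esub> vertex_unit j) = x \<otimes>\<^bsub>G\<^esub> \<one>\<^bsub>G\<^esub>"
      unfolding G_one using xc by (intro G.M.finsum_rdistr[symmetric]) auto
    finally show "x \<in> ?I" using xc by simp
  qed
qed

section \<open>The arrow ideal and its square\<close>

lemma arrow_ideal: "ideal J G"
  unfolding gpath_arrow_ideal_def by (rule G.M.genideal_ideal) (auto simp: D.gpaths_iff)

lemma arrow_ideal_minimal:
  assumes "ideal H G" "\<And>p. valid p \<Longrightarrow> gpath_length p = 1 \<Longrightarrow> cls p \<in> H"
  shows "J \<subseteq> H"
  unfolding gpath_arrow_ideal_def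
  by (rule G.M.genideal_minimal[OF assms(1)]) (auto simp: D.gpaths_iff assms(2))

text \<open>The path is cut after its first arrow. An identity entry closes the left piece, and
  \<open>b\<close> goes to the right piece; hence length at least one gives membership in
  \<open>J\<close>, and length at least two gives membership in its square.\<close>

lemma cls_Cons:
  assumes "valid (u, a, (\<beta>, b) # ps)"
  shows "cls (u, a, (\<beta>, b) # ps) = cls (u, a, [(\<beta>, \<one>\<^bsub>\<A> (head \<Delta> \<beta>)\<^esub>)]) \<otimes>\<^bsub>G\<^esub> cls (head \<Delta> \<beta>, b, ps)"
proof -
  have b: "head \<Delta> \<beta> \<in> verts \<Delta>" "b \<in> carrier (\<A> (head \<Delta> \<beta>))"
    using assms D.gpath_valid_start[of \<A> "head \<Delta> \<beta>" b ps] by auto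
  then show ?thesis using assms
    by (subst cls_mult) (auto simp: component_one_closed component_units)
qed

text \<open>Detaches the first entry as well, because \<open>\<phi>\<close> is prescribed only on
  paths of length zero and on arrows with identity entries.\<close>

lemma cls_Cons_unit:
  assumes "valid (u, a, [(\<beta>, \<one>\<^bsub>\<A> (head \<Delta> \<beta>)\<^esub>)])"
  shows "cls (u, a, [(\<beta>, \<one>\<^bsub>\<A> (head \<Delta> \<beta>)\<^esub>)]) =
    cls (u, a, []) \<otimes>\<^bsub>G\<^esub> cls (u, \<one>\<^bsub>\<A> u\<^esub>, [(\<beta>, \<one>\<^bsub>\<A> (head \<Delta> \<beta>)\<^esub>)])"
proof -
  have b: "u \<in> verts \<Delta>" "a \<in> carrier (\<A> u)"
    using assms D.gpath_valid_start[of \<A> u a] by auto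
  then show ?thesis using assms
    by (subst cls_mult) (auto simp: component_one_closed component_units)
qed

lemma cls_length_1_in_arrow_ideal: "valid p \<Longrightarrow> gpath_length p = 1 \<Longrightarrow> cls p \<in> J"
  unfolding gpath_arrow_ideal_def
  by (rule subsetD[OF G.M.genideal_self]) (auto simp: D.gpaths_iff)

lemma cls_in_arrow_ideal:
  assumes "valid (u, a, (\<beta>, b) # ps)"
  shows "cls (u, a, (\<beta>, b) # ps) \<in> J"
proof -
  have "cls (u, a, [(\<beta>, \<one>\<^bsub>\<A> (head \<Delta> \<beta>)\<^esub>)]) \<in> J"
    using assms by (intro cls_length_1_in_arrow_ideal) (auto simp: component_one_closed)
  then show ?thesis
    unfolding cls_Cons[OF assms] using assms by (intro ideal.I_r_closed[OF arrow_ideal]) auto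
qed

lemma cls_in_arrow_ideal_square:
  assumes "valid (u, a, (\<beta>, b) # (\<gamma>, c) # ps)"
  shows "cls (u, a, (\<beta>, b) # (\<gamma>, c) # ps) \<in> J \<cdot>\<^bsub>G\<^esub> J"
  unfolding cls_Cons[OF assms] using assms
  by (intro ideal_prod.prod cls_in_arrow_ideal) (auto simp: component_one_closed)

end

section \<open>The radical and the splitting\<close>

lemma (in module) submoduleI':
  assumes "H \<subseteq> carrier M" "\<zero>\<^bsub>M\<^esub> \<in> H"
    and "\<And>a b. a \<in> H \<Longrightarrow> b \<in> H \<Longrightarrow> a \<oplus>\<^bsub>M\<^esub> b \<in> H"
    and smult: "\<And>a x. a \<in> carrier R \<Longrightarrow> x \<in> H \<Longrightarrow> a \<odot>\<^bsub>M\<^esub> x \<in> H"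
  shows "submodule H R M"
proof (rule submoduleI)
  fix a assume a: "a \<in> H"
  then have "\<ominus>\<^bsub>M\<^esub> a = (\<ominus> \<one>) \<odot>\<^bsub>M\<^esub> a" using assms(1) by (simp add: smult_l_minus subset_iff)
  then show "\<ominus>\<^bsub>M\<^esub> a \<in> H" using smult[OF _ a, of "\<ominus> \<one>"] by simp
qed (use assms in auto)

section \<open>Maximal left ideals and two-sidedness of the radical\<close>

context ring
begin

lemma left_idealI:
  assumes "H \<subseteq> carrier R" "\<zero> \<in> H" "\<And>x y. x \<in> H \<Longrightarrow> y \<in> H \<Longrightarrow> x \<oplus> y \<in> H"
    and mult: "\<And>a x. a \<in> carrier R \<Longrightarrow> x \<in> H \<Longrightarrow> a \<otimes> x \<in> H"
  shows "left_ideal H R"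
proof -
  have "\<ominus> x \<in> H" if "x \<in> H" for x
  proof -
    have "\<ominus> x = (\<ominus> \<one>) \<otimes> x" using that assms(1) by (simp add: l_minus subset_iff)
    then show ?thesis using mult[OF _ that, of "\<ominus> \<one>"] by simp
  qed
  then have "subgroup H (add_monoid R)"
    using assms by (intro add.subgroupI) (auto simp: a_inv_def)
  then show ?thesis using mult by (simp add: left_ideal_def additive_subgroupI)
qed

lemma left_idealD:
  assumes "left_ideal H R"
  shows "x \<in> H \<Longrightarrow> x \<in> carrier R" "\<zero> \<in> H" "x \<in> H \<Longrightarrow> y \<in> H \<Longrightarrow> x \<oplus> y \<in> H"
    "a \<in> carrier R \<Longrightarrow> x \<in> H \<Longrightarrow> a \<otimes> x \<in> H"
  using assms additive_subgroup.a_subset[of H R] additive_subgroup.zero_closed[of H R]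
    additive_subgroup.a_closed[of H R x y]
  by (auto simp: left_ideal_def)

text \<open>This set is the annihilator of the class of \<open>x\<close> in the simple left module
  \<open>R/L\<close>. The class is nonzero and so generates the module, which is then
  \<open>R\<close> modulo the annihilator; simplicity makes the annihilator maximal. The proof is
  the same argument written with left ideals.\<close>

lemma maximal_left_ideal_quotient:
  assumes L: "maximal_left_ideal L R" and x: "x \<in> carrier R" "x \<notin> L"
  shows "maximal_left_ideal {y \<in> carrier R. y \<otimes> x \<in> L} R"
proof -
  let ?L' = "{y \<in> carrier R. y \<otimes> x \<in> L}"
  have lL: "left_ideal L R" using L by (simp add: maximal_left_ideal_def)
  note LD = left_idealD[OF lL]
  have "left_ideal ?L' R"
    using x LD by (intro left_idealI) (auto simp: l_distr m_assoc)
  moreover have "?L' \<noteq> carrier R"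
  proof
    assume "?L' = carrier R"
    then have "\<one> \<in> ?L'" by simp
    then show False using x by simp
  qed
  moreover have "H = ?L' \<or> H = carrier R" if H: "left_ideal H R" "?L' \<subseteq> H" for H
  proof (rule disjCI)
    assume "H \<noteq> carrier R"
    note HD = left_idealD[OF H(1)]
    have "H \<subseteq> ?L'"
    proof (rule ccontr)
      assume "\<not> H \<subseteq> ?L'"
      then obtain y where y: "y \<in> H" "y \<otimes> x \<notin> L" using HD by auto
      \<comment> \<open>The left ideal \<open>L + H x\<close> contains \<open>L\<close> and also the
        element \<open>y \<otimes> x\<close> outside \<open>L\<close>, so maximality makes it the
        whole ring; in particular it contains \<open>x\<close>.\<close>
      let ?M = "{l \<oplus> z \<otimes> x | l z. l \<in> L \<and> z \<in> H}"
      have M: "left_ideal ?M R"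
      proof (rule left_idealI)
        show "?M \<subseteq> carrier R" using x LD HD by auto
        show "\<zero> \<in> ?M" using x LD(2) HD(2) by (auto intro!: exI[of _ \<zero>])
      next
        fix u v assume "u \<in> ?M" "v \<in> ?M"
        then obtain l z l' z' where *: "l \<in> L" "z \<in> H" "l' \<in> L" "z' \<in> H"
          "u = l \<oplus> z \<otimes> x" "v = l' \<oplus> z' \<otimes> x" by blast
        then have "u \<oplus> v = (l \<oplus> l') \<oplus> (z \<oplus> z') \<otimes> x"
          using x LD(1) HD(1) by (simp add: l_distr a_ac)
        then show "u \<oplus> v \<in> ?M" using * LD(3) HD(3) by blast
      next
        fix a u assume a: "a \<in> carrier R" "u \<in> ?M"
        then obtain l z where *: "l \<in> L" "z \<in> H" "u = l \<oplus> z \<otimes> x" by blast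
        then have "a \<otimes> u = a \<otimes> l \<oplus> (a \<otimes> z) \<otimes> x"
          using a x LD(1) HD(1) by (simp add: r_distr m_assoc)
        then show "a \<otimes> u \<in> ?M" using * a LD(4) HD(4) by blast
      qed
      have "L \<subseteq> ?M"
      proof
        fix l assume "l \<in> L"
        then have "l = l \<oplus> \<zero> \<otimes> x" using x LD(1) by simp
        then show "l \<in> ?M" using \<open>l \<in> L\<close> HD(2) by blast
      qed
      moreover have "y \<otimes> x \<in> ?M"
      proof -
        have "y \<otimes> x = \<zero> \<oplus> y \<otimes> x" using x y HD(1) by simp
        then show ?thesis using y LD(2) by blast
      qed
      ultimately have "?M = carrier R" using L M y(2) by (metis (no_types, lifting) maximal_left_ideal_def)
      then have "x \<in> ?M" using x by simp
      then obtain l z where lz: "l \<in> L" "z \<in> H" "x = l \<oplus> z \<otimes> x" by blast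
      then have c: "l \<in> carrier R" "z \<in> carrier R" using LD HD by auto
      have "(\<one> \<ominus> z) \<otimes> x = x \<ominus> z \<otimes> x" using x c by (simp add: minus_eq l_distr l_minus)
      also have "\<dots> = l"
      proof -
        have "x \<ominus> z \<otimes> x = (l \<oplus> z \<otimes> x) \<ominus> z \<otimes> x" using lz(3) by simp
        then show ?thesis using x c by (simp add: minus_eq a_assoc r_neg)
      qed
      \<comment> \<open>Both \<open>\<one> \<ominus> z\<close> and \<open>z\<close> now lie in
        \<open>H\<close>, so their sum, the identity, does too.\<close>
      finally have "\<one> \<ominus> z \<in> ?L'" using lz c by simp
      then have "(\<one> \<ominus> z) \<oplus> z \<in> H" using H(2) lz(2) HD(3) by blast
      then have "\<one> \<in> H" using c by (simp add: minus_eq a_assoc l_neg)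
      then have "H = carrier R" using HD(1) HD(4)[of _ \<one>] by fastforce
      then show False using \<open>H \<noteq> carrier R\<close> by simp
    qed
    then show "H = ?L'" using H(2) by blast
  qed
  ultimately show ?thesis unfolding maximal_left_ideal_def by blast
qed

text \<open>As an intersection of left ideals the radical is a left ideal. For right multiplication
  by an \<open>x\<close> outside a maximal left ideal \<open>L\<close>, an element \<open>a\<close>
  of the radical lies in the maximal left ideal \<open>{y. y \<otimes> x \<in> L}\<close>, which
  means \<open>a \<otimes> x \<in> L\<close>.\<close>

lemma radical_ideal: "ideal (radical R) R"
proof -
  have D: "left_ideal L R" if "maximal_left_ideal L R" for L
    using that by (simp add: maximal_left_ideal_def)
  have "left_ideal (radical R) R"
    using left_idealD(2,3,4)[OF D] by (intro left_idealI) (auto simp: radical_def)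
  then have "additive_subgroup (radical R) R"
    and l: "\<And>a x. a \<in> radical R \<Longrightarrow> x \<in> carrier R \<Longrightarrow> x \<otimes> a \<in> radical R"
    by (auto simp: left_ideal_def)
  moreover have "a \<otimes> x \<in> radical R" if a: "a \<in> radical R" and x: "x \<in> carrier R" for a x
  proof -
    have "a \<otimes> x \<in> L" if L: "maximal_left_ideal L R" for L
    proof (cases "x \<in> L")
      case True
      then show ?thesis using left_idealD(4)[OF D[OF L]] a by (simp add: radical_def)
    next
      case False
      then show ?thesis using maximal_left_ideal_quotient[OF L x] a by (auto simp: radical_def)
    qed
    then show ?thesis using a x by (simp add: radical_def)
  qed
  ultimately show ?thesis
    by (intro idealI ring_axioms) (auto simp: additive_subgroup_def)
qed

end

text \<open>As \<open>B\<close> is a complement of \<open>I\<close>, each coset of \<open>I\<close>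
  meets \<open>B\<close> in exactly one element. Picking it defines \<open>\<epsilon>\<close>, which
  is a homomorphism because \<open>B\<close> is closed under the operations and each coset
  determines its element of \<open>B\<close>.\<close>

lemma (in assoc_algebra) splitting_alg_hom:
  assumes I: "ideal I M" and B: "subring B M" "submodule B R M"
    and sum: "B <+>\<^bsub>M\<^esub> I = carrier M" and inter: "B \<inter> I = {\<zero>\<^bsub>M\<^esub>}"
  shows "\<exists>\<epsilon> \<in> alg_hom R (quotient_algebra M I) M. \<forall>X\<in>carrier (quotient_algebra M I). \<epsilon> X \<in> X"
proof -
  let ?Q = "quotient_algebra M I"
  interpret I: ideal I M by fact
  interpret B: subring B M by fact
  note N = ideal_submodule[OF I]
  note BD = submoduleE[OF B(2)]
  have unique: "b = b'" if X: "X \<in> carrier ?Q" and b: "b \<in> B" "b \<in> X" "b' \<in> B" "b' \<in> X" for X b b'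
  proof -
    obtain x where "x \<in> carrier M" "X = I +>\<^bsub>M\<^esub> x" using X by (auto simp: quotient_algebra_carrier)
    then have "b \<in> carrier M" "b' \<in> carrier M" "I +>\<^bsub>M\<^esub> b = I +>\<^bsub>M\<^esub> b'"
      using b coset_mem_iff[OF N] by auto
    then have "b \<ominus>\<^bsub>M\<^esub> b' \<in> I" using coset_eq_iff[OF N] by simp
    moreover have "b \<ominus>\<^bsub>M\<^esub> b' \<in> B" using b BD(3,5) by (simp add: M.minus_eq)
    ultimately have "b \<ominus>\<^bsub>M\<^esub> b' = \<zero>\<^bsub>M\<^esub>" using inter by blast
    then show ?thesis using \<open>b \<in> carrier M\<close> \<open>b' \<in> carrier M\<close> by simp
  qed
  have ex: "\<exists>b. b \<in> B \<and> b \<in> X" if X: "X \<in> carrier ?Q" for X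
  proof -
    obtain x where x: "x \<in> carrier M" "X = I +>\<^bsub>M\<^esub> x" using X by (auto simp: quotient_algebra_carrier)
    then obtain b n where b: "b \<in> B" "n \<in> I" "x = b \<oplus>\<^bsub>M\<^esub> n"
      using sum unfolding set_add_def set_mult_def by auto blast
    then have c: "b \<in> carrier M" "n \<in> carrier M" using BD(1) I.a_subset by auto
    then have "x \<ominus>\<^bsub>M\<^esub> b = n" using b(3) M.a_comm[of b n] by (simp add: M.minus_eq M.a_assoc M.r_neg)
    then have "b \<in> X" using b x c coset_eq_iff[OF N x(1) c(1)] coset_mem_iff[OF N x(1)] by simp
    then show ?thesis using b by blast
  qed
  define \<epsilon> where "\<epsilon> X = (SOME b. b \<in> B \<and> b \<in> X)" for X
  have \<epsilon>: "\<epsilon> X \<in> B" "\<epsilon> X \<in> X" if "X \<in> carrier ?Q" for X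
    using someI_ex[OF ex[OF that]] unfolding \<epsilon>_def by auto
  have \<epsilon>_eqI: "\<epsilon> X = b" if "X \<in> carrier ?Q" "b \<in> B" "b \<in> X" for X b
    using unique that \<epsilon> by blast
  have \<epsilon>c: "\<epsilon> X \<in> carrier M" if "X \<in> carrier ?Q" for X using \<epsilon>(1)[OF that] BD(1) by blast
  have rep: "I +>\<^bsub>M\<^esub> \<epsilon> X = X" if X: "X \<in> carrier ?Q" for X
  proof -
    obtain x where x: "x \<in> carrier M" "X = I +>\<^bsub>M\<^esub> x" using X by (auto simp: quotient_algebra_carrier)
    then show ?thesis using coset_mem_iff[OF N x(1)] \<epsilon>(2)[OF X] by simp
  qed
  have mem: "b \<in> X" if "b \<in> carrier M" "X = I +>\<^bsub>M\<^esub> b" for b X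
    using that coset_mem_iff[OF N that(1)] by simp
  interpret Q: assoc_algebra R ?Q by (rule quotient_assoc_algebra[OF I])
  have "\<epsilon> \<in> alg_hom R ?Q M"
    unfolding alg_hom_def
  proof (intro CollectI conjI ballI ring_hom_memI)
    fix X Y assume XY: "X \<in> carrier ?Q" "Y \<in> carrier ?Q"
    have cosets: "X \<otimes>\<^bsub>?Q\<^esub> Y = I +>\<^bsub>M\<^esub> (\<epsilon> X \<otimes>\<^bsub>M\<^esub> \<epsilon> Y)" "X \<oplus>\<^bsub>?Q\<^esub> Y = I +>\<^bsub>M\<^esub> (\<epsilon> X \<oplus>\<^bsub>M\<^esub> \<epsilon> Y)"
      using quotient_algebra_coset_mult[OF I \<epsilon>c[OF XY(1)] \<epsilon>c[OF XY(2)]]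
        quotient_algebra_add[OF N \<epsilon>c[OF XY(1)] \<epsilon>c[OF XY(2)]]
      unfolding rep[OF XY(1)] rep[OF XY(2)] by auto
    have "\<epsilon> X \<otimes>\<^bsub>M\<^esub> \<epsilon> Y \<in> X \<otimes>\<^bsub>?Q\<^esub> Y" "\<epsilon> X \<oplus>\<^bsub>M\<^esub> \<epsilon> Y \<in> X \<oplus>\<^bsub>?Q\<^esub> Y"
      using \<epsilon>c[OF XY(1)] \<epsilon>c[OF XY(2)] by (auto intro: mem[OF _ cosets(1)] mem[OF _ cosets(2)])
    then show "\<epsilon> (X \<otimes>\<^bsub>?Q\<^esub> Y) = \<epsilon> X \<otimes>\<^bsub>M\<^esub> \<epsilon> Y" "\<epsilon> (X \<oplus>\<^bsub>?Q\<^esub> Y) = \<epsilon> X \<oplus>\<^bsub>M\<^esub> \<epsilon> Y"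
      using XY \<epsilon>(1) BD(5) B.m_closed
      by (auto intro!: \<epsilon>_eqI Q.M.m_closed Q.M.a_closed)
  next
    fix c X assume cX: "c \<in> carrier R" "X \<in> carrier ?Q"
    show "\<epsilon> (c \<odot>\<^bsub>?Q\<^esub> X) = c \<odot>\<^bsub>M\<^esub> \<epsilon> X"
      by (rule \<epsilon>_eqI[OF Q.smult_closed[OF cX] _ mem]) (use cX quotient_algebra_smult[OF N, of c "\<epsilon> X"] in \<open>auto simp: rep \<epsilon> \<epsilon>c BD(4)\<close>)
  next
    show "\<epsilon> \<one>\<^bsub>?Q\<^esub> = \<one>\<^bsub>M\<^esub>"
      by (rule \<epsilon>_eqI[OF Q.M.one_closed _ mem]) (auto simp: quotient_algebra_one B.one_closed)
  qed (use \<epsilon>c in blast)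
  then show ?thesis using \<epsilon>(2) by blast
qed

section \<open>Direct sums of simple algebras and their orthogonal idempotents\<close>

locale decomposed_algebra = S: assoc_algebra K S
  for K :: "('k, 'x) ring_scheme" (structure) and S :: "('k, 's, 'z) module_scheme" +
  fixes m :: nat and C :: "nat \<Rightarrow> 's set" and e :: "nat \<Rightarrow> 's"
  assumes decomposition: "simple_decomposition K S m C e"
begin

lemma C_ideal: "i \<in> {1..m} \<Longrightarrow> ideal (C i) S"
  using decomposition by (simp add: simple_decomposition_def)

lemma C_subset: "i \<in> {1..m} \<Longrightarrow> x \<in> C i \<Longrightarrow> x \<in> carrier S"
  using C_ideal additive_subgroup.a_subset[OF ideal.axioms(1)] by blast

lemma C_assoc_algebra: "i \<in> {1..m} \<Longrightarrow> assoc_algebra K (component_algebra S C e i)"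
  using decomposition by (simp add: simple_decomposition_def simple_algebra_def)

lemma e_unit:
  assumes "i \<in> {1..m}"
  shows "e i \<in> C i" "x \<in> C i \<Longrightarrow> e i \<otimes>\<^bsub>S\<^esub> x = x" "x \<in> C i \<Longrightarrow> x \<otimes>\<^bsub>S\<^esub> e i = x"
proof -
  interpret Ci: assoc_algebra K "component_algebra S C e i" by (rule C_assoc_algebra[OF assms])
  show "e i \<in> C i" "x \<in> C i \<Longrightarrow> e i \<otimes>\<^bsub>S\<^esub> x = x" "x \<in> C i \<Longrightarrow> x \<otimes>\<^bsub>S\<^esub> e i = x"
    using Ci.M.one_closed Ci.M.l_one[of x] Ci.M.r_one[of x]
    by (auto simp: component_algebra_def)
qed

lemma C_zero: "i \<in> {1..m} \<Longrightarrow> \<zero>\<^bsub>S\<^esub> \<in> C i"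
  using C_ideal additive_subgroup.zero_closed[OF ideal.axioms(1)] by blast

lemma finsum_single:
  assumes "i \<in> {1..m}" "z \<in> carrier S"
  shows "(\<Oplus>\<^bsub>S\<^esub>k\<in>{1..m}. if k = i then z else \<zero>\<^bsub>S\<^esub>) = z"
  using S.M.add.finprod_singleton_swap[of i "{1..m}" "\<lambda>_. z"] assms by simp

text \<open>An element of two summands has two decompositions, one concentrated at \<open>i\<close>
  and one at \<open>j\<close>. Uniqueness identifies them, and comparing the components at
  \<open>i\<close> gives zero.\<close>

lemma C_disjoint:
  assumes ij: "i \<in> {1..m}" "j \<in> {1..m}" "i \<noteq> j" and z: "z \<in> C i" "z \<in> C j"
  shows "z = \<zero>\<^bsub>S\<^esub>"
proof -
  define f where "f a = (\<lambda>k\<in>{1..m}. if k = a then z else \<zero>\<^bsub>S\<^esub>)" for a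
  have zc: "z \<in> carrier S" using C_subset ij z by blast
  have "f a \<in> (\<Pi>\<^sub>E k\<in>{1..m}. C k) \<and> z = (\<Oplus>\<^bsub>S\<^esub>k\<in>{1..m}. f a k)" if "a \<in> {i, j}" for a
  proof
    show "f a \<in> (\<Pi>\<^sub>E k\<in>{1..m}. C k)" using that z C_zero by (auto simp: f_def)
    have "(\<Oplus>\<^bsub>S\<^esub>k\<in>{1..m}. f a k) = (\<Oplus>\<^bsub>S\<^esub>k\<in>{1..m}. if k = a then z else \<zero>\<^bsub>S\<^esub>)"
      using zc by (intro S.M.finsum_cong') (auto simp: f_def)
    then show "z = (\<Oplus>\<^bsub>S\<^esub>k\<in>{1..m}. f a k)" using finsum_single[OF _ zc, of a] that ij by auto
  qed
  note sum = this
  have unique: "\<exists>!f. f \<in> (\<Pi>\<^sub>E k\<in>{1..m}. C k) \<and> z = (\<Oplus>\<^bsub>S\<^esub>k\<in>{1..m}. f k)"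
    using decomposition zc by (simp add: simple_decomposition_def)
  have "f i = f j"
    using the1_equality[OF unique, of "f i"] the1_equality[OF unique, of "f j"] sum[of i] sum[of j]
    by simp
  then have "f i i = f j i" by simp
  then show ?thesis using ij by (simp add: f_def)
qed

text \<open>The product lies in both two-sided ideals, hence in their zero intersection.\<close>

lemma C_orthogonal:
  assumes "i \<in> {1..m}" "j \<in> {1..m}" "i \<noteq> j" "x \<in> C i" "y \<in> C j"
  shows "x \<otimes>\<^bsub>S\<^esub> y = \<zero>\<^bsub>S\<^esub>"
  using assms C_ideal ideal.I_r_closed[of "C i" S x y] ideal.I_l_closed[of "C j" S y x] C_subset
  by (intro C_disjoint[OF assms(1-3)]) auto

text \<open>Multiplying the decomposition of the identity by \<open>e i\<close> leaves only the
  component at \<open>i\<close>, on which \<open>e i\<close> acts as identity; this component is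
  therefore \<open>e i\<close>.\<close>

lemma one_eq_sum_e: "\<one>\<^bsub>S\<^esub> = (\<Oplus>\<^bsub>S\<^esub>i\<in>{1..m}. e i)"
proof -
  obtain f where f: "f \<in> (\<Pi>\<^sub>E i\<in>{1..m}. C i)" "\<one>\<^bsub>S\<^esub> = (\<Oplus>\<^bsub>S\<^esub>i\<in>{1..m}. f i)"
    using decomposition S.M.one_closed unfolding simple_decomposition_def by blast
  then have fC: "f i \<in> C i" "f i \<in> carrier S" if "i \<in> {1..m}" for i
    using that C_subset by (auto simp: PiE_iff)
  have "f i = e i" if i: "i \<in> {1..m}" for i
  proof -
    have ec: "e i \<in> carrier S" using e_unit(1)[OF i] C_subset i by blast
    have "e i = e i \<otimes>\<^bsub>S\<^esub> (\<Oplus>\<^bsub>S\<^esub>j\<in>{1..m}. f j)" unfolding f(2)[symmetric] using ec by simp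
    also have "\<dots> = (\<Oplus>\<^bsub>S\<^esub>j\<in>{1..m}. e i \<otimes>\<^bsub>S\<^esub> f j)"
      using ec fC by (intro S.M.finsum_rdistr) auto
    also have "\<dots> = (\<Oplus>\<^bsub>S\<^esub>j\<in>{1..m}. if j = i then f i else \<zero>\<^bsub>S\<^esub>)"
      using fC i C_orthogonal[OF i _ _ e_unit(1)[OF i]]
      by (intro S.M.finsum_cong') (auto simp: e_unit(2)[OF i])
    also have "\<dots> = f i" by (rule finsum_single[OF i fC(2)[OF i]])
    finally show ?thesis by simp
  qed
  then have "(\<Oplus>\<^bsub>S\<^esub>i\<in>{1..m}. f i) = (\<Oplus>\<^bsub>S\<^esub>i\<in>{1..m}. e i)"
    using fC by (intro S.M.finsum_cong') auto
  with f(2) show ?thesis by simp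
qed

end

section \<open>The radical as a bimodule\<close>

text \<open>The assumption \<open>section_mem\<close> expresses that \<open>\<epsilon>\<close> is a
  section: composed with the canonical map to the quotient it is the identity.\<close>

locale radical_split = A: assoc_algebra K A
  for K :: "('k, 'x) ring_scheme" (structure) and A :: "('k, 'a, 'y) module_scheme" +
  fixes \<epsilon> :: "'a set \<Rightarrow> 'a" and m :: nat and C :: "nat \<Rightarrow> 'a set set" and e :: "nat \<Rightarrow> 'a set"
  assumes rad_square: "x \<in> radical A \<Longrightarrow> y \<in> radical A \<Longrightarrow> x \<otimes>\<^bsub>A\<^esub> y = \<zero>\<^bsub>A\<^esub>"
    and section_hom: "\<epsilon> \<in> alg_hom K (quotient_algebra A (radical A)) A"
    and section_mem: "X \<in> carrier (quotient_algebra A (radical A)) \<Longrightarrow> \<epsilon> X \<in> X"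
    and decomposition: "simple_decomposition K (quotient_algebra A (radical A)) m C e"
begin

abbreviation "rad \<equiv> radical A"
abbreviation "Q \<equiv> quotient_algebra A rad"
abbreviation "part i j \<equiv> carrier (radical_part K A C i j)"

sublocale rad: ideal rad A by (rule A.M.radical_ideal)

lemma rad_submodule: "submodule rad K A" by (rule A.ideal_submodule[OF rad.is_ideal])

lemma Q_assoc_algebra: "assoc_algebra K Q"
  by (rule A.quotient_assoc_algebra[OF rad.is_ideal])

sublocale Q: decomposed_algebra K Q m C e
  by (intro decomposed_algebra.intro Q_assoc_algebra decomposed_algebra_axioms.intro decomposition)

sublocale \<epsilon>: ring_hom_ring Q A \<epsilon>
  by (rule alg_hom_ring_hom_ring[OF section_hom Q.S.M.ring_axioms A.M.ring_axioms])

lemma section_smult: "c \<in> carrier K \<Longrightarrow> X \<in> carrier Q \<Longrightarrow> \<epsilon> (c \<odot>\<^bsub>Q\<^esub> X) = c \<odot>\<^bsub>A\<^esub> \<epsilon> X"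
  by (rule alg_homD(5)[OF section_hom])

lemma coset_section: "X \<in> carrier Q \<Longrightarrow> rad +>\<^bsub>A\<^esub> \<epsilon> X = X"
  using section_mem[of X] A.coset_mem_iff[OF rad_submodule] by (auto simp: quotient_algebra_carrier)

text \<open>The coset of \<open>\<epsilon> X\<close> is \<open>X\<close>, and an element of the
  radical has the zero coset. This is what later removes the part of degree zero from kernel
  elements.\<close>

lemma section_inj_mod: "X \<in> carrier Q \<Longrightarrow> \<epsilon> X \<in> rad \<Longrightarrow> X = \<zero>\<^bsub>Q\<^esub>"
  using coset_section[of X] rad.a_rcos_const[of "\<epsilon> X"] by (simp add: quotient_algebra_zero)

lemma coset_diff:
  assumes X: "X \<in> carrier Q" and x: "x \<in> X"
  shows "x \<in> carrier A" "x \<ominus>\<^bsub>A\<^esub> \<epsilon> X \<in> rad"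
proof -
  have "x \<in> rad +>\<^bsub>A\<^esub> \<epsilon> X" using x coset_section[OF X] by simp
  then show "x \<in> carrier A" "x \<ominus>\<^bsub>A\<^esub> \<epsilon> X \<in> rad"
    using A.coset_mem_iff[OF rad_submodule] A.coset_eq_iff[OF rad_submodule] X by auto
qed

text \<open>Any representative of \<open>X\<close> differs from \<open>\<epsilon> X\<close> by an
  element of the radical, and this annihilates \<open>y\<close> because the radical has square zero.
  So \<open>the_elem\<close> is applied to a singleton, and the action is plain multiplication in
  \<open>A\<close>.\<close>

lemma coset_lact_eq:
  assumes X: "X \<in> carrier Q" and y: "y \<in> rad"
  shows "coset_lact A X y = \<epsilon> X \<otimes>\<^bsub>A\<^esub> y"
proof -
  have "x \<otimes>\<^bsub>A\<^esub> y = \<epsilon> X \<otimes>\<^bsub>A\<^esub> y" if "x \<in> X" for x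
  proof -
    note d = coset_diff[OF X that]
    have "x \<otimes>\<^bsub>A\<^esub> y \<ominus>\<^bsub>A\<^esub> \<epsilon> X \<otimes>\<^bsub>A\<^esub> y = (x \<ominus>\<^bsub>A\<^esub> \<epsilon> X) \<otimes>\<^bsub>A\<^esub> y"
      using d(1) X y by (simp add: A.M.minus_eq A.M.l_distr A.M.l_minus)
    also have "\<dots> = \<zero>\<^bsub>A\<^esub>" by (rule rad_square[OF d(2) y])
    finally show ?thesis using d(1) X y by simp
  qed
  then have "(\<lambda>x. x \<otimes>\<^bsub>A\<^esub> y) ` X = (\<lambda>_. \<epsilon> X \<otimes>\<^bsub>A\<^esub> y) ` X" by (rule image_cong[OF refl])
  also have "\<dots> = {\<epsilon> X \<otimes>\<^bsub>A\<^esub> y}" by (rule image_constant[OF section_mem[OF X]])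
  finally have "(\<lambda>x. x \<otimes>\<^bsub>A\<^esub> y) ` X = {\<epsilon> X \<otimes>\<^bsub>A\<^esub> y}" .
  then show ?thesis by (simp add: coset_lact_def)
qed

lemma coset_ract_eq:
  assumes X: "X \<in> carrier Q" and y: "y \<in> rad"
  shows "coset_ract A y X = y \<otimes>\<^bsub>A\<^esub> \<epsilon> X"
proof -
  have "y \<otimes>\<^bsub>A\<^esub> x = y \<otimes>\<^bsub>A\<^esub> \<epsilon> X" if "x \<in> X" for x
  proof -
    note d = coset_diff[OF X that]
    have "y \<otimes>\<^bsub>A\<^esub> x \<ominus>\<^bsub>A\<^esub> y \<otimes>\<^bsub>A\<^esub> \<epsilon> X = y \<otimes>\<^bsub>A\<^esub> (x \<ominus>\<^bsub>A\<^esub> \<epsilon> X)"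
      using d(1) X y by (simp add: A.M.minus_eq A.M.r_distr A.M.r_minus)
    also have "\<dots> = \<zero>\<^bsub>A\<^esub>" by (rule rad_square[OF y d(2)])
    finally show ?thesis using d(1) X y by simp
  qed
  then have "(\<lambda>x. y \<otimes>\<^bsub>A\<^esub> x) ` X = (\<lambda>_. y \<otimes>\<^bsub>A\<^esub> \<epsilon> X) ` X" by (rule image_cong[OF refl])
  also have "\<dots> = {y \<otimes>\<^bsub>A\<^esub> \<epsilon> X}" by (rule image_constant[OF section_mem[OF X]])
  finally have "(\<lambda>x. y \<otimes>\<^bsub>A\<^esub> x) ` X = {y \<otimes>\<^bsub>A\<^esub> \<epsilon> X}" .
  then show ?thesis by (simp add: coset_ract_def)
qed

lemma section_rad [simp]:
  "X \<in> carrier Q \<Longrightarrow> y \<in> rad \<Longrightarrow> \<epsilon> X \<otimes>\<^bsub>A\<^esub> y \<in> rad"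
  "X \<in> carrier Q \<Longrightarrow> y \<in> rad \<Longrightarrow> y \<otimes>\<^bsub>A\<^esub> \<epsilon> X \<in> rad"
  by (auto intro: rad.I_l_closed rad.I_r_closed)

lemma part_generators_subset:
  assumes "i \<in> {1..m}" "j \<in> {1..m}"
  shows "{coset_ract A (coset_lact A X y) Y | X y Y. X \<in> C i \<and> y \<in> rad \<and> Y \<in> C j} =
    {\<epsilon> X \<otimes>\<^bsub>A\<^esub> y \<otimes>\<^bsub>A\<^esub> \<epsilon> Y | X y Y. X \<in> C i \<and> y \<in> rad \<and> Y \<in> C j}"
proof -
  have "coset_ract A (coset_lact A X y) Y = \<epsilon> X \<otimes>\<^bsub>A\<^esub> y \<otimes>\<^bsub>A\<^esub> \<epsilon> Y"
    if "X \<in> C i" "y \<in> rad" "Y \<in> C j" for X y Y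
    using that Q.C_subset[OF assms(1)] Q.C_subset[OF assms(2)]
    by (simp add: coset_lact_eq coset_ract_eq)
  then show ?thesis by (intro Collect_cong ex_cong1) auto
qed

lemma part_eq:
  assumes "i \<in> {1..m}" "j \<in> {1..m}"
  shows "part i j =
    lin_span K A {\<epsilon> X \<otimes>\<^bsub>A\<^esub> y \<otimes>\<^bsub>A\<^esub> \<epsilon> Y | X y Y. X \<in> C i \<and> y \<in> rad \<and> Y \<in> C j}"
  unfolding radical_part_def part_generators_subset[OF assms] by simp

text \<open>All three properties are linear in \<open>y\<close> and hold on the spanning elements,
  since \<open>e i\<close> and \<open>e j\<close> are the identities of \<open>C i\<close> and
  \<open>C j\<close>.\<close>

lemma part_props:
  assumes ij: "i \<in> {1..m}" "j \<in> {1..m}" and y: "y \<in> part i j"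
  shows "y \<in> rad" "\<epsilon> (e i) \<otimes>\<^bsub>A\<^esub> y = y" "y \<otimes>\<^bsub>A\<^esub> \<epsilon> (e j) = y"
proof -
  note c = Q.C_subset[OF ij(1)] Q.C_subset[OF ij(2)] Q.e_unit[OF ij(1)] Q.e_unit[OF ij(2)]
  have sub: "{\<epsilon> X \<otimes>\<^bsub>A\<^esub> y \<otimes>\<^bsub>A\<^esub> \<epsilon> Y | X y Y. X \<in> C i \<and> y \<in> rad \<and> Y \<in> C j} \<subseteq> carrier A"
    using c by auto
  have ei: "\<epsilon> (e i) \<in> carrier A" "\<epsilon> (e j) \<in> carrier A" using c by auto
  have "y \<in> rad \<and> \<epsilon> (e i) \<otimes>\<^bsub>A\<^esub> y = y \<and> y \<otimes>\<^bsub>A\<^esub> \<epsilon> (e j) = y"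
    using y[unfolded part_eq[OF ij]] sub
  proof (induction rule: A.lin_span_induct)
    case (base z)
    then obtain X y Y where z: "z = \<epsilon> X \<otimes>\<^bsub>A\<^esub> y \<otimes>\<^bsub>A\<^esub> \<epsilon> Y" "X \<in> C i" "y \<in> rad" "Y \<in> C j" by blast
    have "\<epsilon> (e i) \<otimes>\<^bsub>A\<^esub> \<epsilon> X = \<epsilon> X" "\<epsilon> Y \<otimes>\<^bsub>A\<^esub> \<epsilon> (e j) = \<epsilon> Y"
      using c z by (simp_all flip: \<epsilon>.hom_mult)
    moreover have "\<epsilon> X \<in> carrier A" "\<epsilon> Y \<in> carrier A" "y \<in> carrier A" "X \<in> carrier Q" "Y \<in> carrier Q"
      using c z by auto
    ultimately show ?case using ei z
      by (simp add: A.M.m_assoc) (simp flip: A.M.m_assoc)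
  next
    case (add x y)
    then show ?case using ei by (simp add: A.M.l_distr A.M.r_distr)
  next
    case (smult c x)
    then show ?case using ei A.submoduleE(4)[OF rad_submodule]
      by (simp add: A.smult_mult_left A.smult_mult_right)
  qed (use ei in simp)
  then show "y \<in> rad" "\<epsilon> (e i) \<otimes>\<^bsub>A\<^esub> y = y" "y \<otimes>\<^bsub>A\<^esub> \<epsilon> (e j) = y" by auto
qed

lemma part_submodule:
  assumes ij: "i \<in> {1..m}" "j \<in> {1..m}"
  shows "submodule (part i j) K A"
  unfolding part_eq[OF ij] using Q.C_subset[OF ij(1)] Q.C_subset[OF ij(2)]
  by (intro A.lin_span_submodule) auto

lemma sandwich_in_part:
  assumes ij: "i \<in> {1..m}" "j \<in> {1..m}" and y: "y \<in> rad" and XY: "X \<in> C i" "Y \<in> C j"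
  shows "\<epsilon> X \<otimes>\<^bsub>A\<^esub> y \<otimes>\<^bsub>A\<^esub> \<epsilon> Y \<in> part i j"
  unfolding part_eq[OF ij] by (rule subsetD[OF lin_span_incl]) (use y XY in blast)

text \<open>Inserting the identity on the other side, as in
  \<open>y = y \<otimes> \<epsilon> (e j)\<close>, brings the product into the two-sided form that
  spans the part.\<close>

lemma part_lact_closed:
  assumes ij: "i \<in> {1..m}" "j \<in> {1..m}" and y: "y \<in> part i j"
  shows "X \<in> C i \<Longrightarrow> \<epsilon> X \<otimes>\<^bsub>A\<^esub> y \<in> part i j" "X \<in> C j \<Longrightarrow> y \<otimes>\<^bsub>A\<^esub> \<epsilon> X \<in> part i j"
proof -
  note p = part_props[OF ij y]
  have yc: "y \<in> carrier A" using p(1) rad.a_subset by blast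
  show "\<epsilon> X \<otimes>\<^bsub>A\<^esub> y \<in> part i j" if X: "X \<in> C i"
    using sandwich_in_part[OF ij p(1) X Q.e_unit(1)[OF ij(2)]] p(3) yc
      Q.C_subset[OF ij(1) X] Q.C_subset[OF ij(2) Q.e_unit(1)[OF ij(2)]]
    by (simp add: A.M.m_assoc)
  show "y \<otimes>\<^bsub>A\<^esub> \<epsilon> X \<in> part i j" if X: "X \<in> C j"
    using sandwich_in_part[OF ij p(1) Q.e_unit(1)[OF ij(1)] X] p(2) by simp
qed

text \<open>The radical is the sum of the \<open>\<^sub>iM\<^sub>j\<close>, as the idempotents \<open>\<epsilon> (e i)\<close> sum to the identity.\<close>

lemma rad_subset_of_generators:
  assumes H: "submodule H K A"
    and gen: "\<And>i j. i \<in> {1..m} \<Longrightarrow> j \<in> {1..m} \<Longrightarrow>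
      bimodule_generators (coset_lact A) (coset_ract A) (C i) (C j) (radical_part K A C i j) (X i j)"
    and X: "\<And>i j. i \<in> {1..m} \<Longrightarrow> j \<in> {1..m} \<Longrightarrow> X i j \<subseteq> H"
    and l: "\<And>Y y. Y \<in> carrier Q \<Longrightarrow> y \<in> H \<Longrightarrow> \<epsilon> Y \<otimes>\<^bsub>A\<^esub> y \<in> H"
    and r: "\<And>Y y. Y \<in> carrier Q \<Longrightarrow> y \<in> H \<Longrightarrow> y \<otimes>\<^bsub>A\<^esub> \<epsilon> Y \<in> H"
  shows "rad \<subseteq> H"
proof
  note HD = A.submoduleE[OF H] A.submodule_zero[OF H]
  have part: "part i j \<subseteq> H" if ij: "i \<in> {1..m}" "j \<in> {1..m}" for i j
  proof -
    let ?M = "radical_part K A C i j"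
    note PS = part_submodule[OF ij]
    have M: "?M = A\<lparr>carrier := part i j\<rparr>" by (simp add: radical_part_def)
    interpret P: module K ?M
      by (subst M) (rule submodule.submodule_is_module[OF PS A.module_axioms])
    \<comment> \<open>This intersection turns out to be one of the sub-bimodules over which
      \<open>bimodule_span\<close> intersects, so the span of \<open>X i j\<close>, which is the
      whole part, lies in \<open>H\<close>.\<close>
    have "submodule (H \<inter> part i j) K ?M"
      using HD A.submoduleE[OF PS] A.submodule_zero[OF PS]
      by (intro P.submoduleI') (auto simp: radical_part_def)
    then have "additive_subgroup (H \<inter> part i j) ?M"
      using submodule.axioms(1) additive_subgroupI by blast
    moreover have "X i j \<subseteq> H \<inter> part i j"
      using gen[OF ij] X[OF ij] by (auto simp: bimodule_generators_def)
    moreover have "coset_lact A Y y \<in> H \<inter> part i j" if "Y \<in> C i" "y \<in> H \<inter> part i j" for Y y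
      using that l part_lact_closed(1)[OF ij, of y] part_props(1)[OF ij, of y] Q.C_subset[OF ij(1)]
      by (simp add: coset_lact_eq)
    moreover have "coset_ract A y Y \<in> H \<inter> part i j" if "Y \<in> C j" "y \<in> H \<inter> part i j" for Y y
      using that r part_lact_closed(2)[OF ij, of y] part_props(1)[OF ij, of y] Q.C_subset[OF ij(2)]
      by (simp add: coset_ract_eq)
    ultimately have "bimodule_span (coset_lact A) (coset_ract A) (C i) (C j) ?M (X i j) \<subseteq> H \<inter> part i j"
      unfolding bimodule_span_def by blast
    then show ?thesis using gen[OF ij] by (auto simp: bimodule_generators_def)
  qed
  have sum: "(\<Oplus>\<^bsub>A\<^esub>i\<in>U. f i) \<in> H" if "finite U" "\<And>i. i \<in> U \<Longrightarrow> f i \<in> H" for U and f :: "nat \<Rightarrow> 'a"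
    using that
  proof (induction U rule: finite_induct)
    case (insert u U)
    then have "f \<in> U \<rightarrow> carrier A" "f u \<in> carrier A" using HD(1) by auto
    with insert show ?case using HD(5) by simp
  qed (use HD in simp)
  have ec: "e i \<in> carrier Q" "\<epsilon> (e i) \<in> carrier A" if "i \<in> {1..m}" for i
    using Q.C_subset[OF that Q.e_unit(1)[OF that]] by simp_all
  have one: "\<one>\<^bsub>A\<^esub> = (\<Oplus>\<^bsub>A\<^esub>i\<in>{1..m}. \<epsilon> (e i))"
    using Q.one_eq_sum_e \<epsilon>.hom_one \<epsilon>.hom_finsum[of e "{1..m}"] ec by (simp add: o_def Pi_def)
  fix y assume y: "y \<in> rad"
  then have yc: "y \<in> carrier A" by simp
  have "y \<otimes>\<^bsub>A\<^esub> \<epsilon> (e j) \<in> H" if j: "j \<in> {1..m}" for j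
  proof -
    have "\<epsilon> (e i) \<otimes>\<^bsub>A\<^esub> (y \<otimes>\<^bsub>A\<^esub> \<epsilon> (e j)) \<in> H" if i: "i \<in> {1..m}" for i
      using sandwich_in_part[OF i j y Q.e_unit(1)[OF i] Q.e_unit(1)[OF j]] part[OF i j] ec[OF i] ec[OF j] yc
      by (auto simp: A.M.m_assoc)
    then have "(\<Oplus>\<^bsub>A\<^esub>i\<in>{1..m}. \<epsilon> (e i) \<otimes>\<^bsub>A\<^esub> (y \<otimes>\<^bsub>A\<^esub> \<epsilon> (e j))) \<in> H"
      by (intro sum) auto
    also have "(\<Oplus>\<^bsub>A\<^esub>i\<in>{1..m}. \<epsilon> (e i) \<otimes>\<^bsub>A\<^esub> (y \<otimes>\<^bsub>A\<^esub> \<epsilon> (e j))) = \<one>\<^bsub>A\<^esub> \<otimes>\<^bsub>A\<^esub> (y \<otimes>\<^bsub>A\<^esub> \<epsilon> (e j))"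
      unfolding one using yc ec j by (intro A.M.finsum_ldistr[symmetric]) auto
    finally show ?thesis using yc ec j by simp
  qed
  then have "(\<Oplus>\<^bsub>A\<^esub>j\<in>{1..m}. y \<otimes>\<^bsub>A\<^esub> \<epsilon> (e j)) \<in> H" by (intro sum) auto
  also have "(\<Oplus>\<^bsub>A\<^esub>j\<in>{1..m}. y \<otimes>\<^bsub>A\<^esub> \<epsilon> (e j)) = y \<otimes>\<^bsub>A\<^esub> \<one>\<^bsub>A\<^esub>"
    unfolding one using yc ec by (intro A.M.finsum_rdistr[symmetric]) auto
  finally show "y \<in> H" using yc by simp
qed

end

section \<open>Tensor algebras\<close>

text \<open>The actions enter through the words in the relators and in the products; their closure
  keeps these words inside \<open>tensor_words S M\<close>.\<close>

locale bimodule_words = S: module K S + M: module K M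
  for K :: "('k, 'x) ring_scheme" (structure) and S :: "('k, 's, 'z) module_scheme"
    and M :: "('k, 'a, 'y) module_scheme" +
  fixes l :: "'s \<Rightarrow> 'a \<Rightarrow> 'a" and r :: "'a \<Rightarrow> 's \<Rightarrow> 'a"
  assumes l_closed: "a \<in> carrier S \<Longrightarrow> y \<in> carrier M \<Longrightarrow> l a y \<in> carrier M"
    and r_closed: "y \<in> carrier M \<Longrightarrow> a \<in> carrier S \<Longrightarrow> r y a \<in> carrier M"
begin

abbreviation "TF \<equiv> tensor_word_algebra K S M l r"
abbreviation "TR \<equiv> tensor_relators K S M l r"
abbreviation "T \<equiv> tensor_algebra K S M l r"
abbreviation "tcls \<equiv> tensor_class K S M l r"

sublocale tw: words K "tensor_words S M" "\<lambda>u v. Some (tensor_word_mult S l r u v)"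
  "{Scalar \<one>\<^bsub>S\<^esub>}" TF
  by unfold_locales (simp add: tensor_word_algebra_def)

interpretation TF: module K TF by (rule tw.word_module)

lemma scalar_word: "a \<in> carrier S \<Longrightarrow> Scalar a \<in> tensor_words S M"
  and tensor_word: "ys \<noteq> [] \<Longrightarrow> set ys \<subseteq> carrier M \<Longrightarrow> Tensor ys \<in> tensor_words S M"
  by (auto simp: tensor_words_def)

lemma tensor_word_update:
  assumes "set ys \<subseteq> carrier M" "t < length ys" "y \<in> carrier M"
  shows "Tensor (ys[t := y]) \<in> tensor_words S M"
proof (rule tensor_word)
  show "ys[t := y] \<noteq> []" using assms by auto
  show "set (ys[t := y]) \<subseteq> carrier M" using assms set_update_subset_insert[of ys t y] by blast
qed

lemma TR_submodule: "submodule TR K TF"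
proof -
  have nth: "ys ! t \<in> carrier M" if "set ys \<subseteq> carrier M" "t < length ys" for ys t
    using that by (auto dest: nth_mem)
  show ?thesis
    unfolding tensor_relators_def Let_def
    by (intro TF.lin_span_submodule)
      (auto intro!: TF.M.minus_closed TF.M.a_closed TF.smult_closed tw.single_word_closed
        scalar_word tensor_word_update l_closed r_closed nth)
qed

sublocale T: module K T
  unfolding tensor_algebra_def by (rule TF.quotient_module[OF TR_submodule])

lemma tcls_closed: "w \<in> tensor_words S M \<Longrightarrow> tcls w \<in> carrier T"
  by (simp add: tensor_class_def tensor_algebra_def quotient_algebra_carrier tw.single_word_closed)

text \<open>With \<open>tcls_smult\<close>, this makes the passage from an element of the bimodule
  to its tensor of degree one linear.\<close>

lemma tcls_add:
  assumes y: "y \<in> carrier M" and z: "z \<in> carrier M"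
  shows "tcls (Tensor [y \<oplus>\<^bsub>M\<^esub> z]) = tcls (Tensor [y]) \<oplus>\<^bsub>T\<^esub> tcls (Tensor [z])"
proof -
  let ?s = "\<lambda>y. single_word K (Tensor [y]) :: ('s, 'a) tensor_word \<Rightarrow> 'k"
  have cl: "?s x \<in> carrier TF" if "x \<in> carrier M" for x
    using that by (intro tw.single_word_closed tensor_word) auto
  have "?s (y \<oplus>\<^bsub>M\<^esub> z) \<ominus>\<^bsub>TF\<^esub> (?s y \<oplus>\<^bsub>TF\<^esub> ?s z) \<in> TR"
    unfolding tensor_relators_def Let_def
    apply (rule subsetD[OF lin_span_incl])
    \<comment> \<open>The third of the five families of relators, additivity in one tensor factor,
      is taken at the list \<open>[y]\<close> and position \<open>0\<close>.\<close>
    apply (rule UnI1, rule UnI1, rule UnI2)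
    using y z by (intro CollectI exI[of _ "[y]"] exI[of _ 0] exI[of _ y] exI[of _ z]) simp
  then have "TR +>\<^bsub>TF\<^esub> ?s (y \<oplus>\<^bsub>M\<^esub> z) = TR +>\<^bsub>TF\<^esub> (?s y \<oplus>\<^bsub>TF\<^esub> ?s z)"
    using TF.coset_eq_iff[OF TR_submodule] cl y z by simp
  then show ?thesis
    unfolding tensor_class_def tensor_algebra_def
    using TF.quotient_algebra_add[OF TR_submodule cl[OF y] cl[OF z]] by simp
qed

lemma tcls_smult:
  assumes c: "c \<in> carrier K" and y: "y \<in> carrier M"
  shows "tcls (Tensor [c \<odot>\<^bsub>M\<^esub> y]) = c \<odot>\<^bsub>T\<^esub> tcls (Tensor [y])"
proof -
  let ?s = "\<lambda>y. single_word K (Tensor [y]) :: ('s, 'a) tensor_word \<Rightarrow> 'k"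
  have cl: "?s x \<in> carrier TF" if "x \<in> carrier M" for x
    using that by (intro tw.single_word_closed tensor_word) auto
  have "?s (c \<odot>\<^bsub>M\<^esub> y) \<ominus>\<^bsub>TF\<^esub> c \<odot>\<^bsub>TF\<^esub> ?s y \<in> TR"
    unfolding tensor_relators_def Let_def
    apply (rule subsetD[OF lin_span_incl])
    \<comment> \<open>The fourth family, homogeneity in one tensor factor, again at the list
      \<open>[y]\<close> and position \<open>0\<close>.\<close>
    apply (rule UnI1, rule UnI2)
    using c y by (intro CollectI exI[of _ "[y]"] exI[of _ 0] exI[of _ c] exI[of _ y]) simp
  then have "TR +>\<^bsub>TF\<^esub> ?s (c \<odot>\<^bsub>M\<^esub> y) = TR +>\<^bsub>TF\<^esub> (c \<odot>\<^bsub>TF\<^esub> ?s y)"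
    using TF.coset_eq_iff[OF TR_submodule] cl c y by simp
  then show ?thesis
    unfolding tensor_class_def tensor_algebra_def
    using TF.quotient_algebra_smult[OF TR_submodule c cl[OF y]] by simp
qed

text \<open>Knowing that the product is a coset at all spares the proof that the relators span an ideal.\<close>

lemma tcls_mult:
  assumes w: "w1 \<in> tensor_words S M" "w2 \<in> tensor_words S M"
      "tensor_word_mult S l r w1 w2 \<in> tensor_words S M"
    and X: "tcls w1 \<otimes>\<^bsub>T\<^esub> tcls w2 \<in> carrier T"
  shows "tcls w1 \<otimes>\<^bsub>T\<^esub> tcls w2 = tcls (tensor_word_mult S l r w1 w2)"
proof -
  let ?s = "single_word K :: ('s, 'a) tensor_word \<Rightarrow> _"
  have self: "f \<in> TR +>\<^bsub>TF\<^esub> f" if "f \<in> carrier TF" for f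
    using that TF.coset_mem_iff[OF TR_submodule] by simp
  let ?w = "tensor_word_mult S l r w1 w2"
  note cl = tw.single_word_closed[OF w(1)] tw.single_word_closed[OF w(2)] tw.single_word_closed[OF w(3)]
  have w12: "?s w1 \<otimes>\<^bsub>TF\<^esub> ?s w2 = ?s ?w" using tw.single_word_mult[OF w(1,2)] by simp
  \<comment> \<open>The product of the two obvious representatives lies in the product of the
    cosets. As the latter is a single coset, this element determines it.\<close>
  have mem: "?s ?w \<in> tcls w1 \<otimes>\<^bsub>T\<^esub> tcls w2"
    unfolding tensor_class_def tensor_algebra_def quotient_algebra_mult rcoset_mult_def
    by (intro UN_I[OF self[OF cl(1)]] UN_I[OF self[OF cl(2)]]) (unfold w12, rule self[OF cl(3)])
  obtain f where f: "f \<in> carrier TF" "tcls w1 \<otimes>\<^bsub>T\<^esub> tcls w2 = TR +>\<^bsub>TF\<^esub> f"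
    using X unfolding tensor_algebra_def quotient_algebra_carrier by blast
  then show ?thesis
    using mem TF.coset_mem_iff[OF TR_submodule f(1)] by (simp add: tensor_class_def)
qed

end

section \<open>The presentation\<close>

locale quiver_split = radical_split K A \<epsilon> m C e
  for K :: "('k, 'x) ring_scheme" (structure) and A :: "('k, 'a, 'y) module_scheme"
    and \<epsilon> m C e +
  fixes \<Delta> :: "(nat, 'e) pre_digraph" and X :: "nat \<Rightarrow> nat \<Rightarrow> 'a set" and g :: "'e \<Rightarrow> 'a"
  assumes fin_digraph: "fin_digraph \<Delta>" and verts: "verts \<Delta> = {1..m}"
    and generators: "i \<in> {1..m} \<Longrightarrow> j \<in> {1..m} \<Longrightarrow>
      bimodule_generators (coset_lact A) (coset_ract A) (C i) (C j) (radical_part K A C i j) (X i j)"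
    and arrows: "i \<in> {1..m} \<Longrightarrow> j \<in> {1..m} \<Longrightarrow> X i j = g ` arcs_between \<Delta> i j"
begin

abbreviation "\<A> \<equiv> component_algebra Q C e"

lemma component_simps [simp]:
  "carrier (\<A> i) = C i" "\<one>\<^bsub>\<A> i\<^esub> = e i" "(\<otimes>\<^bsub>\<A> i\<^esub>) = (\<otimes>\<^bsub>Q\<^esub>)" "(\<oplus>\<^bsub>\<A> i\<^esub>) = (\<oplus>\<^bsub>Q\<^esub>)"
  "(\<odot>\<^bsub>\<A> i\<^esub>) = (\<odot>\<^bsub>Q\<^esub>)"
  by (simp_all add: component_algebra_def)

sublocale gpath_family K \<Delta> \<A>
proof (intro gpath_family.intro fin_digraph gpath_family_axioms.intro)
  show "cring K" by (rule A.R.is_cring)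
  show "assoc_algebra K (\<A> v)" if "v \<in> verts \<Delta>" for v
    using Q.C_assoc_algebra that verts by simp
qed

lemma C_carrier: "i \<in> verts \<Delta> \<Longrightarrow> a \<in> C i \<Longrightarrow> a \<in> carrier Q"
  using Q.C_subset verts by simp

lemma e_closed: "i \<in> verts \<Delta> \<Longrightarrow> e i \<in> C i" "i \<in> verts \<Delta> \<Longrightarrow> e i \<in> carrier Q"
  using Q.e_unit(1) C_carrier verts by auto

lemma valid_start: "valid (u, a, ps) \<Longrightarrow> u \<in> verts \<Delta> \<and> a \<in> C u \<and> a \<in> carrier Q"
  using D.gpath_valid_start[of \<A> u a ps] C_carrier by auto

lemma arrow_part: "\<beta> \<in> arcs \<Delta> \<Longrightarrow> g \<beta> \<in> part (tail \<Delta> \<beta>) (head \<Delta> \<beta>)"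
proof -
  assume \<beta>: "\<beta> \<in> arcs \<Delta>"
  then have ij: "tail \<Delta> \<beta> \<in> {1..m}" "head \<Delta> \<beta> \<in> {1..m}"
    using D.tail_in_verts D.head_in_verts verts by auto
  have "g \<beta> \<in> X (tail \<Delta> \<beta>) (head \<Delta> \<beta>)"
    unfolding arrows[OF ij] using \<beta> by (auto simp: arcs_between_def)
  then show ?thesis using generators[OF ij] by (auto simp: bimodule_generators_def)
qed

lemma arrow_props:
  assumes "\<beta> \<in> arcs \<Delta>"
  shows "g \<beta> \<in> rad" "g \<beta> \<in> carrier A" "\<epsilon> (e (tail \<Delta> \<beta>)) \<otimes>\<^bsub>A\<^esub> g \<beta> = g \<beta>"
    "g \<beta> \<otimes>\<^bsub>A\<^esub> \<epsilon> (e (head \<Delta> \<beta>)) = g \<beta>"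
  using part_props[OF _ _ arrow_part[OF assms]] D.tail_in_verts[OF assms] D.head_in_verts[OF assms] verts
  by auto

section \<open>Evaluation of generalized paths through the section and the chosen generators\<close>

fun path_value :: "(nat, 'a set, 'e) gpath \<Rightarrow> 'a"
  where
    "path_value (u, a, []) = \<epsilon> a"
  | "path_value (u, a, (\<beta>, b) # ps) = \<epsilon> a \<otimes>\<^bsub>A\<^esub> (g \<beta> \<otimes>\<^bsub>A\<^esub> path_value (head \<Delta> \<beta>, b, ps))"

lemma path_value_closed: "valid p \<Longrightarrow> path_value p \<in> carrier A"
proof (induction p rule: path_value.induct)
  case (1 u a)
  then show ?case using C_carrier[of u a] by simp
next
  case (2 u a \<beta> b ps)
  then show ?case using C_carrier[of u a] arrow_props(2)[of \<beta>] D.tail_in_verts by auto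
qed

lemma path_value_cons:
  "fst q = head \<Delta> \<beta> \<Longrightarrow>
    path_value (D.gpath_cons u a \<beta> q) = \<epsilon> a \<otimes>\<^bsub>A\<^esub> (g \<beta> \<otimes>\<^bsub>A\<^esub> path_value q)"
  by (cases q) auto

lemma section_orthogonal:
  "u \<in> verts \<Delta> \<Longrightarrow> v \<in> verts \<Delta> \<Longrightarrow> u \<noteq> v \<Longrightarrow> a \<in> C u \<Longrightarrow> b \<in> C v \<Longrightarrow> \<epsilon> a \<otimes>\<^bsub>A\<^esub> \<epsilon> b = \<zero>\<^bsub>A\<^esub>"
  using Q.C_orthogonal[of u v a b] verts C_carrier by (simp flip: \<epsilon>.hom_mult)

text \<open>Where two paths meet, the adjacent entries merge because \<open>\<epsilon>\<close> is
  multiplicative. If the paths do not compose, these entries come from different simple summands and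
  their product is zero.\<close>

lemma path_value_mult:
  assumes p: "valid p" and q: "valid q"
  shows "path_value p \<otimes>\<^bsub>A\<^esub> path_value q =
    (case mul p q of None \<Rightarrow> \<zero>\<^bsub>A\<^esub> | Some r \<Rightarrow> path_value r)"
  using p
proof (induction p rule: path_value.induct)
  case (1 u a)
  then have a: "u \<in> verts \<Delta>" "a \<in> C u" "\<epsilon> a \<in> carrier A" "a \<in> carrier Q" using C_carrier by auto
  obtain v b qs where q': "q = (v, b, qs)" by (cases q)
  then have b: "v \<in> verts \<Delta>" "b \<in> C v" "\<epsilon> b \<in> carrier A" "b \<in> carrier Q" using q valid_start by auto
  show ?case
  proof (cases qs)
    case Nil
    then show ?thesis using a b section_orthogonal by (simp add: q')
  next
    case (Cons y ys)
    obtain \<beta> c where y: "y = (\<beta>, c)" by (cases y)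
    have \<beta>: "g \<beta> \<in> carrier A" "path_value (head \<Delta> \<beta>, c, ys) \<in> carrier A"
      using q unfolding q' Cons y by (auto intro: arrow_props path_value_closed)
    show ?thesis using a b \<beta> section_orthogonal[of u v a b]
      by (simp add: q' Cons y flip: A.M.m_assoc)
  qed
next
  case (2 u a \<beta> b ps)
  let ?p = "(head \<Delta> \<beta>, b, ps)"
  have \<beta>: "\<epsilon> a \<in> carrier A" "g \<beta> \<in> carrier A" "path_value ?p \<in> carrier A" "path_value q \<in> carrier A"
    using 2(2) q C_carrier[of u a] D.tail_in_verts[of \<beta>] by (auto intro: arrow_props path_value_closed)
  have "path_value (u, a, (\<beta>, b) # ps) \<otimes>\<^bsub>A\<^esub> path_value q =
      \<epsilon> a \<otimes>\<^bsub>A\<^esub> (g \<beta> \<otimes>\<^bsub>A\<^esub> (path_value ?p \<otimes>\<^bsub>A\<^esub> path_value q))"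
    using \<beta> by (simp add: A.M.m_assoc)
  also have "path_value ?p \<otimes>\<^bsub>A\<^esub> path_value q = (case mul ?p q of None \<Rightarrow> \<zero>\<^bsub>A\<^esub> | Some r \<Rightarrow> path_value r)"
    using 2 by simp
  finally show ?case
    using \<beta> D.gpath_mult_fst[of \<A> ?p q]
    by (cases "mul ?p q") (auto simp: path_value_cons)
qed

lemma path_value_add:
  assumes "slot s v" and xy: "x \<in> C v" "y \<in> C v"
  shows "path_value (s (x \<oplus>\<^bsub>Q\<^esub> y)) = path_value (s x) \<oplus>\<^bsub>A\<^esub> path_value (s y)"
  using assms
proof (induction rule: slot_induct[case_names h c])
  case (h u a ps)
  then have xy: "x \<in> carrier Q" "y \<in> carrier Q" using C_carrier by auto
  show ?case
  proof (cases ps)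
    case Nil
    then show ?thesis using xy by simp
  next
    case (Cons z zs)
    obtain \<beta> c where z: "z = (\<beta>, c)" by (cases z)
    have "g \<beta> \<in> carrier A" "path_value (head \<Delta> \<beta>, c, zs) \<in> carrier A"
      using h(1) unfolding Cons z by (auto intro: arrow_props path_value_closed)
    then show ?thesis using xy by (simp add: Cons z A.M.l_distr)
  qed
next
  case (c a \<beta> s v)
  have v: "v \<in> verts \<Delta>" by (rule slot_in_verts[OF c(3)])
  have "path_value (s x) \<in> carrier A" "path_value (s y) \<in> carrier A"
    using c slot_valid[OF c(3)] by (auto intro!: path_value_closed)
  then show ?case
    using c arrow_props(2)[OF c(1)] C_carrier[OF D.tail_in_verts[OF c(1)], of a]
    by (simp add: path_value_cons A.M.r_distr)
qed

lemma path_value_smult: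
  assumes "slot s v" and cx: "d \<in> carrier K" "x \<in> C v"
  shows "path_value (s (d \<odot>\<^bsub>Q\<^esub> x)) = d \<odot>\<^bsub>A\<^esub> path_value (s x)"
  using assms
proof (induction rule: slot_induct[case_names h c])
  case (h u a ps)
  then have x: "x \<in> carrier Q" using C_carrier by auto
  show ?case
  proof (cases ps)
    case Nil
    then show ?thesis using x h by (simp add: section_smult)
  next
    case (Cons z zs)
    obtain \<beta> c where z: "z = (\<beta>, c)" by (cases z)
    have "g \<beta> \<in> carrier A" "path_value (head \<Delta> \<beta>, c, zs) \<in> carrier A"
      using h(1) unfolding Cons z by (auto intro: arrow_props path_value_closed)
    then show ?thesis using x h by (simp add: Cons z A.smult_mult_left section_smult)
  qed
next
  case (c a \<beta> s v)
  have "path_value (s x) \<in> carrier A"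
    using c slot_valid[OF c(3)] by (auto intro!: path_value_closed)
  then show ?case
    using c arrow_props(2)[OF c(1)] C_carrier[OF D.tail_in_verts[OF c(1)], of a]
    by (simp add: path_value_cons A.smult_mult_right)
qed

lemma path_value_alg_hom: "\<exists>\<psi> \<in> alg_hom K G A. \<forall>p. valid p \<longrightarrow> \<psi> (cls p) = path_value p"
proof (rule lift_alg_hom)
  show "assoc_algebra K A" by (rule A.assoc_algebra_axioms)
  have "(\<Oplus>\<^bsub>A\<^esub>i\<in>verts \<Delta>. path_value (i, \<one>\<^bsub>\<A> i\<^esub>, [])) = \<epsilon> (\<Oplus>\<^bsub>Q\<^esub>i\<in>verts \<Delta>. e i)"
    using \<epsilon>.hom_finsum[of e "verts \<Delta>"] e_closed by (simp add: o_def Pi_def)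
  then show "(\<Oplus>\<^bsub>A\<^esub>i\<in>verts \<Delta>. path_value (i, \<one>\<^bsub>\<A> i\<^esub>, [])) = \<one>\<^bsub>A\<^esub>"
    using Q.one_eq_sum_e verts \<epsilon>.hom_one by simp
qed (simp_all add: path_value_closed path_value_mult path_value_add path_value_smult)

end

section \<open>The radical as the bimodule of the tensor algebra, and the part of degree
  zero\<close>

context radical_split
begin

lemma radical_bimodule_words:
  "bimodule_words K Q (radical_bimodule A) (coset_lact A) (coset_ract A)"
proof (intro bimodule_words.intro bimodule_words_axioms.intro)
  show "module K Q" by (rule Q.S.module_axioms)
  show "module K (radical_bimodule A)"
    unfolding radical_bimodule_def
    by (rule submodule.submodule_is_module[OF rad_submodule A.module_axioms])
qed (simp_all add: radical_bimodule_def coset_lact_eq coset_ract_eq)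

sublocale T: bimodule_words K Q "radical_bimodule A" "coset_lact A" "coset_ract A"
  by (rule radical_bimodule_words)

lemma radical_bimodule_simps [simp]:
  "carrier (radical_bimodule A) = rad" "(\<oplus>\<^bsub>radical_bimodule A\<^esub>) = (\<oplus>\<^bsub>A\<^esub>)"
  "(\<odot>\<^bsub>radical_bimodule A\<^esub>) = (\<odot>\<^bsub>A\<^esub>)"
  by (simp_all add: radical_bimodule_def)

end

context quiver_split
begin

text \<open>The copy of \<open>A/r\<close> in degree zero: \<open>s\<close> is cut into its
  components \<open>e i \<otimes> s\<close>. It allows the part of degree zero of an element to be
  recorded by a single \<open>s\<close> in \<open>Q\<close>, to which \<open>section_inj_mod\<close>
  applies.\<close>

definition vertex_part :: "'a set \<Rightarrow> ((nat, 'a set, 'e) gpath \<Rightarrow> 'k) set"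
  where "vertex_part s = (\<Oplus>\<^bsub>G\<^esub>i\<in>verts \<Delta>. cls (i, e i \<otimes>\<^bsub>Q\<^esub> s, []))"

lemma e_mult_closed: "i \<in> verts \<Delta> \<Longrightarrow> s \<in> carrier Q \<Longrightarrow> e i \<otimes>\<^bsub>Q\<^esub> s \<in> C i"
  using ideal.I_r_closed[OF Q.C_ideal] e_closed verts by simp

lemma slot_Nil: "i \<in> verts \<Delta> \<Longrightarrow> slot (\<lambda>x. (i, x, [])) i"
  using slot_head[of i "e i" "[]"] e_closed by simp

lemma cls_Nil_zero: "i \<in> verts \<Delta> \<Longrightarrow> cls (i, \<zero>\<^bsub>Q\<^esub>, []) = \<zero>\<^bsub>G\<^esub>"
  using cls_smult[OF slot_Nil, of i \<zero> "\<zero>\<^bsub>Q\<^esub>"] Q.C_zero[of i] verts by simp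

lemma vertex_part_closed [simp]: "s \<in> carrier Q \<Longrightarrow> vertex_part s \<in> carrier G"
  unfolding vertex_part_def by (intro G.M.finsum_closed) (auto simp: e_mult_closed)

lemma vertex_part_add:
  assumes "s \<in> carrier Q" "t \<in> carrier Q"
  shows "vertex_part (s \<oplus>\<^bsub>Q\<^esub> t) = vertex_part s \<oplus>\<^bsub>G\<^esub> vertex_part t"
proof -
  have "vertex_part (s \<oplus>\<^bsub>Q\<^esub> t) =
      (\<Oplus>\<^bsub>G\<^esub>i\<in>verts \<Delta>. cls (i, e i \<otimes>\<^bsub>Q\<^esub> s, []) \<oplus>\<^bsub>G\<^esub> cls (i, e i \<otimes>\<^bsub>Q\<^esub> t, []))"
    unfolding vertex_part_def
    using assms cls_add[OF slot_Nil] e_closed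
    by (intro G.M.finsum_cong') (auto simp: Q.S.M.r_distr e_mult_closed)
  also have "\<dots> = vertex_part s \<oplus>\<^bsub>G\<^esub> vertex_part t"
    unfolding vertex_part_def using assms by (intro G.M.finsum_addf) (auto simp: e_mult_closed)
  finally show ?thesis .
qed

lemma vertex_part_zero: "vertex_part \<zero>\<^bsub>Q\<^esub> = \<zero>\<^bsub>G\<^esub>"
proof -
  have "vertex_part \<zero>\<^bsub>Q\<^esub> = (\<Oplus>\<^bsub>G\<^esub>i\<in>verts \<Delta>. \<zero>\<^bsub>G\<^esub>)"
    unfolding vertex_part_def using e_closed by (intro G.M.finsum_cong') (auto simp: cls_Nil_zero)
  then show ?thesis by simp
qed

text \<open>For \<open>a\<close> in one summand, orthogonality kills the components at all other
  vertices.\<close>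

lemma vertex_part_cls:
  assumes i: "i \<in> verts \<Delta>" and a: "a \<in> C i"
  shows "vertex_part a = cls (i, a, [])"
proof -
  have "vertex_part a = (\<Oplus>\<^bsub>G\<^esub>j\<in>verts \<Delta>. if j = i then cls (i, a, []) else \<zero>\<^bsub>G\<^esub>)"
    unfolding vertex_part_def using i a Q.e_unit(2)[of i a] Q.C_orthogonal[of _ i _ a] e_closed verts
    by (intro G.M.finsum_cong') (auto simp: cls_Nil_zero)
  also have "\<dots> = cls (i, a, [])"
    using G.M.add.finprod_singleton_swap[of i "verts \<Delta>" "\<lambda>_. cls (i, a, [])"] i a by simp
  finally show ?thesis .
qed

section \<open>Comparison of \<psi> and \<phi>\<close>

context
  fixes \<psi> \<phi>
  assumes \<psi>: "\<psi> \<in> alg_hom K G A" and \<psi>_cls: "\<And>p. valid p \<Longrightarrow> \<psi> (cls p) = path_value p"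
    and \<phi>: "is_phi_tilde K A \<Delta> \<A> g \<phi>"
begin

interpretation \<psi>: ring_hom_ring G A \<psi>
  by (rule alg_hom_ring_hom_ring[OF \<psi> G.M.ring_axioms A.M.ring_axioms])

lemma \<psi>_smult: "c \<in> carrier K \<Longrightarrow> x \<in> carrier G \<Longrightarrow> \<psi> (c \<odot>\<^bsub>G\<^esub> x) = c \<odot>\<^bsub>A\<^esub> \<psi> x"
  by (rule alg_homD(5)[OF \<psi>])

lemma \<psi>_vertex_part:
  assumes "s \<in> carrier Q"
  shows "\<psi> (vertex_part s) = \<epsilon> s"
proof -
  have v: "valid (i, e i \<otimes>\<^bsub>Q\<^esub> s, [])" if "i \<in> verts \<Delta>" for i
    using that assms by (simp add: e_mult_closed)
  have "\<psi> (vertex_part s) = (\<Oplus>\<^bsub>A\<^esub>i\<in>verts \<Delta>. \<psi> (cls (i, e i \<otimes>\<^bsub>Q\<^esub> s, [])))"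
    unfolding vertex_part_def
    using \<psi>.hom_finsum[of "\<lambda>i. cls (i, e i \<otimes>\<^bsub>Q\<^esub> s, [])" "verts \<Delta>"] v by (simp add: o_def Pi_def)
  also have "\<dots> = (\<Oplus>\<^bsub>A\<^esub>i\<in>verts \<Delta>. \<epsilon> (e i \<otimes>\<^bsub>Q\<^esub> s))"
    using v assms e_closed by (intro A.M.finsum_cong') (auto simp: \<psi>_cls)
  also have "\<dots> = \<epsilon> (\<Oplus>\<^bsub>Q\<^esub>i\<in>verts \<Delta>. e i \<otimes>\<^bsub>Q\<^esub> s)"
    using \<epsilon>.hom_finsum[of "\<lambda>i. e i \<otimes>\<^bsub>Q\<^esub> s" "verts \<Delta>"] assms e_closed by (simp add: o_def Pi_def)
  also have "(\<Oplus>\<^bsub>Q\<^esub>i\<in>verts \<Delta>. e i \<otimes>\<^bsub>Q\<^esub> s) = (\<Oplus>\<^bsub>Q\<^esub>i\<in>verts \<Delta>. e i) \<otimes>\<^bsub>Q\<^esub> s"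
    using assms e_closed by (intro Q.S.M.finsum_ldistr[symmetric]) auto
  also have "\<dots> = s" unfolding verts Q.one_eq_sum_e[symmetric] using assms by simp
  finally show ?thesis .
qed

lemma path_value_rad:
  assumes "valid (u, a, (\<beta>, b) # ps)"
  shows "path_value (u, a, (\<beta>, b) # ps) \<in> rad"
proof -
  have "\<beta> \<in> arcs \<Delta>" "a \<in> carrier Q" "path_value (head \<Delta> \<beta>, b, ps) \<in> carrier A"
    using assms C_carrier[of u a] D.tail_in_verts by (auto intro: path_value_closed)
  then show ?thesis
    using rad.I_l_closed[OF rad.I_r_closed[OF arrow_props(1)]] by simp
qed

text \<open>The preimage of the radical is an ideal and contains the paths of length one, each of
  which has a generator from the radical as a factor of its value.\<close>

lemma \<psi>_arrow_ideal: "x \<in> J \<Longrightarrow> \<psi> x \<in> rad"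
proof -
  have "ideal {x \<in> carrier G. \<psi> x \<in> rad} G" by (rule \<psi>.ideal_vimage[OF rad.is_ideal])
  moreover have "\<psi> (cls p) \<in> rad" if p: "valid p" "gpath_length p = 1" for p
  proof -
    obtain u a ps where "p = (u, a, ps)" by (cases p)
    then obtain \<beta> b where "p = (u, a, [(\<beta>, b)])" using p(2) by (auto simp: length_Suc_conv)
    then show ?thesis using path_value_rad[of u a \<beta> b "[]"] p(1) \<psi>_cls[OF p(1)] by simp
  qed
  ultimately have "J \<subseteq> {x \<in> carrier G. \<psi> x \<in> rad}" by (intro arrow_ideal_minimal) auto
  then show "x \<in> J \<Longrightarrow> \<psi> x \<in> rad" by blast
qed

lemma arrow_ideal_closed: "x \<in> J \<Longrightarrow> x \<in> carrier G"
  using additive_subgroup.a_subset[OF ideal.axioms(1)[OF arrow_ideal]] by blast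

lemma \<psi>_arrow_ideal_square: "x \<in> J \<cdot>\<^bsub>G\<^esub> J \<Longrightarrow> x \<in> carrier G \<and> \<psi> x = \<zero>\<^bsub>A\<^esub>"
proof (induction rule: ideal_prod.induct)
  case (prod i j)
  then show ?case using arrow_ideal_closed \<psi>_arrow_ideal by (simp add: rad_square)
qed simp

lemma \<psi>_surj: "\<psi> ` carrier G = carrier A"
proof
  let ?H = "\<psi> ` carrier G"
  show "?H \<subseteq> carrier A" by auto
  have add: "x \<oplus>\<^bsub>A\<^esub> y \<in> ?H" if xy: "x \<in> ?H" "y \<in> ?H" for x y
  proof -
    obtain x' y' where "x' \<in> carrier G" "y' \<in> carrier G" "x = \<psi> x'" "y = \<psi> y'" using xy by blast
    then show ?thesis by (intro image_eqI[of _ _ "x' \<oplus>\<^bsub>G\<^esub> y'"]) simp_all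
  qed
  have mult: "x \<otimes>\<^bsub>A\<^esub> y \<in> ?H" if xy: "x \<in> ?H" "y \<in> ?H" for x y
  proof -
    obtain x' y' where "x' \<in> carrier G" "y' \<in> carrier G" "x = \<psi> x'" "y = \<psi> y'" using xy by blast
    then show ?thesis by (intro image_eqI[of _ _ "x' \<otimes>\<^bsub>G\<^esub> y'"]) simp_all
  qed
  have smult: "c \<odot>\<^bsub>A\<^esub> x \<in> ?H" if c: "c \<in> carrier K" "x \<in> ?H" for c x
  proof -
    obtain x' where "x' \<in> carrier G" "x = \<psi> x'" using c(2) by blast
    then show ?thesis using c(1) by (intro image_eqI[of _ _ "c \<odot>\<^bsub>G\<^esub> x'"]) (simp_all add: \<psi>_smult)
  qed
  have zero: "\<zero>\<^bsub>A\<^esub> \<in> ?H" using \<psi>.hom_zero G.M.zero_closed by (metis imageI)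
  have H: "submodule ?H K A" using add smult zero by (intro A.submoduleI') auto
  have sec: "\<epsilon> s \<in> ?H" if "s \<in> carrier Q" for s
    using that \<psi>_vertex_part[OF that] by (metis imageI vertex_part_closed)
  have "g \<beta> \<in> ?H" if \<beta>: "\<beta> \<in> arcs \<Delta>" for \<beta>
  proof -
    let ?p = "(tail \<Delta> \<beta>, e (tail \<Delta> \<beta>), [(\<beta>, e (head \<Delta> \<beta>))])"
    have "valid ?p" using \<beta> e_closed D.tail_in_verts D.head_in_verts by simp
    moreover from this have "\<psi> (cls ?p) = g \<beta>" using arrow_props[OF \<beta>] by (simp add: \<psi>_cls)
    ultimately show ?thesis by (metis imageI cls_closed)
  qed
  then have X: "X i j \<subseteq> ?H" if "i \<in> {1..m}" "j \<in> {1..m}" for i j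
    unfolding arrows[OF that] by (auto simp: arcs_between_def)
  \<comment> \<open>The image is closed under products and contains the image of
    \<open>\<epsilon>\<close>, so it is stable under both actions of \<open>Q\<close>; it also
    contains the generators, as values of arrows with identity entries.\<close>
  have rad: "rad \<subseteq> ?H"
    by (rule rad_subset_of_generators[OF H generators X]) (auto intro: mult sec)
  show "carrier A \<subseteq> ?H"
  proof
    fix x assume x: "x \<in> carrier A"
    \<comment> \<open>An arbitrary \<open>x\<close> differs from the value of the section at its own
      coset by an element of the radical.\<close>
    let ?X = "rad +>\<^bsub>A\<^esub> x"
    have X: "?X \<in> carrier Q" using x by (simp add: quotient_algebra_carrier)
    have "x \<in> ?X" using A.coset_mem_iff[OF rad_submodule x] x by simp
    then have "x \<ominus>\<^bsub>A\<^esub> \<epsilon> ?X \<in> ?H" using coset_diff[OF X] rad by blast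
    then have "(x \<ominus>\<^bsub>A\<^esub> \<epsilon> ?X) \<oplus>\<^bsub>A\<^esub> \<epsilon> ?X \<in> ?H" using sec[OF X] add by blast
    then show "x \<in> ?H" using x X by (simp add: A.M.minus_eq A.M.a_assoc A.M.l_neg)
  qed
qed

abbreviation "tensor y \<equiv> radical_tensor_class K A (Tensor [y])"

lemma \<phi>_hom: "\<phi> \<in> alg_hom K G T.T"
  using \<phi> by (simp add: is_phi_tilde_def radical_tensor_algebra_def)

lemmas \<phi>D = alg_homD[OF \<phi>_hom]

lemma tensor_eq: "radical_tensor_class K A = T.tcls"
  by (simp add: radical_tensor_class_def)

lemma \<phi>_zero: "\<phi> \<zero>\<^bsub>G\<^esub> = \<zero>\<^bsub>T.T\<^esub>"
  using \<phi>D(5)[of \<zero> "\<zero>\<^bsub>G\<^esub>"] \<phi>D(1)[of "\<zero>\<^bsub>G\<^esub>"] by simp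

lemma tensor_zero: "tensor \<zero>\<^bsub>A\<^esub> = \<zero>\<^bsub>T.T\<^esub>"
  using T.tcls_smult[of \<zero> "\<zero>\<^bsub>A\<^esub>"] T.tcls_closed[of "Tensor [\<zero>\<^bsub>A\<^esub>]"] T.tensor_word[of "[\<zero>\<^bsub>A\<^esub>]"]
  by (simp add: tensor_eq)

text \<open>The product of the two classes is \<open>\<phi> (x \<otimes> y)\<close>, which lies in
  the carrier and hence is a coset, as \<open>tcls_mult\<close> requires.\<close>

lemma \<phi>_mult:
  assumes x: "x \<in> carrier G" "\<phi> x = T.tcls w1" and y: "y \<in> carrier G" "\<phi> y = T.tcls w2"
    and w: "w1 \<in> tensor_words Q (radical_bimodule A)" "w2 \<in> tensor_words Q (radical_bimodule A)"
      "tensor_word_mult Q (coset_lact A) (coset_ract A) w1 w2 \<in> tensor_words Q (radical_bimodule A)"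
  shows "\<phi> (x \<otimes>\<^bsub>G\<^esub> y) = T.tcls (tensor_word_mult Q (coset_lact A) (coset_ract A) w1 w2)"
  using T.tcls_mult[OF w] \<phi>D(2)[OF x(1) y(1)] \<phi>D(1)[of "x \<otimes>\<^bsub>G\<^esub> y"] x y by simp

text \<open>The path is factored into an entry, an arrow with identity entries and another entry,
  the three kinds of paths on which \<open>\<phi>\<close> is prescribed. In the tensor algebra the
  outer entries act on the tensor of \<open>g \<beta>\<close>, and the result is the tensor of the
  value of the path.\<close>

lemma \<phi>_length_1:
  assumes p: "valid (u, a, [(\<beta>, b)])"
  shows "\<phi> (cls (u, a, [(\<beta>, b)])) = tensor (path_value (u, a, [(\<beta>, b)]))"
proof -
  let ?h = "head \<Delta> \<beta>"
  have \<beta>: "\<beta> \<in> arcs \<Delta>" "tail \<Delta> \<beta> = u" and uh: "u \<in> verts \<Delta>" "?h \<in> verts \<Delta>"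
    and ab: "a \<in> C u" "b \<in> C ?h" using p D.tail_in_verts by auto
  then have c: "a \<in> carrier Q" "b \<in> carrier Q"
    using C_carrier[OF uh(1) ab(1)] C_carrier[OF uh(2) ab(2)] by auto
  let ?arrow = "(u, e u, [(\<beta>, e ?h)])"
  have v: "valid ?arrow" "valid (u, a, [(\<beta>, e ?h)])" "valid (u, a, [])" "valid (?h, b, [])"
    using \<beta> uh ab e_closed by auto
  have scalar: "\<phi> (cls (i, s, [])) = T.tcls (Scalar s)" if "i \<in> verts \<Delta>" "s \<in> C i" for i s
    using \<phi> that by (simp add: is_phi_tilde_def tensor_eq)
  have arrow: "\<phi> (cls ?arrow) = T.tcls (Tensor [g \<beta>])"
    using \<phi> \<beta> by (auto simp: is_phi_tilde_def tensor_eq)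
  note g = arrow_props(1,2)[OF \<beta>(1)]
  have w: "Tensor [y] \<in> tensor_words Q (radical_bimodule A)" if "y \<in> rad" for y
    using that by (intro T.tensor_word) auto
  have s: "Scalar s \<in> tensor_words Q (radical_bimodule A)" if "s \<in> carrier Q" for s
    using that by (rule T.scalar_word)
  have "\<phi> (cls (u, a, [(\<beta>, e ?h)])) = T.tcls (Tensor [\<epsilon> a \<otimes>\<^bsub>A\<^esub> g \<beta>])"
    using cls_Cons_unit[of u a \<beta>] v
      \<phi>_mult[OF cls_closed[OF v(3)] scalar[OF uh(1) ab(1)] cls_closed[OF v(1)] arrow s[OF c(1)] w[OF g(1)]]
      w c g by (simp add: coset_lact_eq)
  from \<phi>_mult[OF cls_closed[OF v(2)] this cls_closed[OF v(4)] scalar[OF uh(2) ab(2)] w s[OF c(2)]]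
  have "\<phi> (cls (u, a, [(\<beta>, b)])) = T.tcls (Tensor [\<epsilon> a \<otimes>\<^bsub>A\<^esub> g \<beta> \<otimes>\<^bsub>A\<^esub> \<epsilon> b])"
    using cls_Cons[OF p] w c g by (simp add: coset_ract_eq)
  then show ?thesis using c g by (simp add: tensor_eq A.M.m_assoc)
qed

text \<open>The summands have degrees zero, one and at least two.\<close>

definition graded :: "((nat, 'a set, 'e) gpath \<Rightarrow> 'k) set \<Rightarrow> bool"
  where "graded x \<longleftrightarrow> (\<exists>s\<in>carrier Q. \<exists>y\<in>J. \<exists>z\<in>J \<cdot>\<^bsub>G\<^esub> J.
    x = vertex_part s \<oplus>\<^bsub>G\<^esub> y \<oplus>\<^bsub>G\<^esub> z \<and> \<phi> y = tensor (\<psi> y))"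

lemma J_zero: "\<zero>\<^bsub>G\<^esub> \<in> J" "\<zero>\<^bsub>G\<^esub> \<in> J \<cdot>\<^bsub>G\<^esub> J"
  using additive_subgroup.zero_closed[OF ideal.axioms(1)] arrow_ideal
    G.M.ideal_prod_is_ideal[OF arrow_ideal arrow_ideal] by blast+

lemma J_smult:
  assumes "c \<in> carrier K"
  shows "x \<in> J \<Longrightarrow> c \<odot>\<^bsub>G\<^esub> x \<in> J" "x \<in> J \<cdot>\<^bsub>G\<^esub> J \<Longrightarrow> c \<odot>\<^bsub>G\<^esub> x \<in> J \<cdot>\<^bsub>G\<^esub> J"
  using G.submoduleE(4)[OF G.ideal_submodule[OF arrow_ideal] assms]
    G.submoduleE(4)[OF G.ideal_submodule[OF G.M.ideal_prod_is_ideal[OF arrow_ideal arrow_ideal]] assms]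
  by auto

text \<open>All conditions are additive. For the condition on \<open>\<phi>\<close> this is
  linearity of the tensor of degree one, applicable because \<open>\<psi>\<close> maps the arrow
  ideal into the radical.\<close>

lemma graded_add:
  assumes "graded x" "graded x'"
  shows "graded (x \<oplus>\<^bsub>G\<^esub> x')"
proof -
  obtain s y z where x: "s \<in> carrier Q" "y \<in> J" "z \<in> J \<cdot>\<^bsub>G\<^esub> J"
    "x = vertex_part s \<oplus>\<^bsub>G\<^esub> y \<oplus>\<^bsub>G\<^esub> z" "\<phi> y = tensor (\<psi> y)"
    using assms(1) unfolding graded_def by blast
  obtain s' y' z' where x': "s' \<in> carrier Q" "y' \<in> J" "z' \<in> J \<cdot>\<^bsub>G\<^esub> J"
    "x' = vertex_part s' \<oplus>\<^bsub>G\<^esub> y' \<oplus>\<^bsub>G\<^esub> z'" "\<phi> y' = tensor (\<psi> y')"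
    using assms(2) unfolding graded_def by blast
  have c: "y \<in> carrier G" "y' \<in> carrier G" "z \<in> carrier G" "z' \<in> carrier G"
    using x x' arrow_ideal_closed \<psi>_arrow_ideal_square by auto
  have "x \<oplus>\<^bsub>G\<^esub> x' = vertex_part (s \<oplus>\<^bsub>Q\<^esub> s') \<oplus>\<^bsub>G\<^esub> (y \<oplus>\<^bsub>G\<^esub> y') \<oplus>\<^bsub>G\<^esub> (z \<oplus>\<^bsub>G\<^esub> z')"
    using x x' c by (simp add: vertex_part_add G.M.a_ac)
  moreover have "\<phi> (y \<oplus>\<^bsub>G\<^esub> y') = tensor (\<psi> (y \<oplus>\<^bsub>G\<^esub> y'))"
    using T.tcls_add[of "\<psi> y" "\<psi> y'"] \<psi>_arrow_ideal x x' c by (simp add: \<phi>D(3) tensor_eq)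
  moreover have "y \<oplus>\<^bsub>G\<^esub> y' \<in> J"
    using x x' arrow_ideal by (simp add: additive_subgroup.a_closed ideal.axioms(1))
  moreover have "z \<oplus>\<^bsub>G\<^esub> z' \<in> J \<cdot>\<^bsub>G\<^esub> J" using x x' by (simp add: ideal_prod.sum)
  ultimately show ?thesis
    unfolding graded_def using x(1) x'(1) Q.S.M.a_closed by blast
qed

text \<open>The length of the path decides which summand it fills. In length zero the scalar is
  moved into the entry, so that the element is again a \<open>vertex_part\<close>.\<close>

lemma graded_smult_cls:
  assumes c: "c \<in> carrier K" and p: "valid p"
  shows "graded (c \<odot>\<^bsub>G\<^esub> cls p)"
proof -
  have zero: "\<phi> \<zero>\<^bsub>G\<^esub> = tensor (\<psi> \<zero>\<^bsub>G\<^esub>)" using \<phi>_zero tensor_zero by simp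
  have cl: "c \<odot>\<^bsub>G\<^esub> cls p \<in> carrier G" using c p by simp
  obtain u a ps where uap: "p = (u, a, ps)" by (cases p)
  show ?thesis
  proof (cases ps)
    case Nil
    then have a: "u \<in> verts \<Delta>" "a \<in> C u" using p uap by auto
    then have ca: "c \<odot>\<^bsub>Q\<^esub> a \<in> C u" using component_smult_closed[of u c a] c by simp
    have "c \<odot>\<^bsub>G\<^esub> cls p = cls (u, c \<odot>\<^bsub>Q\<^esub> a, [])"
      using cls_smult[OF slot_Nil, of u c a] a c by (simp add: uap Nil)
    also have "\<dots> = vertex_part (c \<odot>\<^bsub>Q\<^esub> a)" by (rule vertex_part_cls[OF a(1) ca, symmetric])
    finally have "c \<odot>\<^bsub>G\<^esub> cls p = vertex_part (c \<odot>\<^bsub>Q\<^esub> a) \<oplus>\<^bsub>G\<^esub> \<zero>\<^bsub>G\<^esub> \<oplus>\<^bsub>G\<^esub> \<zero>\<^bsub>G\<^esub>"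
      using C_carrier[OF a(1) ca] by simp
    then show ?thesis
      unfolding graded_def using C_carrier[OF a(1) ca] J_zero zero by blast
  next
    case (Cons y qs)
    obtain \<beta> b where y: "y = (\<beta>, b)" by (cases y)
    show ?thesis
    proof (cases qs)
      case Nil
      then have p': "p = (u, a, [(\<beta>, b)])" using uap Cons y by simp
      have J: "c \<odot>\<^bsub>G\<^esub> cls p \<in> J" using p c unfolding p' by (intro J_smult cls_in_arrow_ideal)
      have r: "path_value p \<in> rad" using p unfolding p' by (rule path_value_rad)
      have "\<phi> (c \<odot>\<^bsub>G\<^esub> cls p) = c \<odot>\<^bsub>T.T\<^esub> tensor (path_value p)"
        using \<phi>_length_1[of u a \<beta> b] p c by (simp add: \<phi>D(5) p')
      also have "\<dots> = tensor (\<psi> (c \<odot>\<^bsub>G\<^esub> cls p))"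
        using T.tcls_smult[OF c, of "path_value p"] r c p by (simp add: \<psi>_smult \<psi>_cls tensor_eq)
      finally have \<phi>eq: "\<phi> (c \<odot>\<^bsub>G\<^esub> cls p) = tensor (\<psi> (c \<odot>\<^bsub>G\<^esub> cls p))" .
      have "c \<odot>\<^bsub>G\<^esub> cls p = vertex_part \<zero>\<^bsub>Q\<^esub> \<oplus>\<^bsub>G\<^esub> (c \<odot>\<^bsub>G\<^esub> cls p) \<oplus>\<^bsub>G\<^esub> \<zero>\<^bsub>G\<^esub>"
        using cl by (simp add: vertex_part_zero)
      then show ?thesis
        unfolding graded_def using J J_zero \<phi>eq Q.S.M.zero_closed by blast
    next
      case (Cons y' rs)
      obtain \<gamma> d where "y' = (\<gamma>, d)" by (cases y')
      then have p': "p = (u, a, (\<beta>, b) # (\<gamma>, d) # rs)" using uap \<open>ps = y # qs\<close> y Cons by simp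
      have J: "c \<odot>\<^bsub>G\<^esub> cls p \<in> J \<cdot>\<^bsub>G\<^esub> J"
        using p c unfolding p' by (intro J_smult cls_in_arrow_ideal_square)
      have "c \<odot>\<^bsub>G\<^esub> cls p = vertex_part \<zero>\<^bsub>Q\<^esub> \<oplus>\<^bsub>G\<^esub> \<zero>\<^bsub>G\<^esub> \<oplus>\<^bsub>G\<^esub> (c \<odot>\<^bsub>G\<^esub> cls p)"
        using cl by (simp add: vertex_part_zero)
      then show ?thesis
        unfolding graded_def using J J_zero zero Q.S.M.zero_closed by blast
    qed
  qed
qed

lemma graded_all: "x \<in> carrier G \<Longrightarrow> graded x"
proof (induction x rule: gpath_algebra_induct)
  case zero
  have "\<zero>\<^bsub>G\<^esub> = vertex_part \<zero>\<^bsub>Q\<^esub> \<oplus>\<^bsub>G\<^esub> \<zero>\<^bsub>G\<^esub> \<oplus>\<^bsub>G\<^esub> \<zero>\<^bsub>G\<^esub>" by (simp add: vertex_part_zero)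
  moreover have "\<phi> \<zero>\<^bsub>G\<^esub> = tensor (\<psi> \<zero>\<^bsub>G\<^esub>)" using \<phi>_zero tensor_zero by simp
  ultimately show ?case
    unfolding graded_def using J_zero Q.S.M.zero_closed by blast
qed (simp add: graded_add graded_smult_cls)

lemma kernel_subset:
  "a_kernel G A \<psi> \<subseteq> J \<cdot>\<^bsub>G\<^esub> J <+>\<^bsub>G\<^esub> (J \<inter> a_kernel G (radical_tensor_algebra K A) \<phi>)"
proof
  fix x assume "x \<in> a_kernel G A \<psi>"
  then have x: "x \<in> carrier G" "\<psi> x = \<zero>\<^bsub>A\<^esub>" unfolding a_kernel_def' by simp_all
  obtain s y z where sum: "s \<in> carrier Q" "y \<in> J" "z \<in> J \<cdot>\<^bsub>G\<^esub> J"
    "x = vertex_part s \<oplus>\<^bsub>G\<^esub> y \<oplus>\<^bsub>G\<^esub> z" "\<phi> y = tensor (\<psi> y)"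
    using graded_all[OF x(1)] unfolding graded_def by blast
  have c: "y \<in> carrier G" "z \<in> carrier G" "\<psi> z = \<zero>\<^bsub>A\<^esub>"
    using sum arrow_ideal_closed \<psi>_arrow_ideal_square by auto
  have y: "\<psi> y \<in> rad" by (rule \<psi>_arrow_ideal[OF sum(2)])
  have "\<epsilon> s \<oplus>\<^bsub>A\<^esub> \<psi> y = \<zero>\<^bsub>A\<^esub>" using x(2) sum c by (simp add: \<psi>_vertex_part)
  then have "\<epsilon> s = \<ominus>\<^bsub>A\<^esub> \<psi> y" using sum(1) c(1) A.M.minus_equality[of "\<epsilon> s" "\<psi> y"] by simp
  \<comment> \<open>Being the negative of \<open>\<psi> y\<close>, the value
    \<open>\<epsilon> s\<close> lies in the radical. Once \<open>s\<close> vanishes so does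
    \<open>\<psi> y\<close>, and \<open>\<phi> y\<close> becomes the tensor of zero.\<close>
  then have s: "s = \<zero>\<^bsub>Q\<^esub>" using section_inj_mod[OF sum(1)] y by simp
  then have "\<psi> y = \<zero>\<^bsub>A\<^esub>" using \<open>\<epsilon> s \<oplus>\<^bsub>A\<^esub> \<psi> y = \<zero>\<^bsub>A\<^esub>\<close> c by simp
  then have "\<phi> y = \<zero>\<^bsub>T.T\<^esub>" using sum(5) tensor_zero by simp
  then have "y \<in> J \<inter> a_kernel G (radical_tensor_algebra K A) \<phi>"
    using sum(2) c unfolding a_kernel_def' radical_tensor_algebra_def by simp
  moreover have "x = z \<oplus>\<^bsub>G\<^esub> y"
    using sum(4) s c by (simp add: vertex_part_zero G.M.a_comm)
  ultimately show "x \<in> J \<cdot>\<^bsub>G\<^esub> J <+>\<^bsub>G\<^esub> (J \<inter> a_kernel G (radical_tensor_algebra K A) \<phi>)"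
    using sum(3) unfolding set_add_def set_mult_def by auto
qed

text \<open>The relations in the kernel of \<open>\<psi>\<close> generate the whole kernel, so the
  isomorphism and both inclusions become statements about this kernel.\<close>

lemma presentation_by_kernel_relations:
  "\<exists>\<rho>. \<rho> \<subseteq> gpath_relations K \<Delta> \<A> \<and>
    alg_isomorphic K A (quotient_algebra G (Idl\<^bsub>G\<^esub> \<rho>)) \<and>
    J \<cdot>\<^bsub>G\<^esub> J \<subseteq> Idl\<^bsub>G\<^esub> \<rho> \<and>
    Idl\<^bsub>G\<^esub> \<rho> \<subseteq> J \<cdot>\<^bsub>G\<^esub> J <+>\<^bsub>G\<^esub> (J \<inter> a_kernel G (radical_tensor_algebra K A) \<phi>)"
proof (intro exI[of _ "a_kernel G A \<psi> \<inter> gpath_relations K \<Delta> \<A>"] conjI)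
  note Idl = ideal_generated_by_relations[OF \<psi>.kernel_is_ideal]
  show "alg_isomorphic K A (quotient_algebra G (Idl\<^bsub>G\<^esub> (a_kernel G A \<psi> \<inter> gpath_relations K \<Delta> \<A>)))"
    unfolding Idl
    by (rule alg_hom_surj_isomorphic[OF A.assoc_algebra_axioms G.assoc_algebra_axioms \<psi> \<psi>_surj])
  show "J \<cdot>\<^bsub>G\<^esub> J \<subseteq> Idl\<^bsub>G\<^esub> (a_kernel G A \<psi> \<inter> gpath_relations K \<Delta> \<A>)"
    unfolding Idl unfolding a_kernel_def' by (intro subsetI CollectI \<psi>_arrow_ideal_square)
  show "Idl\<^bsub>G\<^esub> (a_kernel G A \<psi> \<inter> gpath_relations K \<Delta> \<A>)
      \<subseteq> J \<cdot>\<^bsub>G\<^esub> J <+>\<^bsub>G\<^esub> (J \<inter> a_kernel G (radical_tensor_algebra K A) \<phi>)"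
    unfolding Idl by (rule kernel_subset)
qed blast

end

end

theorem theorem4p2:
  fixes K :: "('k, 'x) ring_scheme"
    and A :: "('k, 'a, 'y) module_scheme"
    and m :: nat
    and C :: "nat \<Rightarrow> 'a set set"
    and e :: "nat \<Rightarrow> 'a set"
    and \<Delta> :: "(nat, 'e) pre_digraph"
    and X :: "nat \<Rightarrow> nat \<Rightarrow> 'a set"
    and g :: "'e \<Rightarrow> 'a"
    and \<A> :: "nat \<Rightarrow> ('k, 'a set) module"
    and G :: "('k, ((nat, 'a set, 'e) gpath \<Rightarrow> 'k) set) module"
    and J :: "((nat, 'a set, 'e) gpath \<Rightarrow> 'k) set set"
    and \<phi> :: "((nat, 'a set, 'e) gpath \<Rightarrow> 'k) set \<Rightarrow> (('a set, 'a) tensor_word \<Rightarrow> 'k) set"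
  assumes "field K"
    and "assoc_algebra K A"
    and "fin_dim K A"
    and "radical A \<cdot>\<^bsub>A\<^esub> radical A = {\<zero>\<^bsub>A\<^esub>}"
    and "splits_over_radical K A"
    and "simple_decomposition K (quotient_algebra A (radical A)) m C e"
    and "is_quiver_of K A m C \<Delta>"
    and "arrow_generators K A m C \<Delta> X g"
  defines "\<A> \<equiv> component_algebra (quotient_algebra A (radical A)) C e"
    and "G \<equiv> gpath_algebra K \<Delta> \<A>"
    and "J \<equiv> gpath_arrow_ideal K \<Delta> \<A>"
  assumes "is_phi_tilde K A \<Delta> \<A> g \<phi>"
  shows "\<exists>\<rho>. \<rho> \<subseteq> gpath_relations K \<Delta> \<A> \<and>
    alg_isomorphic K A (quotient_algebra G (Idl\<^bsub>G\<^esub> \<rho>)) \<and>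
    J \<cdot>\<^bsub>G\<^esub> J \<subseteq> Idl\<^bsub>G\<^esub> \<rho> \<and>
    Idl\<^bsub>G\<^esub> \<rho> \<subseteq> J \<cdot>\<^bsub>G\<^esub> J <+>\<^bsub>G\<^esub> (J \<inter> a_kernel G (radical_tensor_algebra K A) \<phi>)"
proof -
  interpret A: assoc_algebra K A by fact
  let ?Q = "quotient_algebra A (radical A)"
  have rad: "ideal (radical A) A" by (rule A.M.radical_ideal)
  obtain B where B: "subring B A" "submodule B K A"
    "B <+>\<^bsub>A\<^esub> radical A = carrier A" "B \<inter> radical A = {\<zero>\<^bsub>A\<^esub>}"
    using \<open>splits_over_radical K A\<close> unfolding splits_over_radical_def by blast
  obtain \<epsilon> where \<epsilon>: "\<epsilon> \<in> alg_hom K ?Q A" "\<And>X. X \<in> carrier ?Q \<Longrightarrow> \<epsilon> X \<in> X"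
    using A.splitting_alg_hom[OF rad B] by blast
  \<comment> \<open>The hypothesis concerns the product ideal, of which each single product is an
    element.\<close>
  have square: "x \<otimes>\<^bsub>A\<^esub> y = \<zero>\<^bsub>A\<^esub>" if "x \<in> radical A" "y \<in> radical A" for x y
    using ideal_prod.prod[OF that, of A] assms(4) by simp
  interpret quiver_split K A \<epsilon> m C e \<Delta> X g
  proof (intro quiver_split.intro radical_split.intro radical_split_axioms.intro
      quiver_split_axioms.intro)
    show "assoc_algebra K A" by fact
    show "simple_decomposition K ?Q m C e" by fact
    show "fin_digraph \<Delta>" "verts \<Delta> = {1..m}"
      using \<open>is_quiver_of K A m C \<Delta>\<close> by (auto simp: is_quiver_of_def)
    fix i j assume "i \<in> {1..m}" "j \<in> {1..m}"
    then show "bimodule_generators (coset_lact A) (coset_ract A) (C i) (C j)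
        (radical_part K A C i j) (X i j)" "X i j = g ` arcs_between \<Delta> i j"
      using \<open>arrow_generators K A m C \<Delta> X g\<close> by (auto simp: arrow_generators_def bij_betw_def)
  qed (use square \<epsilon> in auto)
  obtain \<psi> where \<psi>: "\<psi> \<in> alg_hom K (gpath_algebra K \<Delta> \<A>) A"
    "\<And>p. D.gpath_valid \<A> p \<Longrightarrow> \<psi> (gpath_class K \<Delta> \<A> p) = path_value p"
    using path_value_alg_hom unfolding \<A>_def by blast
  show ?thesis
    using presentation_by_kernel_relations[OF \<psi>[unfolded \<A>_def] assms(12)[unfolded \<A>_def]]
    unfolding G_def J_def \<A>_def .
qed

end
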